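(* Let $n\ge3$ and $1<p<\infty$. If $L\in\mathcal{S}^n$, then for every $\tau\in[-1,1]$, $$V(L)^{-n/p-1}\,V(\mathrm{M}_p^\tau L)\ge V(B)^{-n/p},$$ with equality if and only if $L$ is an ellipsoid centered at the origin.
   Context: $V$ is volume and $B$ is the Euclidean unit ball in $\mathbb{R}^n$. For a compact set $L\subset\mathbb{R}^n$ star-shaped with respect to the origin, the radial function is $\rho(L,x)=\max\{\lambda\ge0:\lambda x\in L\}$, $x\in\mathbb{R}^n\setminus\{0\}$; $L$ is a star body if $\rho(L,\cdot)$ is positive and continuous. $\mathcal{S}^n$ is the set of star bodies in $\mathbb{R}^n$. The support function of a convex body $K$ is $h(K,x)=\max\{x\cdot y:y\in K\}$. Let $c_{n,p}=\dfrac{\Gamma\left(\frac{n+p}{2}\right)}{\pi^{(n-1)/2}\,\Gamma\left(\frac{1+p}{2}\right)}$ and, for $\tau\in[-1,1]$, $c_{n,p}(\tau)=\dfrac{c_{n,p}}{(1+\tau)^p+(1-\tau)^p}$ and $\varphi_\tau(t)=|t|+\tau t$. For $L\in\mathcal{S}^n$, $\mathrm{M}_p^\tau L$ is the convex body (containing the origin in its interior) with $$h(\mathrm{M}_p^\tau L,u)^p=c_{n,p}(\tau)\int_{S^{n-1}}\varphi_\tau(u\cdot v)^p\,\rho(L,v)^{n+p}\,dv,\qquad u\in S^{n-1},$$ where $dv$ is spherical Lebesgue measure. *)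

theory Defs
  imports "HOL-Analysis.Analysis"
begin

section \<open>Star bodies\<close>

definition star_shaped_origin :: "'a::real_vector set \<Rightarrow> bool" where
  "star_shaped_origin L \<longleftrightarrow> 0 \<in> L \<and> (\<forall>x\<in>L. closed_segment 0 x \<subseteq> L)"

text \<open>For a compact set \<open>L\<close> containing \<open>0\<close> and \<open>x \<noteq> 0\<close> the supremum is attained, i.e. it is a
  maximum (\<^const>\<open>Max\<close> is reserved for finite sets).\<close>

definition radial_fun :: "'a::real_vector set \<Rightarrow> 'a \<Rightarrow> real" where
  "radial_fun L x = Sup {l. 0 \<le> l \<and> l *\<^sub>R x \<in> L}"

definition star_body :: "'a::euclidean_space set \<Rightarrow> bool" where
  "star_body L \<longleftrightarrow> compact L \<and> star_shaped_origin L \<and>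
     (\<forall>x. x \<noteq> 0 \<longrightarrow> 0 < radial_fun L x) \<and> continuous_on (- {0}) (radial_fun L)"


section \<open>Convex bodies\<close>

definition convex_body :: "'a::euclidean_space set \<Rightarrow> bool" where
  "convex_body K \<longleftrightarrow> convex K \<and> compact K \<and> interior K \<noteq> {}"

text \<open>Again the supremum is a maximum when \<open>K\<close> is compact and nonempty.\<close>

definition support_fun :: "'a::euclidean_space set \<Rightarrow> 'a \<Rightarrow> real" where
  "support_fun K x = (SUP y\<in>K. x \<bullet> y)"

definition centered_ellipsoid :: "'a::euclidean_space set \<Rightarrow> bool" where
  "centered_ellipsoid E \<longleftrightarrow> (\<exists>f :: 'a \<Rightarrow> 'a. linear f \<and> bij f \<and> E = f ` cball 0 1)"


section \<open>Spherical Lebesgue measure\<close>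

text \<open>The unnormalised surface measure of the unit sphere, in its polar-coordinate description:
  the measure of \<open>A\<close> is the dimension times the volume of the cone
  \<open>{x. 0 < norm x \<le> 1 \<and> x /\<^sub>R norm x \<in> A}\<close> over \<open>A\<close>.\<close>

definition sphere_measure :: "'a::euclidean_space measure" where
  "sphere_measure = scale_measure (of_nat DIM('a))
     (distr (restrict_space lborel (cball 0 1 - {0})) (restrict_space borel (sphere 0 1))
        (\<lambda>x. x /\<^sub>R norm x))"

lemma space_sphere_measure: "space (sphere_measure :: 'a::euclidean_space measure) = sphere 0 1"
  by (simp add: sphere_measure_def space_scale_measure space_restrict_space)

lemma sets_sphere_measure:
  "sets (sphere_measure :: 'a::euclidean_space measure) = sets (restrict_space borel (sphere 0 1))"
  by (simp add: sphere_measure_def)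

lemma emeasure_sphere_measure:
  fixes A :: "'a::euclidean_space set"
  assumes "A \<in> sets sphere_measure"
  shows "emeasure sphere_measure A =
    of_nat DIM('a) * emeasure lborel {x. 0 < norm x \<and> norm x \<le> 1 \<and> x /\<^sub>R norm x \<in> A}"
proof -
  let ?R = "restrict_space lborel (cball 0 1 - {0}) :: 'a measure"
  have A: "A \<in> sets (restrict_space borel (sphere 0 1))"
    using assms by (simp add: sets_sphere_measure)
  have "(\<lambda>x::'a. x /\<^sub>R norm x) \<in> borel_measurable ?R"
    by (intro measurable_restrict_space1) simp
  then have m: "(\<lambda>x. x /\<^sub>R norm x) \<in> measurable ?R (restrict_space borel (sphere 0 1))"
    by (intro measurable_restrict_space2) (auto simp: space_restrict_space)
  have e: "(\<lambda>x. x /\<^sub>R norm x) -` A \<inter> (cball 0 1 - {0}) = {x. 0 < norm x \<and> norm x \<le> 1 \<and> x /\<^sub>R norm x \<in> A}"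
    by auto
  have "emeasure ?R {x. 0 < norm x \<and> norm x \<le> 1 \<and> x /\<^sub>R norm x \<in> A} =
      emeasure lborel {x. 0 < norm x \<and> norm x \<le> 1 \<and> x /\<^sub>R norm x \<in> A}"
    by (intro emeasure_restrict_space) auto
  then show ?thesis
    unfolding sphere_measure_def
    by (simp add: emeasure_distr[OF m A] space_restrict_space e del: zero_less_norm_iff)
qed


section \<open>Asymmetric \<open>L\<^sub>p\<close> moment bodies\<close>

definition moment_const :: "nat \<Rightarrow> real \<Rightarrow> real" where
  "moment_const n p =
     Gamma ((real n + p) / 2) / (pi powr ((real n - 1) / 2) * Gamma ((1 + p) / 2))"

definition moment_const_tau :: "nat \<Rightarrow> real \<Rightarrow> real \<Rightarrow> real" where
  "moment_const_tau n p \<tau> = moment_const n p / ((1 + \<tau>) powr p + (1 - \<tau>) powr p)"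

definition phi_tau :: "real \<Rightarrow> real \<Rightarrow> real" where
  "phi_tau \<tau> t = \<bar>t\<bar> + \<tau> * t"

definition moment_body :: "real \<Rightarrow> real \<Rightarrow> 'a::euclidean_space set \<Rightarrow> 'a set" where
  "moment_body p \<tau> L = (THE K. convex_body K \<and> 0 \<in> interior K \<and>
     (\<forall>u\<in>sphere 0 1. support_fun K u powr p =
        moment_const_tau DIM('a) p \<tau> *
        (\<integral>v. phi_tau \<tau> (u \<bullet> v) powr p * radial_fun L v powr (real DIM('a) + p) \<partial>sphere_measure)))"

end

theory Submission
  imports Defs
begin

text \<open>
  Put \<open>W s = \<phi>\<^sub>\<tau>(s)\<^sup>p\<close>. In polar coordinates the spherical integral defining the moment body becomes
  \<open>h(M L, u)\<^sup>p = C \<integral>\<^sub>L W(u \<bullet> x) dx\<close>, where \<open>C\<close> is normalized by \<open>M B = B\<close>. The right-hand side makes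
  sense for every bounded Borel set \<open>A\<close> that contains a neighbourhood of the origin; its support
  function is \<open>supp A\<close> below and the convex body itself is \<open>mbody A\<close>. In this generality \<open>L\<close> can be replaced by its
  Steiner symmetral \<open>S\<^sub>e L\<close>, which need not be a star body.

  The inequality. The chord over \<open>x \<bottom> e\<close>, in the direction \<open>e\<close>, of a convex body with support function
  \<open>h\<close> has length \<open>inf h(u) + h(w) - (u + w) \<bullet> x\<close> over all \<open>u \<bullet> e = 1\<close>, \<open>w \<bullet> e = -1\<close>. Therefore
  the chords of \<open>M (S\<^sub>e A)\<close> are no longer than those of \<open>M A\<close> as soon as
  \<open>h(M (S\<^sub>e A), u + w \<plusminus> 2 e) \<le> h(M A, u) + h(M A, w)\<close> (\<open>supp_steiner_le\<close>). This is a Minkowski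
  inequality between two different sets. Written with weights \<open>\<alpha>\<close> and \<open>1 - \<alpha>\<close>, it
  follows by integrating a one-dimensional inequality over the lines parallel to \<open>e\<close>
  (\<open>line_rearrangement\<close>), which combines the bathtub principle and the convexity of \<open>W\<close>. So
  symmetrization does not increase \<open>V(M A)\<close>. A set that differs from the ball of
  its volume has a symmetral that is closer to that ball by a definite amount (\<open>steiner_improvement\<close>); hence finitely
  many symmetrizations bring it arbitrarily close, and \<open>V(M L)\<close> is at least the
  volume of the moment body of a ball (\<open>measure_mbody_ge\<close>).

  Equality. If \<open>L\<close> is extremal then \<open>V(M (S\<^sub>e L)) = V(M L)\<close> for every direction \<open>e\<close>, and the
  one-dimensional inequality is an equality on almost every line parallel to \<open>e\<close>
  (\<open>equality_on_lines\<close>). When the lines approach the one through the origin, this shows that the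
  origin bisects the chord of \<open>L\<close> on it (\<open>symmetric_of_equality\<close>). So \<open>L = - L\<close>, and then \<open>w = - u\<close>: now the
  equality on lines says that the chords of \<open>L\<close> parallel to \<open>e\<close> have their midpoints on the hyperplane
  orthogonal to \<open>u\<close> (\<open>chords_centred_of_equality\<close>), so the reflection \<open>z - 2 (u \<bullet> z) e\<close> maps \<open>L\<close> to itself. In coordinates that are
  orthonormal for the second moments of \<open>L\<close>, these are orthogonal reflections in all directions, and
  \<open>L\<close> is a ball (\<open>ellipsoid_of_reflections\<close>). Conversely, the ratio of the
  volumes is invariant under linear maps (\<open>measure_mbody_ellipsoid\<close>).
\<close>



section \<open>Integration along parallel lines and along rays\<close>

lemma nn_integral_lborel_translate:
  fixes f :: "'a::euclidean_space \<Rightarrow> ennreal"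
  assumes [measurable]: "f \<in> borel_measurable borel"
  shows "(\<integral>\<^sup>+x. f (a + x) \<partial>lborel) = (\<integral>\<^sup>+x. f x \<partial>lborel)"
proof -
  have "(\<integral>\<^sup>+x. f x \<partial>lborel) = (\<integral>\<^sup>+x. f x \<partial>distr lborel borel ((+) a))"
    by (simp add: lborel_distr_plus)
  also have "\<dots> = (\<integral>\<^sup>+x. f (a + x) \<partial>lborel)"
    by (subst nn_integral_distr) auto
  finally show ?thesis ..
qed

lemma nn_integral_lborel_scale:
  fixes f :: "'a::euclidean_space \<Rightarrow> ennreal"
  assumes [measurable]: "f \<in> borel_measurable borel" and c: "c \<noteq> 0"
  shows "(\<integral>\<^sup>+x. f x \<partial>lborel) = ennreal (\<bar>c\<bar> ^ DIM('a)) * (\<integral>\<^sup>+x. f (c *\<^sub>R x) \<partial>lborel)"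
  by (subst lborel_affine[OF c, of 0]) (simp add: nn_integral_density nn_integral_distr nn_integral_cmult)

lemma nn_integral_lborel_reflect:
  fixes f :: "real \<Rightarrow> ennreal"
  assumes [measurable]: "f \<in> borel_measurable borel"
  shows "(\<integral>\<^sup>+t. f (a - t) \<partial>lborel) = (\<integral>\<^sup>+t. f t \<partial>lborel)"
  using nn_integral_real_affine[of f "-1" a] by simp

lemma emeasure_ball_neq_0:
  fixes x :: "'a::euclidean_space"
  assumes "0 < d" shows "emeasure lborel (ball x d) \<noteq> 0"
proof -
  have "unit_ball_vol (real DIM('a)) \<noteq> 0" using unit_ball_vol_pos[of "real DIM('a)"] by linarith
  then show ?thesis using assms by (simp add: emeasure_ball)
qed

definition slab :: "'a::euclidean_space \<Rightarrow> 'a set" where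
  "slab e = {x. \<bar>x \<bullet> e\<bar> \<le> 1/2}"

lemma cball_measurable [measurable]: "cball (a::'a::euclidean_space) r \<in> sets borel"
  by simp

lemma ball_measurable [measurable]: "ball (a::'a::euclidean_space) r \<in> sets borel"
  by simp

lemma slab_borel [measurable]: "slab e \<in> sets borel"
  unfolding slab_def by measurable

text \<open>Both sides equal the double integral of \<open>f (x + t e)\<close> over \<open>t\<close> and over \<open>x\<close> in the slab:
  after translating \<open>x\<close> by \<open>- t e\<close>, each point \<open>y\<close> is hit for a set of parameters \<open>t\<close> of
  length one. So Fubini's theorem in an arbitrary direction needs no choice of coordinates.\<close>

lemma nn_integral_along_lines:
  fixes f :: "'a::euclidean_space \<Rightarrow> ennreal"
  assumes [measurable]: "f \<in> borel_measurable borel" and e: "norm e = 1"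
  shows "(\<integral>\<^sup>+x. f x \<partial>lborel) =
    (\<integral>\<^sup>+x. indicator (slab e) x * (\<integral>\<^sup>+t. f (x + t *\<^sub>R e) \<partial>lborel) \<partial>lborel)"
proof -
  have ee: "e \<bullet> e = 1" using e by (simp add: norm_eq_1)
  have "(\<integral>\<^sup>+x. indicator (slab e) x * (\<integral>\<^sup>+t. f (x + t *\<^sub>R e) \<partial>lborel) \<partial>lborel)
     = (\<integral>\<^sup>+x. (\<integral>\<^sup>+t. indicator (slab e) x * f (x + t *\<^sub>R e) \<partial>lborel) \<partial>lborel)"
    by (intro nn_integral_cong nn_integral_cmult[symmetric]) measurable
  also have "\<dots> = (\<integral>\<^sup>+t. (\<integral>\<^sup>+x. indicator (slab e) x * f (x + t *\<^sub>R e) \<partial>lborel) \<partial>lborel)"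
    by (intro lborel_pair.Fubini') measurable
  also have "\<dots> = (\<integral>\<^sup>+t. (\<integral>\<^sup>+y. indicator (slab e) (y - t *\<^sub>R e) * f y \<partial>lborel) \<partial>lborel)"
  proof (rule nn_integral_cong)
    fix t :: real
    have "(\<integral>\<^sup>+y. indicator (slab e) (y - t *\<^sub>R e) * f y \<partial>lborel)
      = (\<integral>\<^sup>+x. indicator (slab e) ((t *\<^sub>R e + x) - t *\<^sub>R e) * f (t *\<^sub>R e + x) \<partial>lborel)"
      by (rule nn_integral_lborel_translate[symmetric]) measurable
    then show "(\<integral>\<^sup>+x. indicator (slab e) x * f (x + t *\<^sub>R e) \<partial>lborel) =
        (\<integral>\<^sup>+y. indicator (slab e) (y - t *\<^sub>R e) * f y \<partial>lborel)"
      by (simp add: add.commute)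
  qed
  also have "\<dots> = (\<integral>\<^sup>+y. (\<integral>\<^sup>+t. indicator (slab e) (y - t *\<^sub>R e) * f y \<partial>lborel) \<partial>lborel)"
    by (intro lborel_pair.Fubini') measurable
  also have "\<dots> = (\<integral>\<^sup>+y. (\<integral>\<^sup>+t. f y * indicator {y \<bullet> e - 1/2 .. y \<bullet> e + 1/2} t \<partial>lborel) \<partial>lborel)"
  proof (intro nn_integral_cong)
    fix y t
    have "y - t *\<^sub>R e \<in> slab e \<longleftrightarrow> t \<in> {y \<bullet> e - 1/2 .. y \<bullet> e + 1/2}"
      unfolding slab_def by (auto simp: inner_diff_left ee abs_if field_simps)
    then show "indicator (slab e) (y - t *\<^sub>R e) * f y = f y * indicator {y \<bullet> e - 1/2 .. y \<bullet> e + 1/2} t"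
      by (simp add: indicator_def)
  qed
  also have "\<dots> = (\<integral>\<^sup>+y. f y \<partial>lborel)"
    by (intro nn_integral_cong, subst nn_integral_cmult_indicator) auto
  finally show ?thesis ..
qed

lemma nn_integral_mono_lines:
  fixes f g :: "'a::euclidean_space \<Rightarrow> ennreal"
  assumes [measurable]: "f \<in> borel_measurable borel" "g \<in> borel_measurable borel" and e: "norm e = 1"
    and "\<And>x. (\<integral>\<^sup>+t. f (x + t *\<^sub>R e) \<partial>lborel) \<le> (\<integral>\<^sup>+t. g (x + t *\<^sub>R e) \<partial>lborel)"
  shows "(\<integral>\<^sup>+x. f x \<partial>lborel) \<le> (\<integral>\<^sup>+x. g x \<partial>lborel)"
  unfolding nn_integral_along_lines[OF assms(1) e] nn_integral_along_lines[OF assms(2) e]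
  by (intro nn_integral_mono mult_left_mono assms) auto

lemma nn_integral_eq_AE_eq:
  assumes [measurable]: "f \<in> borel_measurable M" "g \<in> borel_measurable M"
    and le: "\<And>x. f x \<le> g x" and eq: "integral\<^sup>N M f = integral\<^sup>N M g" and fin: "integral\<^sup>N M f \<noteq> \<infinity>"
  shows "AE x in M. f x = (g x :: ennreal)"
proof -
  have "(\<integral>\<^sup>+x. g x - f x \<partial>M) = integral\<^sup>N M g - integral\<^sup>N M f"
    by (rule nn_integral_diff) (use fin le in auto)
  also have "\<dots> = 0" using eq fin by (auto simp: top.not_eq_extremum)
  finally have "AE x in M. g x - f x = 0"
    by (subst (asm) nn_integral_0_iff_AE) auto
  moreover have "AE x in M. f x \<noteq> \<infinity>"
    using fin by (rule nn_integral_noteq_infinite[rotated]) auto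
  ultimately show ?thesis
  proof eventually_elim
    case (elim x)
    then show ?case using le[of x] by (metis add.right_neutral diff_add_cancel_ennreal add_0)
  qed
qed

lemma AE_eq_on_lines:
  fixes f g :: "'a::euclidean_space \<Rightarrow> ennreal"
  assumes [measurable]: "f \<in> borel_measurable borel" "g \<in> borel_measurable borel" and e: "norm e = 1"
    and le: "\<And>x. (\<integral>\<^sup>+t. f (x + t *\<^sub>R e) \<partial>lborel) \<le> (\<integral>\<^sup>+t. g (x + t *\<^sub>R e) \<partial>lborel)"
    and eq: "(\<integral>\<^sup>+x. f x \<partial>lborel) = (\<integral>\<^sup>+x. g x \<partial>lborel)" and fin: "(\<integral>\<^sup>+x. f x \<partial>lborel) \<noteq> \<infinity>"
  shows "AE x in lborel. x \<in> slab e \<longrightarrow>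
     (\<integral>\<^sup>+t. f (x + t *\<^sub>R e) \<partial>lborel) = (\<integral>\<^sup>+t. g (x + t *\<^sub>R e) \<partial>lborel)"
proof -
  have "AE x in lborel. indicator (slab e) x * (\<integral>\<^sup>+t. f (x + t *\<^sub>R e) \<partial>lborel) =
     indicator (slab e) x * (\<integral>\<^sup>+t. g (x + t *\<^sub>R e) \<partial>lborel)"
    using eq fin unfolding nn_integral_along_lines[OF assms(1) e] nn_integral_along_lines[OF assms(2) e]
    by (intro nn_integral_eq_AE_eq) (auto intro!: mult_left_mono le)
  then show ?thesis by eventually_elim (auto split: split_indicator_asm)
qed

lemma nn_integral_powr_atLeast:
  assumes a: "a > 0" and c: "c > 0"
  shows "(\<integral>\<^sup>+s. ennreal (a * (c / s) powr a / s) * indicator {c..} s \<partial>lborel) = 1"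
proof -
  have "((\<lambda>s. - ((c / s) powr a)) \<longlongrightarrow> 0) at_top"
  proof -
    have "((\<lambda>s. (c / s) powr a) \<longlongrightarrow> 0) at_top"
      using a c
      by (intro tendsto_zero_powrI[where b=a] tendsto_divide_0[OF tendsto_const]
          filterlim_at_top_imp_at_infinity filterlim_ident) (auto intro: eventually_mono[OF eventually_gt_at_top[of 0]])
    then show ?thesis using tendsto_minus by fastforce
  qed
  then have "(\<integral>\<^sup>+s. ennreal (a * (c / s) powr a / s) * indicator {c..} s \<partial>lborel) = ennreal (0 - (- ((c / c) powr a)))"
  proof (intro nn_integral_FTC_atLeast[where F="\<lambda>s. - ((c / s) powr a)"])
    fix s assume "c \<le> s"
    then have s: "s > 0" using c by simp
    show "((\<lambda>s. - ((c / s) powr a)) has_real_derivative a * (c / s) powr a / s) (at s)"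
      using s c by (auto intro!: derivative_eq_intros simp: field_simps powr_diff powr_minus powr_divide)
  qed (use a c in auto)
  then show ?thesis using c by simp
qed

text \<open>Polar coordinates. As for parallel lines, both sides are a double integral over a point and a
  dilation factor \<open>s\<close>; the weight \<open>n \<bar>x\<bar>\<^sup>n\<close> on the unit ball is chosen so that,
  after rescaling, it integrates to one over the factors \<open>s\<close> for every point.\<close>

lemma nn_integral_along_rays:
  fixes f :: "'a::euclidean_space \<Rightarrow> ennreal"
  assumes [measurable]: "f \<in> borel_measurable borel"
  defines "n \<equiv> DIM('a)"
  shows "(\<integral>\<^sup>+x. f x \<partial>lborel) =
    (\<integral>\<^sup>+x. indicator (cball 0 1) x * ennreal (n * norm x ^ n) *
        (\<integral>\<^sup>+s. indicator {0<..} s * (f (s *\<^sub>R x) * ennreal (s ^ (n - 1))) \<partial>lborel) \<partial>lborel)"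
proof -
  have n: "n > 0" by (simp add: n_def)
  have "(\<integral>\<^sup>+x. indicator (cball 0 1) x * ennreal (n * norm x ^ n) *
        (\<integral>\<^sup>+s. indicator {0<..} s * (f (s *\<^sub>R x) * ennreal (s ^ (n - 1))) \<partial>lborel) \<partial>lborel)
    = (\<integral>\<^sup>+x. (\<integral>\<^sup>+s. indicator {0<..} s * ennreal (s ^ (n - 1)) *
         (indicator (cball 0 1) x * ennreal (n * norm x ^ n) * f (s *\<^sub>R x)) \<partial>lborel) \<partial>lborel)"
    by (subst nn_integral_cmult[symmetric]) (auto simp: ac_simps)
  also have "\<dots> = (\<integral>\<^sup>+s. (\<integral>\<^sup>+x. indicator {0<..} s * ennreal (s ^ (n - 1)) *
         (indicator (cball 0 1) x * ennreal (n * norm x ^ n) * f (s *\<^sub>R x)) \<partial>lborel) \<partial>lborel)"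
    by (intro lborel_pair.Fubini') measurable
  also have "\<dots> = (\<integral>\<^sup>+s. (\<integral>\<^sup>+y. (if norm y \<le> s \<and> 0 < s then
      ennreal (n * (norm y / s) ^ n / s) * f y else 0) \<partial>lborel) \<partial>lborel)"
  proof (rule nn_integral_cong)
    fix s :: real
    show "(\<integral>\<^sup>+x. indicator {0<..} s * ennreal (s ^ (n - 1)) *
         (indicator (cball 0 1) x * ennreal (n * norm x ^ n) * f (s *\<^sub>R x)) \<partial>lborel) =
       (\<integral>\<^sup>+y. (if norm y \<le> s \<and> 0 < s then
      ennreal (n * (norm y / s) ^ n / s) * f y else 0) \<partial>lborel)"
    proof (cases "s > 0")
      case True
      have pw: "s ^ n = s * s ^ (n - 1)" using n by (cases n) auto
      have "(\<integral>\<^sup>+y. (if norm y \<le> s \<and> 0 < s then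
          ennreal (n * (norm y / s) ^ n / s) * f y else 0) \<partial>lborel)
        = ennreal (\<bar>s\<bar> ^ n) * (\<integral>\<^sup>+x. (if norm (s *\<^sub>R x) \<le> s \<and> 0 < s then
          ennreal (n * (norm (s *\<^sub>R x) / s) ^ n / s) * f (s *\<^sub>R x) else 0) \<partial>lborel)"
        unfolding n_def by (rule nn_integral_lborel_scale) (measurable, use True in simp)
      also have "\<dots> = (\<integral>\<^sup>+x. ennreal (\<bar>s\<bar> ^ n) * (if norm (s *\<^sub>R x) \<le> s \<and> 0 < s then
          ennreal (n * (norm (s *\<^sub>R x) / s) ^ n / s) * f (s *\<^sub>R x) else 0) \<partial>lborel)"
        by (rule nn_integral_cmult[symmetric]) measurable
      also have "\<dots> = (\<integral>\<^sup>+x. indicator {0<..} s * ennreal (s ^ (n - 1)) *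
         (indicator (cball 0 1) x * ennreal (n * norm x ^ n) * f (s *\<^sub>R x)) \<partial>lborel)"
      proof (rule nn_integral_cong)
        fix x :: 'a
        have "ennreal (s ^ n) * ennreal (n * norm x ^ n / s) = ennreal (s ^ (n - 1)) * ennreal (n * norm x ^ n)"
          using True by (simp add: pw flip: ennreal_mult)
        then show "ennreal (\<bar>s\<bar> ^ n) * (if norm (s *\<^sub>R x) \<le> s \<and> 0 < s then
          ennreal (n * (norm (s *\<^sub>R x) / s) ^ n / s) * f (s *\<^sub>R x) else 0) =
          indicator {0<..} s * ennreal (s ^ (n - 1)) *
         (indicator (cball 0 1) x * ennreal (n * norm x ^ n) * f (s *\<^sub>R x))"
          using True by (auto split: split_indicator simp: mult.assoc[symmetric] mult_le_cancel_left)
      qed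
      finally show ?thesis ..
    qed simp
  qed
  also have "\<dots> = (\<integral>\<^sup>+y. (\<integral>\<^sup>+s. (if norm y \<le> s \<and> 0 < s then
      ennreal (n * (norm y / s) ^ n / s) * f y else 0) \<partial>lborel) \<partial>lborel)"
    by (rule lborel_pair.Fubini') measurable
  also have "\<dots> = (\<integral>\<^sup>+y. f y \<partial>lborel)"
  proof (rule nn_integral_cong_AE, use AE_lborel_singleton[of 0] in eventually_elim)
    case (elim y)
    then have y: "norm y > 0" by simp
    have "(\<integral>\<^sup>+s. (if norm y \<le> s \<and> 0 < s then ennreal (n * (norm y / s) ^ n / s) * f y else 0) \<partial>lborel)
      = (\<integral>\<^sup>+s. ennreal (real n * (norm y / s) powr real n / s) * indicator {norm y..} s * f y \<partial>lborel)"
    proof (rule nn_integral_cong)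
      fix s :: real
      show "(if norm y \<le> s \<and> 0 < s then ennreal (n * (norm y / s) ^ n / s) * f y else 0)
        = ennreal (real n * (norm y / s) powr real n / s) * indicator {norm y..} s * f y"
      proof (cases "norm y \<le> s")
        case True
        then have "s > 0" "norm y / s > 0" using y by (auto simp del: zero_less_norm_iff)
        then show ?thesis by (simp add: powr_realpow ac_simps)
      qed simp
    qed
    also have "\<dots> = (\<integral>\<^sup>+s. ennreal (real n * (norm y / s) powr real n / s) * indicator {norm y..} s \<partial>lborel) * f y"
      by (rule nn_integral_multc) measurable
    also have "\<dots> = f y" using nn_integral_powr_atLeast[of "real n" "norm y"] n y by simp
    finally show ?case .
  qed
  finally show ?thesis ..
qed

section \<open>The weight and its one-dimensional rearrangement inequality\<close>

locale moment_weight =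
  fixes p \<tau> :: real
  assumes p: "1 < p" and tau: "-1 \<le> \<tau>" "\<tau> \<le> 1"
begin

definition W :: "real \<Rightarrow> real" where
  "W s = phi_tau \<tau> s powr p"

lemma tau_mult_le: "\<bar>\<tau> * s\<bar> \<le> \<bar>s\<bar>"
  using tau mult_right_mono[of "\<bar>\<tau>\<bar>" 1 "\<bar>s\<bar>"] by (simp add: abs_mult)

lemma phi_nonneg: "0 \<le> phi_tau \<tau> s"
  using tau_mult_le[of s] by (simp add: phi_tau_def)

lemma phi_le: "phi_tau \<tau> s \<le> 2 * \<bar>s\<bar>"
  using tau_mult_le[of s] by (simp add: phi_tau_def)

lemma phi_add: "phi_tau \<tau> (s + t) \<le> phi_tau \<tau> s + phi_tau \<tau> t"
  by (simp add: phi_tau_def distrib_left)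

lemma phi_scale: "c \<ge> 0 \<Longrightarrow> phi_tau \<tau> (c * s) = c * phi_tau \<tau> s"
  by (simp add: phi_tau_def abs_mult algebra_simps)

lemma W_nonneg [simp]: "0 \<le> W s"
  by (simp add: W_def)

lemma W_0 [simp]: "W 0 = 0"
  by (simp add: W_def phi_tau_def)

lemma W_scale: "c \<ge> 0 \<Longrightarrow> W (c * s) = c powr p * W s"
  by (simp add: W_def phi_scale powr_mult phi_nonneg)

lemma W_continuous: "continuous_on S W"
  unfolding W_def phi_tau_def using p phi_nonneg
  by (intro continuous_on_powr' continuous_intros) (auto simp: phi_tau_def)

lemma W_measurable [measurable]: "W \<in> borel_measurable borel"
  by (intro borel_measurable_continuous_onI W_continuous)

lemma W_le: "W s \<le> (2 * \<bar>s\<bar>) powr p"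
  unfolding W_def by (intro powr_mono2 phi_nonneg phi_le) (use p in auto)

lemma W_nonneg_arg: "s \<ge> 0 \<Longrightarrow> W s = (1 + \<tau>) powr p * s powr p"
  using tau by (simp add: W_def phi_tau_def flip: powr_mult) (simp add: algebra_simps)

lemma W_minus: "s \<ge> 0 \<Longrightarrow> W (- s) = (1 - \<tau>) powr p * s powr p"
  using tau by (simp add: W_def phi_tau_def flip: powr_mult) (simp add: algebra_simps)

definition weight_sum :: real where
  "weight_sum = (1 + \<tau>) powr p + (1 - \<tau>) powr p"

lemma weight_sum_pos: "weight_sum > 0"
proof -
  have "1 + \<tau> > 0 \<or> 1 - \<tau> > 0" by linarith
  then show ?thesis unfolding weight_sum_def
    by (metis add_nonneg_pos add_pos_nonneg powr_ge_zero powr_gt_zero less_irrefl)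
qed

lemma W_symmetrize: "W s + W (- s) = weight_sum * \<bar>s\<bar> powr p"
  using W_nonneg_arg[of s] W_minus[of s] W_nonneg_arg[of "- s"] W_minus[of "- s"]
  by (cases "s \<ge> 0") (simp_all add: weight_sum_def algebra_simps)

lemma W_mono: "0 \<le> s \<Longrightarrow> s \<le> t \<Longrightarrow> W s \<le> W t"
  using p by (simp add: W_nonneg_arg mult_left_mono powr_mono2)

lemma W_antimono: "s \<le> t \<Longrightarrow> t \<le> 0 \<Longrightarrow> W t \<le> W s"
  using p W_minus[of "-s"] W_minus[of "-t"] by (simp add: mult_left_mono powr_mono2)

text \<open>This is convexity of \<open>t\<^sup>p\<close> at the points \<open>x / \<alpha>\<close> and \<open>y / (1 - \<alpha>)\<close>. The
  minimum of the right-hand side over \<open>\<alpha>\<close> is attained and equal to the left-hand side, so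
  that proving an inequality for all \<open>\<alpha>\<close> amounts to Minkowski's inequality.\<close>

lemma powr_add_le:
  assumes "x \<ge> 0" "y \<ge> 0" and \<alpha>: "0 < \<alpha>" "\<alpha> < (1::real)"
  shows "(x + y) powr p \<le> \<alpha> powr (1 - p) * x powr p + (1 - \<alpha>) powr (1 - p) * y powr p"
proof -
  have ge1: "1 \<le> \<beta> powr (1 - p)" if "0 < \<beta>" "\<beta> < 1" for \<beta> :: real
    using that p powr_mono'[of "1 - p" 0 \<beta>] by simp
  have split: "\<beta> * (z / \<beta>) powr p = \<beta> powr (1 - p) * z powr p" if "0 < \<beta>" "0 \<le> z" for \<beta> z :: real
    using that by (simp add: powr_divide powr_diff)
  show ?thesis
  proof (cases "x = 0 \<or> y = 0")
    case True
    then show ?thesis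
      using ge1[of \<alpha>] ge1[of "1 - \<alpha>"] \<alpha> p mult_right_mono[of 1 _ "x powr p"] mult_right_mono[of 1 _ "y powr p"]
      by auto
  next
    case False
    then have xy: "x > 0" "y > 0" using assms by auto
    have "((1 - (1 - \<alpha>)) *\<^sub>R (x / \<alpha>) + (1 - \<alpha>) *\<^sub>R (y / (1 - \<alpha>))) powr p
      \<le> (1 - (1 - \<alpha>)) * (x / \<alpha>) powr p + (1 - \<alpha>) * (y / (1 - \<alpha>)) powr p"
      using p \<alpha> xy by (intro convex_onD[OF powr_convex]) auto
    then show ?thesis using \<alpha> xy split[of \<alpha> x] split[of "1 - \<alpha>" y] by simp
  qed
qed

lemma W_add_le:
  assumes \<alpha>: "0 < \<alpha>" "\<alpha> < 1"
  shows "W (s + t) \<le> \<alpha> powr (1 - p) * W s + (1 - \<alpha>) powr (1 - p) * W t"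
proof -
  have "W (s + t) \<le> (phi_tau \<tau> s + phi_tau \<tau> t) powr p"
    unfolding W_def by (intro powr_mono2 phi_nonneg phi_add) (use p in auto)
  also have "\<dots> \<le> \<alpha> powr (1 - p) * W s + (1 - \<alpha>) powr (1 - p) * W t"
    unfolding W_def by (intro powr_add_le phi_nonneg \<alpha>)
  finally show ?thesis .
qed

lemma W_convex:
  assumes l: "0 < l" "l < 1"
  shows "W ((1 - l) * s + l * t) \<le> (1 - l) * W s + l * W t"
proof -
  have "x powr (1 - p) * (x powr p * w) = x * w" if "x > 0" for x w :: real
    using that by (simp add: mult.assoc[symmetric] flip: powr_add)
  with W_add_le[of "1 - l" "(1 - l) * s" "l * t"] l show ?thesis
    by (simp add: W_scale)
qed

end

text \<open>Exchanging the part of \<open>I\<close> outside \<open>A\<close> for the part of \<open>A\<close> outside \<open>I\<close>, which has the same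
  measure, replaces values below \<open>c\<close> by values above \<open>c\<close>. If the values on \<open>I\<close> are strictly below
  \<open>c\<close> then nothing can be exchanged without a gain.\<close>

lemma bathtub:
  fixes \<psi> :: "'a \<Rightarrow> real"
  assumes [measurable]: "A \<in> sets M" "I \<in> sets M" "\<psi> \<in> borel_measurable M"
    and eq: "emeasure M A = emeasure M I" and fin: "emeasure M I \<noteq> \<infinity>"
    and le: "\<And>x. x \<in> I \<Longrightarrow> \<psi> x \<le> c" and ge: "\<And>x. x \<notin> I \<Longrightarrow> c \<le> \<psi> x"
  shows "(\<integral>\<^sup>+x\<in>I. ennreal (\<psi> x) \<partial>M) \<le> (\<integral>\<^sup>+x\<in>A. ennreal (\<psi> x) \<partial>M)"
    and "(\<integral>\<^sup>+x\<in>I. ennreal (\<psi> x) \<partial>M) = (\<integral>\<^sup>+x\<in>A. ennreal (\<psi> x) \<partial>M) \<Longrightarrow> 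
      (\<And>x. x \<in> I \<Longrightarrow> 0 \<le> \<psi> x \<and> \<psi> x < c) \<Longrightarrow> emeasure M (I - A) = 0 \<and> emeasure M (A - I) = 0"
proof -
  have fin2: "emeasure M (I \<inter> A) \<noteq> \<infinity>"
    using fin emeasure_mono[of "I \<inter> A" I M] by (auto simp: top_unique)
  have "emeasure M (I \<inter> A) + emeasure M (I - A) = emeasure M I"
    by (subst plus_emeasure) (auto intro!: arg_cong[where f="emeasure M"])
  moreover have "emeasure M (I \<inter> A) + emeasure M (A - I) = emeasure M A"
    by (subst plus_emeasure) (auto intro!: arg_cong[where f="emeasure M"])
  ultimately have "emeasure M (I \<inter> A) + emeasure M (I - A) = emeasure M (I \<inter> A) + emeasure M (A - I)"
    using eq by simp
  then have diff: "emeasure M (I - A) = emeasure M (A - I)"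
    using fin2 by (simp add: ennreal_add_left_cancel)
  let ?J = "\<lambda>S. \<integral>\<^sup>+x\<in>S. ennreal (\<psi> x) \<partial>M"
  have split: "?J S = ?J (S \<inter> T) + ?J (S - T)" if [measurable]: "S \<in> sets M" "T \<in> sets M" for S T
    by (subst nn_integral_add[symmetric]) (auto intro!: nn_integral_cong split: split_indicator)
  have up: "?J (I - A) \<le> ennreal c * emeasure M (I - A)"
    by (subst nn_integral_cmult_indicator[symmetric]) (auto intro!: nn_integral_mono ennreal_leI le split: split_indicator)
  have lo: "ennreal c * emeasure M (A - I) \<le> ?J (A - I)"
    by (subst nn_integral_cmult_indicator[symmetric]) (auto intro!: nn_integral_mono ennreal_leI ge split: split_indicator)
  have ul: "?J (I - A) \<le> ?J (A - I)" using up lo diff by simp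
  show "(\<integral>\<^sup>+x\<in>I. ennreal (\<psi> x) \<partial>M) \<le> (\<integral>\<^sup>+x\<in>A. ennreal (\<psi> x) \<partial>M)"
    using split[of I A] split[of A I] ul by (simp add: Int_commute add_left_mono)
  assume eq2: "?J I = ?J A" and str: "\<And>x. x \<in> I \<Longrightarrow> 0 \<le> \<psi> x \<and> \<psi> x < c"
  have finJ: "?J S \<noteq> \<infinity>" if [measurable]: "S \<in> sets M" and S: "S \<subseteq> I" for S
  proof -
    have "?J S \<le> ennreal c * emeasure M I"
      by (subst nn_integral_cmult_indicator[symmetric])
        (use S in \<open>auto intro!: nn_integral_mono ennreal_leI le split: split_indicator\<close>)
    also have "\<dots> < \<infinity>" using fin by (simp add: ennreal_mult_less_top top.not_eq_extremum)
    finally show ?thesis by simp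
  qed
  have "?J (I \<inter> A) + ?J (I - A) = ?J (I \<inter> A) + ?J (A - I)"
    using eq2 split[of I A] split[of A I] by (simp add: Int_commute)
  then have "?J (I - A) = ?J (A - I)"
    using finJ[of "I \<inter> A"] by (simp add: ennreal_add_left_cancel)
  with up lo diff have J: "?J (I - A) = ennreal c * emeasure M (I - A)" by simp
  have "AE x in M. ennreal (\<psi> x) * indicator (I - A) x = ennreal c * indicator (I - A) x"
    using J finJ[of "I - A"] str
    by (intro nn_integral_eq_AE_eq)
      (auto simp: nn_integral_cmult_indicator intro!: ennreal_leI le split: split_indicator)
  then have "AE x in M. x \<notin> I - A"
    by eventually_elim (use str in \<open>fastforce split: split_indicator_asm simp: ennreal_inj\<close>)
  then have "emeasure M (I - A) = 0"
    using AE_iff_null_sets[of "I - A" M] by (simp add: null_sets_def)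
  then show "emeasure M (I - A) = 0 \<and> emeasure M (A - I) = 0" using diff by simp
qed

lemma convex_sublevel:
  fixes \<psi> :: "real \<Rightarrow> real"
  assumes conv: "\<And>s t l. 0 < l \<Longrightarrow> l < 1 \<Longrightarrow> \<psi> ((1 - l) * s + l * t) \<le> (1 - l) * \<psi> s + l * \<psi> t"
    and xy: "x < y" and c: "\<psi> x = c" "\<psi> y = c"
  shows "t \<in> {x<..<y} \<Longrightarrow> \<psi> t \<le> c" and "t \<notin> {x<..<y} \<Longrightarrow> c \<le> \<psi> t"
proof -
  have between: "\<psi> v \<le> max (\<psi> u) (\<psi> w) \<and>
      (\<psi> w = \<psi> v \<longrightarrow> \<psi> v \<le> \<psi> u) \<and> (\<psi> u = \<psi> v \<longrightarrow> \<psi> v \<le> \<psi> w)" if uvw: "u < v" "v < w" for u v w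
  proof -
    define l where "l = (v - u) / (w - u)"
    have l: "0 < l" "l < 1" using uvw by (auto simp: l_def)
    have "(1 - l) * u + l * w = u + l * (w - u)" by algebra
    also have "\<dots> = v" using uvw by (simp add: l_def)
    finally have *: "\<psi> v \<le> (1 - l) * \<psi> u + l * \<psi> w" using conv[OF l, of u w] by simp
    have "(1 - l) * \<psi> u + l * \<psi> w \<le> (1 - l) * max (\<psi> u) (\<psi> w) + l * max (\<psi> u) (\<psi> w)"
      using l by (intro add_mono mult_left_mono) auto
    then have 1: "\<psi> v \<le> max (\<psi> u) (\<psi> w)" using * by (simp add: algebra_simps)
    have 2: "\<psi> v \<le> \<psi> u" if "\<psi> w = \<psi> v"
    proof -
      have "(1 - l) * \<psi> v \<le> (1 - l) * \<psi> u" using * that by (simp add: algebra_simps)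
      then show ?thesis using l by simp
    qed
    have 3: "\<psi> v \<le> \<psi> w" if "\<psi> u = \<psi> v"
    proof -
      have "l * \<psi> v \<le> l * \<psi> w" using * that by (simp add: algebra_simps)
      then show ?thesis using l by simp
    qed
    show ?thesis using 1 2 3 by auto
  qed
  show "\<psi> t \<le> c" if "t \<in> {x<..<y}"
    using between[of x t y] that c by auto
  show "c \<le> \<psi> t" if "t \<notin> {x<..<y}"
    using between[of t x y] between[of x y t] that c xy by (cases "t = x \<or> t = y") auto
qed

text \<open>The difference of the values at distance \<open>l\<close> changes sign between an interval on which the function
  decreases and one on which it increases.\<close>

lemma equal_values_at_distance:
  fixes \<psi> :: "real \<Rightarrow> real"
  assumes cont: "continuous_on UNIV \<psi>" and l: "l > 0"
    and dec: "\<And>s t. s \<le> t \<Longrightarrow> t \<le> lo \<Longrightarrow> \<psi> t \<le> \<psi> s" and inc: "\<And>s t. hi \<le> s \<Longrightarrow> s \<le> t \<Longrightarrow> \<psi> s \<le> \<psi> t"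
    and "lo \<le> hi"
  shows "\<exists>m. \<psi> (m - l/2) = \<psi> (m + l/2)"
proof -
  have "\<exists>m\<ge>lo - l/2. m \<le> hi + l/2 \<and> \<psi> (m + l/2) - \<psi> (m - l/2) = 0"
  proof (rule IVT')
    show "continuous_on {lo - l/2..hi + l/2} (\<lambda>m. \<psi> (m + l/2) - \<psi> (m - l/2))"
      by (intro continuous_intros continuous_on_compose2[OF cont]) auto
  qed (use assms in \<open>auto intro: dec inc\<close>)
  then show ?thesis by (metis eq_iff_diff_eq_0)
qed

context moment_weight
begin

text \<open>Two steps make a set on a line an interval centred at \<open>0\<close>. The convex function integrated on
  the right is smallest, among sets of given length, on an interval where it takes equal values at both
  ends; on that interval, reflecting the second summand about the midpoint aligns
  the arguments \<open>a + t\<close> and \<open>b - t\<close>, whose sum is then \<open>a + b + 2 r\<close>.\<close>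

lemma line_rearrangement:
  assumes [measurable]: "A \<in> sets borel" and A: "emeasure lborel A = ennreal l" and l0: "l \<ge> 0"
    and \<alpha>: "0 < \<alpha>" "\<alpha> < 1"
  shows "(\<integral>\<^sup>+r\<in>{-(l/2)<..<l/2}. ennreal (W (a + b + 2 * r)) \<partial>lborel) \<le>
    (\<integral>\<^sup>+t\<in>A. ennreal (\<alpha> powr (1 - p) * W (a + t) + (1 - \<alpha>) powr (1 - p) * W (b - t)) \<partial>lborel)"
proof (cases "l = 0")
  case False
  then have l: "l > 0" using l0 by simp
  define P where "P = \<alpha> powr (1 - p)"
  define Q where "Q = (1 - \<alpha>) powr (1 - p)"
  have PQ: "P \<ge> 0" "Q \<ge> 0" by (auto simp: P_def Q_def)
  define \<psi> where "\<psi> t = P * W (a + t) + Q * W (b - t)" for t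
  have cont: "continuous_on UNIV \<psi>" unfolding \<psi>_def
    by (intro continuous_intros continuous_on_compose2[OF W_continuous[of UNIV]]) auto
  have [measurable]: "\<psi> \<in> borel_measurable borel" unfolding \<psi>_def by measurable
  have conv: "\<psi> ((1 - k) * s + k * t) \<le> (1 - k) * \<psi> s + k * \<psi> t" if k: "0 < k" "k < 1" for s t k
  proof -
    have 1: "W (a + ((1 - k) * s + k * t)) \<le> (1 - k) * W (a + s) + k * W (a + t)"
      using W_convex[OF k, of "a + s" "a + t"] by (simp add: algebra_simps)
    have 2: "W (b - ((1 - k) * s + k * t)) \<le> (1 - k) * W (b - s) + k * W (b - t)"
      using W_convex[OF k, of "b - s" "b - t"] by (simp add: algebra_simps)
    show ?thesis using mult_left_mono[OF 1 PQ(1)] mult_left_mono[OF 2 PQ(2)]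
      unfolding \<psi>_def by (simp add: algebra_simps)
  qed
  \<comment> \<open>Outside the points \<open>- a\<close> and \<open>b\<close> both summands increase, or both decrease.\<close>
  obtain m where m: "\<psi> (m - l/2) = \<psi> (m + l/2)"
  proof (rule exE[OF equal_values_at_distance[OF cont l, of "min (-a) b" "max (-a) b"]])
    show "\<psi> t \<le> \<psi> s" if "s \<le> t" "t \<le> min (-a) b" for s t
      unfolding \<psi>_def using that by (intro add_mono mult_left_mono PQ W_mono W_antimono) auto
    show "\<psi> s \<le> \<psi> t" if "s \<le> t" "max (-a) b \<le> s" for s t
      unfolding \<psi>_def using that by (intro add_mono mult_left_mono PQ W_mono W_antimono) auto
  qed auto
  let ?I = "{m - l/2<..<m + l/2}"
  have lr: "m - l/2 < m + l/2" using l by simp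
  note sub = convex_sublevel[OF conv lr m refl]
  have "(\<integral>\<^sup>+r\<in>{-(l/2)<..<l/2}. ennreal (W (a + b + 2 * r)) \<partial>lborel) \<le>
     (\<integral>\<^sup>+r\<in>{-(l/2)<..<l/2}. ennreal (P * W (a + (m + r)) + Q * W (b - (m - r))) \<partial>lborel)"
  proof (intro nn_integral_mono mult_right_mono ennreal_leI)
    fix r
    show "W (a + b + 2 * r) \<le> P * W (a + (m + r)) + Q * W (b - (m - r))"
      using W_add_le[OF \<alpha>, of "a + (m + r)" "b - (m - r)"] by (simp add: P_def Q_def algebra_simps)
  qed simp
  also have "\<dots> = (\<integral>\<^sup>+r\<in>{-(l/2)<..<l/2}. ennreal (P * W (a + (m + r))) \<partial>lborel) +
      (\<integral>\<^sup>+r\<in>{-(l/2)<..<l/2}. ennreal (Q * W (b - (m - r))) \<partial>lborel)"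
    by (subst nn_integral_add[symmetric])
      (auto intro!: nn_integral_cong simp: PQ distrib_right)
  also have "(\<integral>\<^sup>+r\<in>{-(l/2)<..<l/2}. ennreal (P * W (a + (m + r))) \<partial>lborel)
     = (\<integral>\<^sup>+t\<in>?I. ennreal (P * W (a + t)) \<partial>lborel)"
    by (subst nn_integral_lborel_translate[of _ m, symmetric])
      (auto intro!: nn_integral_cong split: split_indicator)
  also have "(\<integral>\<^sup>+r\<in>{-(l/2)<..<l/2}. ennreal (Q * W (b - (m - r))) \<partial>lborel)
     = (\<integral>\<^sup>+t\<in>?I. ennreal (Q * W (b - t)) \<partial>lborel)"
    by (subst nn_integral_lborel_reflect[of _ m, symmetric])
      (auto intro!: nn_integral_cong split: split_indicator)
  also have "(\<integral>\<^sup>+t\<in>?I. ennreal (P * W (a + t)) \<partial>lborel) + (\<integral>\<^sup>+t\<in>?I. ennreal (Q * W (b - t)) \<partial>lborel)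
     = (\<integral>\<^sup>+t\<in>?I. ennreal (\<psi> t) \<partial>lborel)"
    by (subst nn_integral_add[symmetric])
      (auto intro!: nn_integral_cong simp: PQ \<psi>_def distrib_right)
  also have "\<dots> \<le> (\<integral>\<^sup>+t\<in>A. ennreal (\<psi> t) \<partial>lborel)"
    using A l by (intro bathtub(1)[where c="\<psi> (m + l/2)"] sub) auto
  finally show ?thesis by (simp add: \<psi>_def P_def Q_def)
qed simp

end

section \<open>Steiner symmetrization\<close>

definition chord :: "'a::euclidean_space set \<Rightarrow> 'a \<Rightarrow> 'a \<Rightarrow> real" where
  "chord A e x = measure lborel {t. x + t *\<^sub>R e \<in> A}"

text \<open>Each chord is replaced by a centred open interval of the same total length; the chord itself may be
  any Borel set.\<close>

definition steiner :: "'a::euclidean_space \<Rightarrow> 'a set \<Rightarrow> 'a set" where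
  "steiner e A = {x. 2 * \<bar>x \<bullet> e\<bar> < chord A e x}"

lemma line_section_borel [measurable]:
  fixes x :: "'a::euclidean_space"
  assumes [measurable]: "A \<in> sets borel"
  shows "{t. x + t *\<^sub>R e \<in> A} \<in> sets borel"
  by measurable

lemma emeasure_line_section:
  fixes x :: "'a::euclidean_space"
  assumes [measurable]: "A \<in> sets borel"
  shows "emeasure lborel {t. x + t *\<^sub>R e \<in> A} = (\<integral>\<^sup>+t. indicator A (x + t *\<^sub>R e) \<partial>lborel)"
proof -
  have "(\<integral>\<^sup>+t. indicator A (x + t *\<^sub>R e) \<partial>lborel) = (\<integral>\<^sup>+t. indicator {t. x + t *\<^sub>R e \<in> A} t \<partial>lborel)"
    by (simp add: indicator_def)
  then show ?thesis by simp
qed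

lemma emeasure_line_section_borel [measurable]:
  fixes A :: "'a::euclidean_space set"
  assumes [measurable]: "A \<in> sets borel"
  shows "(\<lambda>x. emeasure lborel {t. x + t *\<^sub>R e \<in> A}) \<in> borel_measurable borel"
  unfolding emeasure_line_section[OF assms] by measurable

lemma abs_le_of_line_in_cball:
  fixes e :: "'a::euclidean_space"
  assumes "norm e = 1" "x + t *\<^sub>R e \<in> cball 0 R"
  shows "\<bar>t\<bar> \<le> R + norm x"
proof -
  have "\<bar>t\<bar> = norm (t *\<^sub>R e)" using assms by simp
  also have "\<dots> = norm ((x + t *\<^sub>R e) - x)" by simp
  also have "\<dots> \<le> norm (x + t *\<^sub>R e) + norm x" by (rule norm_triangle_ineq4)
  finally show ?thesis using assms by simp
qed

lemma emeasure_chord: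
  fixes A :: "'a::euclidean_space set"
  assumes e: "norm e = 1" and A: "A \<in> sets borel" "A \<subseteq> cball 0 R"
  shows "emeasure lborel {t. x + t *\<^sub>R e \<in> A} = ennreal (chord A e x)"
proof -
  have "{t. x + t *\<^sub>R e \<in> A} \<subseteq> {-(R + norm x)..R + norm x}"
    using abs_le_of_line_in_cball[OF e] A by fastforce
  then have "emeasure lborel {t. x + t *\<^sub>R e \<in> A} \<le> emeasure lborel {-(R + norm x)..R + norm x}"
    by (intro emeasure_mono) auto
  also have "\<dots> < \<infinity>" by (simp add: emeasure_lborel_Icc_eq)
  finally show ?thesis
    unfolding chord_def by (intro emeasure_eq_ennreal_measure) auto
qed

lemma chord_nonneg [simp]: "0 \<le> chord A e x"
  by (simp add: chord_def)

lemma chord_borel [measurable]: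
  fixes A :: "'a::euclidean_space set"
  assumes [measurable]: "A \<in> sets borel"
  shows "chord A e \<in> borel_measurable borel"
proof -
  have "chord A e = (\<lambda>x. enn2real (\<integral>\<^sup>+t. indicator A (x + t *\<^sub>R e) \<partial>lborel))"
    by (auto simp: chord_def measure_def emeasure_line_section)
  then show ?thesis by simp
qed

lemma chord_shift:
  fixes A :: "'a::euclidean_space set"
  assumes [measurable]: "A \<in> sets borel"
  shows "chord A e (x + s *\<^sub>R e) = chord A e x"
proof -
  have "emeasure lborel {t. x + s *\<^sub>R e + t *\<^sub>R e \<in> A} = (\<integral>\<^sup>+t. indicator A (x + (s + t) *\<^sub>R e) \<partial>lborel)"
    unfolding emeasure_line_section[OF assms] by (simp add: algebra_simps)
  also have "\<dots> = (\<integral>\<^sup>+t. indicator A (x + t *\<^sub>R e) \<partial>lborel)"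
    by (rule nn_integral_lborel_translate) measurable
  also have "\<dots> = emeasure lborel {t. x + t *\<^sub>R e \<in> A}"
    by (simp add: emeasure_line_section)
  finally show ?thesis by (simp add: chord_def measure_def)
qed

lemma steiner_borel [measurable]:
  assumes [measurable]: "A \<in> sets borel"
  shows "steiner e A \<in> sets borel"
  unfolding steiner_def by measurable

lemma line_in_steiner_iff:
  fixes A :: "'a::euclidean_space set"
  assumes "A \<in> sets borel" "norm e = 1"
  shows "x + t *\<^sub>R e \<in> steiner e A \<longleftrightarrow> x \<bullet> e + t \<in> {-(chord A e x / 2)<..<chord A e x / 2}"
  using assms by (auto simp: steiner_def chord_shift inner_add_left norm_eq_1 abs_if field_simps split: if_splits)

lemma nn_integral_line_steiner:
  fixes A :: "'a::euclidean_space set" and f :: "'a \<Rightarrow> ennreal"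
  assumes A [measurable]: "A \<in> sets borel" and e: "norm e = 1" and [measurable]: "f \<in> borel_measurable borel"
  shows "(\<integral>\<^sup>+t. indicator (steiner e A) (x + t *\<^sub>R e) * f (x + t *\<^sub>R e) \<partial>lborel) =
    (\<integral>\<^sup>+r\<in>{-(chord A e x / 2)<..<chord A e x / 2}. f (x + (r - x \<bullet> e) *\<^sub>R e) \<partial>lborel)"
  by (subst nn_integral_lborel_translate[of _ "x \<bullet> e", symmetric])
    (auto intro!: nn_integral_cong simp: line_in_steiner_iff[OF A e] indicator_def mult.commute)

lemma line_section_steiner_emeasure:
  fixes A :: "'a::euclidean_space set"
  assumes A [measurable]: "A \<in> sets borel" and e: "norm e = 1"
  shows "emeasure lborel {t. x + t *\<^sub>R e \<in> steiner e A} = ennreal (chord A e x)"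
proof -
  have "emeasure lborel {t. x + t *\<^sub>R e \<in> steiner e A} =
     (\<integral>\<^sup>+t. indicator (steiner e A) (x + t *\<^sub>R e) * 1 \<partial>lborel)"
    by (simp add: emeasure_line_section)
  also have "\<dots> = ennreal (chord A e x)"
    by (subst nn_integral_line_steiner[OF A e]) (auto simp: emeasure_lborel_Ioo)
  finally show ?thesis .
qed

lemma emeasure_along_lines:
  fixes A :: "'a::euclidean_space set"
  assumes [measurable]: "A \<in> sets borel" and e: "norm e = 1"
  shows "emeasure lborel A = (\<integral>\<^sup>+x. indicator (slab e) x * emeasure lborel {t. x + t *\<^sub>R e \<in> A} \<partial>lborel)"
  using nn_integral_along_lines[OF _ e, of "indicator A"] by (simp add: emeasure_line_section)

lemma emeasure_steiner:
  fixes A :: "'a::euclidean_space set"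
  assumes A: "A \<in> sets borel" "A \<subseteq> cball 0 R" and e: "norm e = 1"
  shows "emeasure lborel (steiner e A) = emeasure lborel A"
  using A by (simp add: emeasure_along_lines[OF _ e] line_section_steiner_emeasure[OF _ e]
      emeasure_chord[OF e A])

lemma norm_line_power2:
  fixes e :: "'a::euclidean_space"
  assumes e: "norm e = 1"
  shows "(norm (x + t *\<^sub>R e))\<^sup>2 = (norm x)\<^sup>2 - (x \<bullet> e)\<^sup>2 + (x \<bullet> e + t)\<^sup>2"
  using e unfolding power2_norm_eq_inner norm_eq_1
  by (simp add: inner_add_left inner_add_right inner_commute[of e x] power2_eq_square algebra_simps)

lemma steiner_subset_cball:
  fixes A :: "'a::euclidean_space set"
  assumes A: "A \<in> sets borel" "A \<subseteq> cball 0 R" and e: "norm e = 1" and R: "0 \<le> R"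
  shows "steiner e A \<subseteq> cball 0 R"
proof
  fix x assume x: "x \<in> steiner e A"
  show "x \<in> cball 0 R"
  proof (rule ccontr)
    assume "x \<notin> cball 0 R"
    then have nx: "R\<^sup>2 < (norm x)\<^sup>2" using R by (simp add: power_strict_mono)
    have "{t. x + t *\<^sub>R e \<in> A} \<subseteq> {- (x \<bullet> e) - \<bar>x \<bullet> e\<bar> .. - (x \<bullet> e) + \<bar>x \<bullet> e\<bar>}"
    proof
      fix t assume "t \<in> {t. x + t *\<^sub>R e \<in> A}"
      then have "(norm (x + t *\<^sub>R e))\<^sup>2 \<le> R\<^sup>2" using A by (auto intro!: power_mono)
      then have "(x \<bullet> e + t)\<^sup>2 \<le> (x \<bullet> e)\<^sup>2" using nx by (simp add: norm_line_power2[OF e])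
      then have "\<bar>x \<bullet> e + t\<bar> \<le> \<bar>x \<bullet> e\<bar>" by (simp add: abs_le_square_iff)
      then show "t \<in> {- (x \<bullet> e) - \<bar>x \<bullet> e\<bar> .. - (x \<bullet> e) + \<bar>x \<bullet> e\<bar>}" by auto
    qed
    then have "emeasure lborel {t. x + t *\<^sub>R e \<in> A} \<le> emeasure lborel {- (x \<bullet> e) - \<bar>x \<bullet> e\<bar> .. - (x \<bullet> e) + \<bar>x \<bullet> e\<bar>}"
      by (intro emeasure_mono) auto
    also have "\<dots> = ennreal (2 * \<bar>x \<bullet> e\<bar>)" by (simp add: emeasure_lborel_Icc_eq)
    finally have "chord A e x \<le> 2 * \<bar>x \<bullet> e\<bar>"
      by (simp add: emeasure_chord[OF e A])
    then show False using x by (simp add: steiner_def)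
  qed
qed

lemma ball_subset_steiner:
  fixes A :: "'a::euclidean_space set"
  assumes A: "A \<in> sets borel" "A \<subseteq> cball 0 R" and e: "norm e = 1" and r: "ball 0 r \<subseteq> A"
  shows "ball 0 r \<subseteq> steiner e A"
proof
  fix x :: 'a assume "x \<in> ball 0 r"
  then have nx: "(norm x)\<^sup>2 < r\<^sup>2" by (simp add: power_strict_mono)
  have r0: "r > 0" using \<open>x \<in> ball 0 r\<close> by (metis mem_ball_0 norm_ge_zero le_less_trans)
  define q where "q = sqrt ((x \<bullet> e)\<^sup>2 + (r\<^sup>2 - (norm x)\<^sup>2))"
  have "sqrt ((x \<bullet> e)\<^sup>2) < q" unfolding q_def using nx by (intro real_sqrt_less_mono) simp
  then have q: "\<bar>x \<bullet> e\<bar> < q" by simp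
  have q2: "q\<^sup>2 = (x \<bullet> e)\<^sup>2 + (r\<^sup>2 - (norm x)\<^sup>2)" unfolding q_def using nx by simp
  have "{- (x \<bullet> e) - q <..< - (x \<bullet> e) + q} \<subseteq> {t. x + t *\<^sub>R e \<in> A}"
  proof
    fix t assume "t \<in> {- (x \<bullet> e) - q <..< - (x \<bullet> e) + q}"
    then have "\<bar>x \<bullet> e + t\<bar> < q" by auto
    then have "\<bar>x \<bullet> e + t\<bar>\<^sup>2 < q\<^sup>2" by (intro power_strict_mono) auto
    then have "(norm (x + t *\<^sub>R e))\<^sup>2 < r\<^sup>2" by (simp add: norm_line_power2[OF e] q2)
    then have "norm (x + t *\<^sub>R e) < r" using r0 by (simp add: power_less_imp_less_base)
    then show "t \<in> {t. x + t *\<^sub>R e \<in> A}" using r by auto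
  qed
  then have "emeasure lborel {- (x \<bullet> e) - q <..< - (x \<bullet> e) + q} \<le> emeasure lborel {t. x + t *\<^sub>R e \<in> A}"
    using A by (intro emeasure_mono) auto
  then have "ennreal (2 * q) \<le> ennreal (chord A e x)"
    using q by (simp add: emeasure_lborel_Ioo emeasure_chord[OF e A])
  then have "2 * q \<le> chord A e x" by simp
  then show "x \<in> steiner e A" using q by (simp add: steiner_def)
qed

subsection \<open>Finitely many symmetrizations bring a set close to a ball\<close>

inductive steiner_iterate :: "'a::euclidean_space set \<Rightarrow> 'a set \<Rightarrow> bool" for A where
  steiner_refl: "steiner_iterate A A"
| steiner_step: "steiner_iterate A B \<Longrightarrow> norm e = 1 \<Longrightarrow> steiner_iterate A (steiner e B)"

text \<open>On average over all translations, two sets meet in the product of their measures; so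
  some translation makes them overlap. This produces the direction for the next symmetrization.\<close>

lemma emeasure_translate_Int:
  fixes P N :: "'a::euclidean_space set"
  assumes [measurable]: "P \<in> sets borel" "N \<in> sets borel"
  shows "(\<integral>\<^sup>+z. emeasure lborel {x \<in> P. x + z \<in> N} \<partial>lborel) = emeasure lborel P * emeasure lborel N"
proof -
  have "(\<integral>\<^sup>+z. emeasure lborel {x \<in> P. x + z \<in> N} \<partial>lborel)
     = (\<integral>\<^sup>+z. (\<integral>\<^sup>+x. indicator P x * indicator N (x + z) \<partial>lborel) \<partial>lborel)"
  proof (intro nn_integral_cong)
    fix z
    have "emeasure lborel {x \<in> P. x + z \<in> N} = (\<integral>\<^sup>+x. indicator {x \<in> P. x + z \<in> N} x \<partial>lborel)"
      by (subst nn_integral_indicator) auto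
    also have "\<dots> = (\<integral>\<^sup>+x. indicator P x * indicator N (x + z) \<partial>lborel)"
      by (intro nn_integral_cong) (auto split: split_indicator)
    finally show "emeasure lborel {x \<in> P. x + z \<in> N} = (\<integral>\<^sup>+x. indicator P x * indicator N (x + z) \<partial>lborel)" .
  qed
  also have "\<dots> = (\<integral>\<^sup>+x. (\<integral>\<^sup>+z. indicator P x * indicator N (x + z) \<partial>lborel) \<partial>lborel)"
    by (intro lborel_pair.Fubini') measurable
  also have "\<dots> = (\<integral>\<^sup>+x. indicator P x * emeasure lborel N \<partial>lborel)"
    by (intro nn_integral_cong, subst nn_integral_cmult) (auto simp: nn_integral_lborel_translate)
  also have "\<dots> = emeasure lborel P * emeasure lborel N"
    by (simp add: nn_integral_multc)
  finally show ?thesis .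
qed

text \<open>On each line, the centred interval cut out of the ball gains the smaller of the lengths of
  the parts of \<open>A\<close> outside the ball and of the ball outside \<open>A\<close>. A translate in
  the direction of the line maps no more than this length of the first part into the second.\<close>

lemma steiner_gain:
  fixes A :: "'a::euclidean_space set" and r s :: real
  assumes A [measurable]: "A \<in> sets borel" and AR: "A \<subseteq> cball 0 R" and e: "norm e = 1"
  defines "P \<equiv> A - ball 0 r" and "N \<equiv> ball 0 r - A"
  shows "emeasure lborel (A \<inter> ball 0 r) + emeasure lborel {x \<in> P. x + s *\<^sub>R e \<in> N}
     \<le> emeasure lborel (steiner e A \<inter> ball 0 r)"
proof -
  have [measurable]: "P \<in> sets borel" "N \<in> sets borel" unfolding P_def N_def by measurable
  have st[measurable]: "steiner e A \<in> sets borel" by simp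
  let ?l = "\<lambda>S x. emeasure lborel {t. x + t *\<^sub>R e \<in> S}"
  let ?T = "{x \<in> P. x + s *\<^sub>R e \<in> N}"
  have AB [measurable]: "A \<inter> ball 0 r \<in> sets borel" by measurable
  have [measurable]: "?T \<in> sets borel" by measurable
  have line: "?l (A \<inter> ball 0 r) x + ?l ?T x \<le> ?l (steiner e A \<inter> ball 0 r) x" for x
  proof -
    have T1: "?l ?T x \<le> ?l P x" by (intro emeasure_mono) auto
    have "?l ?T x \<le> emeasure lborel {t. (s + t) \<in> {t. x + t *\<^sub>R e \<in> N}}"
      by (intro emeasure_mono) (auto simp: algebra_simps)
    also have "\<dots> = (\<integral>\<^sup>+t. indicator {t. s + t \<in> {t. x + t *\<^sub>R e \<in> N}} t \<partial>lborel)" by simp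
    also have "\<dots> = (\<integral>\<^sup>+t. indicator {t. x + t *\<^sub>R e \<in> N} (s + t) \<partial>lborel)"
      by (simp add: indicator_def)
    also have "\<dots> = ?l N x" by (subst nn_integral_lborel_translate) auto
    finally have T2: "?l ?T x \<le> ?l N x" .
    have "?l (A \<inter> ball 0 r) x + ?l P x = ?l A x"
      by (subst plus_emeasure) (auto simp: P_def intro!: arg_cong[where f="emeasure lborel"])
    then have A1: "?l (A \<inter> ball 0 r) x + ?l ?T x \<le> ?l A x" using add_left_mono[OF T1, of "?l (A \<inter> ball 0 r) x"] by simp
    have "?l (A \<inter> ball 0 r) x + ?l N x = ?l (ball 0 r) x"
      by (subst plus_emeasure) (auto simp: N_def intro!: arg_cong[where f="emeasure lborel"])
    then have B1: "?l (A \<inter> ball 0 r) x + ?l ?T x \<le> ?l (ball 0 r) x" using add_left_mono[OF T2, of "?l (A \<inter> ball 0 r) x"] by simp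
    have ballsec: "x + t *\<^sub>R e \<in> ball 0 r \<longleftrightarrow> r > 0 \<and> (x \<bullet> e + t)\<^sup>2 < r\<^sup>2 - ((norm x)\<^sup>2 - (x \<bullet> e)\<^sup>2)" for t
    proof -
      have "x + t *\<^sub>R e \<in> ball 0 r \<longleftrightarrow> r > 0 \<and> (norm (x + t *\<^sub>R e))\<^sup>2 < r\<^sup>2"
        by (metis mem_ball_0 norm_ge_zero le_less_trans power2_less_imp_less less_imp_le power_strict_mono pos2)
      then show ?thesis by (auto simp: norm_line_power2[OF e])
    qed
    show ?thesis
    proof (cases "?l (ball 0 r) x = 0")
      case True
      then show ?thesis using B1 by simp
    next
      case False
      then have "{t. x + t *\<^sub>R e \<in> ball 0 r} \<noteq> {}" by force
      then obtain t0 where "x + t0 *\<^sub>R e \<in> ball 0 r" by auto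
      then have c: "r > 0" "0 \<le> r\<^sup>2 - ((norm x)\<^sup>2 - (x \<bullet> e)\<^sup>2)"
        using ballsec[of t0] zero_le_power2[of "x \<bullet> e + t0"] by (blast, smt (verit))
      \<comment> \<open>Half the length of the chord of the ball.\<close>
      define q where "q = sqrt (r\<^sup>2 - ((norm x)\<^sup>2 - (x \<bullet> e)\<^sup>2))"
      have q: "q \<ge> 0" "q\<^sup>2 = r\<^sup>2 - ((norm x)\<^sup>2 - (x \<bullet> e)\<^sup>2)" using c by (auto simp: q_def)
      have ballsec': "x + t *\<^sub>R e \<in> ball 0 r \<longleftrightarrow> x \<bullet> e + t \<in> {-q<..<q}" for t
      proof -
        have "x + t *\<^sub>R e \<in> ball 0 r \<longleftrightarrow> \<bar>x \<bullet> e + t\<bar> < \<bar>q\<bar>"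
          unfolding ballsec using c q(2) by (metis abs_square_less_1 abs_le_square_iff not_le)
        then show ?thesis using q(1) by auto
      qed
      have shift: "emeasure lborel {t. x \<bullet> e + t \<in> {-k<..<k}} = ennreal (2 * k)" if "k \<ge> 0" for k
      proof -
        have "{t. x \<bullet> e + t \<in> {-k<..<k}} = {- (x \<bullet> e) - k <..< - (x \<bullet> e) + k}" by auto
        then show ?thesis using that by (simp add: emeasure_lborel_Ioo)
      qed
      define k where "k = min q (chord A e x / 2)"
      have "?l (steiner e A \<inter> ball 0 r) x = emeasure lborel {t. x \<bullet> e + t \<in> {-k<..<k}}"
        unfolding Int_iff line_in_steiner_iff[OF A e] ballsec' k_def
        by (intro arg_cong[where f="emeasure lborel"] Collect_cong) (auto simp: minus_min_eq_max)
      also have "\<dots> = ennreal (2 * k)" using q by (intro shift) (auto simp: k_def)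
      also have "\<dots> = min (?l (ball 0 r) x) (?l A x)"
        unfolding ballsec' shift[OF q(1)] emeasure_chord[OF e A AR] by (auto simp: k_def min_def)
      finally show ?thesis using A1 B1 by simp
    qed
  qed
  have "emeasure lborel (A \<inter> ball 0 r) + emeasure lborel ?T =
     (\<integral>\<^sup>+x. indicator (slab e) x * (?l (A \<inter> ball 0 r) x + ?l ?T x) \<partial>lborel)"
    unfolding distrib_left emeasure_along_lines[OF \<open>?T \<in> sets borel\<close> e] emeasure_along_lines[OF AB e]
    by (rule nn_integral_add[symmetric]) measurable
  also have "\<dots> \<le> (\<integral>\<^sup>+x. indicator (slab e) x * ?l (steiner e A \<inter> ball 0 r) x \<partial>lborel)"
    by (intro nn_integral_mono mult_left_mono line) auto
  also have "\<dots> = emeasure lborel (steiner e A \<inter> ball 0 r)"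
    by (intro emeasure_along_lines[OF _ e, symmetric]) auto
  finally show ?thesis .
qed

text \<open>The part \<open>P\<close> of \<open>A\<close> outside the ball and the part \<open>N\<close> of the ball outside \<open>A\<close> have the same
  measure, at least \<open>\<eta>\<close>. Only translations of norm at most \<open>2 R\<close> can move \<open>P\<close> onto \<open>N\<close>, so the
  mean overlap is at least \<open>\<eta>\<^sup>2 / \<kappa>\<close>. Half of it is certainly reached, and symmetrizing in the direction of
  such a translation gains that much. The bound depends on \<open>A\<close> only through \<open>\<eta>\<close> and
  \<open>R\<close>, so this step can be iterated.\<close>

lemma steiner_improvement:
  fixes A :: "'a::euclidean_space set"
  assumes A [measurable]: "A \<in> sets borel" and AR: "A \<subseteq> cball 0 R" and r: "0 < r" "r \<le> R"
    and vol: "emeasure lborel A = emeasure lborel (ball (0::'a) r)"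
    and \<eta>: "measure lborel (ball 0 r - A) \<ge> \<eta>" "\<eta> > 0"
  defines "\<kappa> \<equiv> measure lborel (cball (0::'a) (2 * R))"
  shows "\<exists>e. norm e = 1 \<and>
    measure lborel (ball 0 r - steiner e A) \<le> measure lborel (ball 0 r - A) - \<eta>\<^sup>2 / (2 * \<kappa>)"
proof -
  let ?\<beta> = "ball (0::'a) r"
  define P where "P = A - ?\<beta>"
  define N where "N = ?\<beta> - A"
  have [measurable]: "P \<in> sets borel" "N \<in> sets borel" unfolding P_def N_def by measurable
  have fm: "emeasure lborel S \<noteq> \<infinity>" if "S \<subseteq> cball 0 R" for S :: "'a set"
    using emeasure_mono[OF that, of lborel] emeasure_compact_finite[of "cball (0::'a) R"]
    by (auto simp: top_unique)
  have sub: "?\<beta> \<subseteq> cball 0 R" using r by auto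
  have em: "emeasure lborel S = ennreal (measure lborel S)" if "S \<subseteq> cball 0 R" for S :: "'a set"
    using fm[OF that] by (intro emeasure_eq_ennreal_measure) auto
  have PN: "P \<subseteq> cball 0 R" "N \<subseteq> cball 0 R" using AR sub by (auto simp: P_def N_def)
  have mvol: "measure lborel A = measure lborel ?\<beta>" using vol by (simp add: measure_def)
  have diff: "measure lborel (S - T) = measure lborel S - measure lborel (S \<inter> T)"
    if [measurable]: "S \<in> sets borel" "T \<in> sets borel" and S: "S \<subseteq> cball 0 R" for S T :: "'a set"
    using measure_Diff[where M=lborel and A=S and B="S \<inter> T"] fm[OF S] by (simp add: Diff_Int)
  have mPN: "measure lborel P = measure lborel N"
    unfolding P_def N_def using diff[of A ?\<beta>] diff[of ?\<beta> A] AR sub mvol by (simp add: Int_commute)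
  have \<kappa>: "\<kappa> > 0" unfolding \<kappa>_def using r by (simp add: content_cball)
  let ?T = "\<lambda>z. {x \<in> P. x + z \<in> N}"
  obtain z where z: "emeasure lborel (?T z) > ennreal (\<eta>\<^sup>2 / (2 * \<kappa>))"
  proof (rule ccontr)
    assume "\<not> thesis"
    then have *: "emeasure lborel (?T z) \<le> ennreal (\<eta>\<^sup>2 / (2 * \<kappa>))" for z
      using that not_le by blast
    have "\<eta> \<le> measure lborel N" using \<eta> by (simp add: N_def)
    then have "ennreal (\<eta> * \<eta>) \<le> emeasure lborel P * emeasure lborel N"
      using \<eta>(2) unfolding em[OF PN(1)] em[OF PN(2)] mPN
      by (simp add: ennreal_mult mult_mono ennreal_leI)
    also have "\<dots> = (\<integral>\<^sup>+z. emeasure lborel (?T z) \<partial>lborel)"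
      by (rule emeasure_translate_Int[symmetric]) measurable
    also have "\<dots> \<le> (\<integral>\<^sup>+z. ennreal (\<eta>\<^sup>2 / (2 * \<kappa>)) * indicator (cball (0::'a) (2 * R)) z \<partial>lborel)"
    proof (rule nn_integral_mono)
      fix z :: 'a
      show "emeasure lborel (?T z) \<le> ennreal (\<eta>\<^sup>2 / (2 * \<kappa>)) * indicator (cball 0 (2 * R)) z"
      proof (cases "z \<in> cball 0 (2 * R)")
        case False
        have "?T z = {}"
        proof (rule ccontr)
          assume "?T z \<noteq> {}"
          then obtain x where x: "norm x \<le> R" "norm (x + z) \<le> R" using PN by fastforce
          have "norm z \<le> norm (x + z) + norm x"
            using norm_triangle_ineq4[of "x + z" x] by simp
          then show False using x False by simp
        qed
        then show ?thesis by (simp only: emeasure_empty zero_le)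
      qed (use *[of z] in simp)
    qed
    also have "\<dots> = ennreal (\<eta>\<^sup>2 / (2 * \<kappa>)) * ennreal \<kappa>"
      using emeasure_compact_finite[of "cball (0::'a) (2 * R)"]
      by (simp add: nn_integral_cmult_indicator \<kappa>_def emeasure_eq_ennreal_measure)
    also have "\<dots> = ennreal (\<eta> * \<eta> / 2)"
      using \<kappa> by (simp add: power2_eq_square flip: ennreal_mult)
    finally show False using \<eta> by (simp add: ennreal_le_iff)
  qed
  have "z \<noteq> 0"
  proof
    assume "z = 0"
    then have T: "?T z = {}" by (auto simp: P_def N_def)
    show False using z unfolding T by simp
  qed
  define e where "e = z /\<^sub>R norm z"
  have e: "norm e = 1" "z = norm z *\<^sub>R e" using \<open>z \<noteq> 0\<close> by (auto simp: e_def)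
  have [measurable]: "?T z \<in> sets borel" by measurable
  have "emeasure lborel (A \<inter> ?\<beta>) + emeasure lborel (?T z) \<le> emeasure lborel (steiner e A \<inter> ?\<beta>)"
    using steiner_gain[OF A AR e(1), of r "norm z"] e(2) by (simp add: P_def N_def)
  then have "emeasure lborel (A \<inter> ?\<beta>) + ennreal (\<eta>\<^sup>2 / (2 * \<kappa>)) \<le> emeasure lborel (steiner e A \<inter> ?\<beta>)"
    using add_left_mono[OF less_imp_le[OF z], of "emeasure lborel (A \<inter> ?\<beta>)"] by (rule order_trans[rotated])
  then have "ennreal (measure lborel (A \<inter> ?\<beta>) + \<eta>\<^sup>2 / (2 * \<kappa>)) \<le> ennreal (measure lborel (steiner e A \<inter> ?\<beta>))"
    using \<kappa> em[of "A \<inter> ?\<beta>", OF le_infI2[OF sub]] em[of "steiner e A \<inter> ?\<beta>", OF le_infI2[OF sub]]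
    by (simp add: ennreal_plus)
  then have "measure lborel (A \<inter> ?\<beta>) + \<eta>\<^sup>2 / (2 * \<kappa>) \<le> measure lborel (steiner e A \<inter> ?\<beta>)"
    by (subst (asm) ennreal_le_iff) auto
  then have "measure lborel (?\<beta> - steiner e A) \<le> measure lborel (?\<beta> - A) - \<eta>\<^sup>2 / (2 * \<kappa>)"
    using diff[OF _ A sub] diff[OF _ steiner_borel[OF A] sub] by (simp only: borel_open open_ball Int_commute)
  then show ?thesis using e(1) by blast
qed

lemma steiner_iterate_invariants:
  fixes A :: "'a::euclidean_space set"
  assumes "steiner_iterate A B"
    and "A \<in> sets borel" "A \<subseteq> cball 0 R" "ball 0 \<epsilon> \<subseteq> A" "0 \<le> R"
  shows "B \<in> sets borel \<and> B \<subseteq> cball 0 R \<and> ball 0 \<epsilon> \<subseteq> B \<and> emeasure lborel B = emeasure lborel A"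
  using assms(1)
proof induction
  case steiner_refl
  show ?case using assms by simp
next
  case (steiner_step B e)
  then have B: "B \<in> sets borel" "B \<subseteq> cball 0 R" "ball 0 \<epsilon> \<subseteq> B" "emeasure lborel B = emeasure lborel A" by blast+
  show ?case
    by (intro conjI steiner_borel B(1) steiner_subset_cball[OF B(1,2) steiner_step(2) \<open>0 \<le> R\<close>]
      ball_subset_steiner[OF B(1,2) steiner_step(2) B(3)] trans[OF emeasure_steiner[OF B(1,2) steiner_step(2)] B(4)])
qed

lemma steiner_iterates_approach_ball:
  fixes A :: "'a::euclidean_space set"
  assumes A: "A \<in> sets borel" "A \<subseteq> cball 0 R" and r: "0 < r" "r \<le> R"
    and vol: "emeasure lborel A = emeasure lborel (ball (0::'a) r)" and \<delta>: "\<delta> > 0"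
  shows "\<exists>B. steiner_iterate A B \<and> measure lborel (ball 0 r - B) < \<delta>"
proof (rule ccontr)
  assume "\<not> ?thesis"
  then have far: "\<delta> \<le> measure lborel (ball 0 r - B)" if "steiner_iterate A B" for B
    using that not_le by blast
  define c where "c = \<delta>\<^sup>2 / (2 * measure lborel (cball (0::'a) (2 * R)))"
  have c: "c > 0" unfolding c_def using r \<delta> by (simp add: content_cball)
  have "\<exists>B. steiner_iterate A B \<and> measure lborel (ball 0 r - B) \<le> measure lborel (ball 0 r - A) - real k * c" for k
  proof (induction k)
    case 0
    show ?case by (rule exI[of _ A]) (simp add: steiner_refl)
  next
    case (Suc k)
    then obtain B where B: "steiner_iterate A B"
        "measure lborel (ball 0 r - B) \<le> measure lborel (ball 0 r - A) - real k * c" by blast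
    have inv: "B \<in> sets borel" "B \<subseteq> cball 0 R" "emeasure lborel B = emeasure lborel A"
      using steiner_iterate_invariants[OF B(1) A, of 0] r by auto
    obtain e where e: "norm e = 1"
      "measure lborel (ball 0 r - steiner e B) \<le> measure lborel (ball 0 r - B) - c"
      using steiner_improvement[OF inv(1,2) r _ far[OF B(1)] \<delta>] inv(3) vol by (auto simp: c_def)
    then show ?case using B steiner_step[OF B(1) e(1)]
      by (intro exI[of _ "steiner e B"]) (auto simp: algebra_simps)
  qed
  note gain = this
  obtain k where k: "measure lborel (ball 0 r - A) < real k * c"
    using reals_Archimedean3[OF c] by blast
  obtain B :: "'a set" where "measure lborel (ball 0 r - B) \<le> measure lborel (ball 0 r - A) - real k * c"
    using gain[of k] by blast
  then show False using k measure_nonneg[of lborel "ball 0 r - B"] by linarith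
qed

section \<open>Polar coordinates and the normalizing constant\<close>

lemma nn_integral_sphere_measure:
  fixes f :: "'a::euclidean_space \<Rightarrow> ennreal"
  assumes [measurable]: "f \<in> borel_measurable borel"
  shows "(\<integral>\<^sup>+v. f v \<partial>sphere_measure) =
    of_nat DIM('a) * (\<integral>\<^sup>+x. indicator (cball 0 1 - {0}) x * f (x /\<^sub>R norm x) \<partial>lborel)"
proof -
  have "(\<lambda>x::'a. x /\<^sub>R norm x) \<in> borel_measurable (restrict_space lborel (cball 0 1 - {0}))"
    by (intro measurable_restrict_space1) simp
  then have m: "(\<lambda>x::'a. x /\<^sub>R norm x) \<in> measurable (restrict_space lborel (cball 0 1 - {0})) (restrict_space borel (sphere 0 1))"
    by (intro measurable_restrict_space2) (auto simp: space_restrict_space)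
  have f: "f \<in> borel_measurable (restrict_space borel (sphere 0 1))"
    by (intro measurable_restrict_space1) simp
  have "(\<integral>\<^sup>+v. f v \<partial>sphere_measure) =
     of_nat DIM('a) * (\<integral>\<^sup>+x. f (x /\<^sub>R norm x) \<partial>restrict_space lborel (cball 0 1 - {0}))"
    unfolding sphere_measure_def using f m
    by (simp add: nn_integral_scale_measure nn_integral_distr)
  also have "(\<integral>\<^sup>+x. f (x /\<^sub>R norm x) \<partial>restrict_space lborel (cball 0 1 - {0})) =
     (\<integral>\<^sup>+x. indicator (cball 0 1 - {0}) x * f (x /\<^sub>R norm x) \<partial>lborel)"
    by (subst nn_integral_restrict_space) (auto simp: mult.commute)
  finally show ?thesis .
qed

lemma nn_integral_polar:
  fixes f :: "'a::euclidean_space \<Rightarrow> ennreal"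
  assumes [measurable]: "f \<in> borel_measurable borel"
  shows "(\<integral>\<^sup>+x. f x \<partial>lborel) =
    (\<integral>\<^sup>+v. (\<integral>\<^sup>+s. indicator {0<..} s * (f (s *\<^sub>R v) * ennreal (s ^ (DIM('a) - 1))) \<partial>lborel) \<partial>sphere_measure)"
proof -
  define n where "n = DIM('a)"
  have n: "n > 0" by (simp add: n_def)
  let ?q = "\<lambda>v. \<integral>\<^sup>+s. indicator {0<..} s * (f (s *\<^sub>R v) * ennreal (s ^ (n - 1))) \<partial>lborel"
  have [measurable]: "?q \<in> borel_measurable borel" by measurable
  have "(\<integral>\<^sup>+x. f x \<partial>lborel) = (\<integral>\<^sup>+x. indicator (cball 0 1) x * ennreal (n * norm x ^ n) * ?q x \<partial>lborel)"
    unfolding n_def by (rule nn_integral_along_rays) simp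
  also have "\<dots> = (\<integral>\<^sup>+x. of_nat n * (indicator (cball 0 1 - {0}) x * ?q (x /\<^sub>R norm x)) \<partial>lborel)"
  proof (rule nn_integral_cong)
    fix x :: 'a
    show "indicator (cball 0 1) x * ennreal (n * norm x ^ n) * ?q x =
      of_nat n * (indicator (cball 0 1 - {0}) x * ?q (x /\<^sub>R norm x))"
    proof (cases "x = 0")
      case False
      then have x: "norm x > 0" by simp
      have pw: "norm x ^ n = norm x * norm x ^ (n - 1)" using n by (cases n) auto
      have "?q (x /\<^sub>R norm x) = ennreal \<bar>norm x\<bar> * (\<integral>\<^sup>+s. indicator {0<..} (0 + norm x * s) *
          (f ((0 + norm x * s) *\<^sub>R (x /\<^sub>R norm x)) * ennreal ((0 + norm x * s) ^ (n - 1))) \<partial>lborel)"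
        by (rule nn_integral_real_affine) (use x in auto)
      also have "\<dots> = ennreal (norm x) * (\<integral>\<^sup>+s. ennreal (norm x ^ (n - 1)) * (indicator {0<..} s *
          (f (s *\<^sub>R x) * ennreal (s ^ (n - 1)))) \<partial>lborel)"
      proof -
        have "indicator {0<..} (0 + norm x * s) * (f ((0 + norm x * s) *\<^sub>R (x /\<^sub>R norm x)) * ennreal ((0 + norm x * s) ^ (n - 1)))
          = ennreal (norm x ^ (n - 1)) * (indicator {0<..} s * (f (s *\<^sub>R x) * ennreal (s ^ (n - 1))))" for s
          using x by (cases "s > 0") (simp_all add: zero_less_mult_iff power_mult_distrib ennreal_mult ac_simps)
        then show ?thesis by simp
      qed
      also have "\<dots> = ennreal (norm x) * ennreal (norm x ^ (n - 1)) * ?q x"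
        by (subst nn_integral_cmult) (auto simp: mult.assoc)
      also have "\<dots> = ennreal (norm x ^ n) * ?q x"
        by (simp add: pw ennreal_mult)
      finally show ?thesis using False
        by (auto split: split_indicator simp: ennreal_mult ennreal_of_nat_eq_real_of_nat mult.assoc)
    qed (use n in auto)
  qed
  also have "\<dots> = (\<integral>\<^sup>+v. ?q v \<partial>sphere_measure)"
    by (subst nn_integral_cmult) (auto simp: nn_integral_sphere_measure n_def)
  finally show ?thesis by (simp add: n_def)
qed

lemma nn_integral_powr_exp_square:
  fixes a :: real
  assumes a: "a > 0"
  shows "(\<integral>\<^sup>+s. indicator {0<..} s * ennreal (s powr (a - 1) * exp (- s\<^sup>2)) \<partial>lborel) = ennreal (Gamma (a / 2) / 2)"
proof -
  define f where "f t = t powr (a / 2 - 1) / exp t" for t :: real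
  have im: "(\<lambda>s::real. s\<^sup>2) ` {0<..} = {0<..}"
  proof
    show "{0<..} \<subseteq> (\<lambda>s::real. s\<^sup>2) ` {0<..}"
      by (auto intro!: image_eqI[of _ _ "sqrt _"])
  qed auto
  have inj: "inj_on (\<lambda>s::real. s\<^sup>2) {0<..}" by (auto simp: inj_on_def power2_eq_iff)
  have der: "((\<lambda>s::real. s\<^sup>2) has_field_derivative 2 * s) (at s within {0<..})" for s
    by (auto intro!: derivative_eq_intros)
  have fi: "f absolutely_integrable_on {0<..}" "integral {0<..} f = Gamma (a / 2)"
  proof -
    have "(f has_integral Gamma (a / 2)) {0..}"
      using Gamma_integral_real[of "a / 2"] a unfolding f_def by simp
    then have *: "(f has_integral Gamma (a / 2)) {0<..}"
      by (subst (asm) has_integral_spike_set_eq[of _ "{0<..}"]) (auto intro: negligible_subset[of "{0}"])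
    then show "integral {0<..} f = Gamma (a / 2)" by (rule integral_unique)
    show "f absolutely_integrable_on {0<..}"
      using * by (intro nonnegative_absolutely_integrable_1) (auto simp: f_def integrable_on_def)
  qed
  have "(\<lambda>s. \<bar>2 * s\<bar> *\<^sub>R f (s\<^sup>2)) absolutely_integrable_on {0<..} \<and>
      integral {0<..} (\<lambda>s. \<bar>2 * s\<bar> *\<^sub>R f (s\<^sup>2)) = Gamma (a / 2)"
    using has_absolute_integral_change_of_variables_1'[of "{0<..}" "\<lambda>s. s\<^sup>2" "\<lambda>s. 2 * s" f "Gamma (a / 2)"]
      der inj fi by (simp add: im)
  then have "((\<lambda>s. \<bar>2 * s\<bar> *\<^sub>R f (s\<^sup>2)) has_integral Gamma (a / 2)) {0<..}"
    by (metis absolutely_integrable_on_def integrable_integral)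
  moreover have "\<bar>2 * s\<bar> *\<^sub>R f (s\<^sup>2) = 2 * (s powr (a - 1) * exp (- s\<^sup>2))" if "s \<in> {0<..}" for s
  proof -
    have "s * (s\<^sup>2) powr (a / 2 - 1) = s powr (a - 1)"
      using that powr_add[of s 1 "a - 2"] by (simp add: powr_powr flip: powr_numeral)
    then show ?thesis using that by (simp add: f_def exp_minus field_simps)
  qed
  ultimately have "((\<lambda>s. 2 * (s powr (a - 1) * exp (- s\<^sup>2))) has_integral Gamma (a / 2)) {0<..}"
    by (rule has_integral_eq[rotated])
  from has_integral_mult_right[OF this, of "1/2"]
  have "((\<lambda>s. s powr (a - 1) * exp (- s\<^sup>2)) has_integral Gamma (a / 2) / 2) {0<..}" by simp
  from nn_integral_has_integral_lebesgue[OF _ this]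
  have "(\<integral>\<^sup>+s. ennreal (indicator {0<..} s * (s powr (a - 1) * exp (- s\<^sup>2))) \<partial>lborel) = ennreal (Gamma (a / 2) / 2)"
    by simp
  also have "(\<lambda>s. ennreal (indicator {0<..} s * (s powr (a - 1) * exp (- s\<^sup>2)))) =
     (\<lambda>s::real. indicator {0<..} s * ennreal (s powr (a - 1) * exp (- s\<^sup>2)))"
    by (auto split: split_indicator)
  finally show ?thesis .
qed

lemma power_pred_eq_powr:
  fixes s :: real
  assumes "s > 0" "n > 0"
  shows "s ^ (n - 1) = s powr (real n - 1)"
proof -
  obtain m where "n = Suc m" using assms by (cases n) auto
  then show ?thesis using assms by (simp add: powr_realpow)
qed

lemma powr_mult_power_pred:
  fixes s :: real
  assumes "s > 0" "n > 0"
  shows "s powr q * s ^ (n - 1) = s powr (real n + q - 1)"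
  using powr_add[of s q "real n - 1"] by (simp only: power_pred_eq_powr[OF assms]) (simp add: algebra_simps)

lemma sphere_measure_UNIV:
  "emeasure (sphere_measure :: 'a::euclidean_space measure) (sphere 0 1) = ennreal (DIM('a) * unit_ball_vol DIM('a))"
proof -
  have "emeasure (sphere_measure :: 'a measure) (sphere 0 1) = (\<integral>\<^sup>+v. 1 \<partial>(sphere_measure :: 'a measure))"
    by (simp add: space_sphere_measure)
  also have "\<dots> = of_nat DIM('a) * (\<integral>\<^sup>+x. indicator (cball (0::'a) 1 - {0}) x * 1 \<partial>lborel)"
    by (rule nn_integral_sphere_measure) simp
  also have "(\<integral>\<^sup>+x. indicator (cball (0::'a) 1 - {0}) x * 1 \<partial>lborel) = emeasure lborel (cball (0::'a) 1 - {0})"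
    by simp
  also have "\<dots> = emeasure lborel (cball (0::'a) 1)"
    by (intro emeasure_Diff_null_set) auto
  also have "\<dots> = ennreal (unit_ball_vol DIM('a))"
    by (simp add: emeasure_cball)
  finally show ?thesis by (simp add: ennreal_mult ennreal_of_nat_eq_real_of_nat)
qed

text \<open>The radial integral is a Gamma value and the angular one is \<open>n\<close> times the volume of the unit
  ball, so the known volume of the ball determines the Gaussian integral.\<close>

lemma nn_integral_gaussian:
  "(\<integral>\<^sup>+x. ennreal (exp (- (norm (x::'a::euclidean_space))\<^sup>2)) \<partial>lborel) = ennreal (pi powr (DIM('a) / 2))"
proof -
  have n: "DIM('a) > 0" by simp
  have "(\<integral>\<^sup>+x. ennreal (exp (- (norm (x::'a))\<^sup>2)) \<partial>lborel) =
    (\<integral>\<^sup>+v. (\<integral>\<^sup>+s. indicator {0<..} s * (ennreal (exp (- (norm (s *\<^sub>R v))\<^sup>2)) * ennreal (s ^ (DIM('a) - 1))) \<partial>lborel) \<partial>(sphere_measure :: 'a measure))"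
    by (rule nn_integral_polar) simp
  also have "\<dots> = (\<integral>\<^sup>+v. ennreal (Gamma (DIM('a) / 2) / 2) \<partial>(sphere_measure :: 'a measure))"
  proof (rule nn_integral_cong)
    fix v :: 'a assume "v \<in> space sphere_measure"
    then have v: "norm v = 1" by (simp add: space_sphere_measure)
    have "(\<integral>\<^sup>+s. indicator {0<..} s * (ennreal (exp (- (norm (s *\<^sub>R v))\<^sup>2)) * ennreal (s ^ (DIM('a) - 1))) \<partial>lborel) =
      (\<integral>\<^sup>+s. indicator {0<..} s * ennreal (s powr (real DIM('a) - 1) * exp (- s\<^sup>2)) \<partial>lborel)"
    proof (rule nn_integral_cong)
      fix s :: real
      show "indicator {0<..} s * (ennreal (exp (- (norm (s *\<^sub>R v))\<^sup>2)) * ennreal (s ^ (DIM('a) - 1))) =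
        indicator {0<..} s * ennreal (s powr (real DIM('a) - 1) * exp (- s\<^sup>2))"
        using power_pred_eq_powr[OF _ n, of s]
        by (cases "s > 0") (simp_all add: v mult.commute flip: ennreal_mult)
    qed
    then show "(\<integral>\<^sup>+s. indicator {0<..} s * (ennreal (exp (- (norm (s *\<^sub>R v))\<^sup>2)) * ennreal (s ^ (DIM('a) - 1))) \<partial>lborel)
       = ennreal (Gamma (DIM('a) / 2) / 2)"
      using nn_integral_powr_exp_square[of "real DIM('a)"] n by simp
  qed
  also have "\<dots> = ennreal (Gamma (DIM('a) / 2) / 2 * (DIM('a) * unit_ball_vol DIM('a)))"
    using sphere_measure_UNIV[where 'a='a] Gamma_real_pos[of "real DIM('a) / 2"] n
    by (simp add: space_sphere_measure flip: ennreal_mult)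
  also have "Gamma (DIM('a) / 2) / 2 * (DIM('a) * unit_ball_vol DIM('a)) = pi powr (DIM('a) / 2)"
  proof -
    have G: "Gamma (real DIM('a) / 2 + 1) = real DIM('a) / 2 * Gamma (real DIM('a) / 2)"
      by (rule Gamma_plus1) (use n nonpos_Ints_nonpos in force)
    moreover have "Gamma (real DIM('a) / 2) > 0" using n by (intro Gamma_real_pos) simp
    moreover have "g / 2 * (m * (q / (m / 2 * g))) = q" if "g > 0" "m > 0" for g m q :: real
      using that by simp
    ultimately show ?thesis unfolding unit_ball_vol_def G using n by (metis of_nat_0_less_iff)
  qed
  finally show ?thesis .
qed

context moment_weight
begin

definition moment :: "'a::euclidean_space set \<Rightarrow> 'a \<Rightarrow> ennreal" where
  "moment A u = (\<integral>\<^sup>+x\<in>A. ennreal (W (u \<bullet> x)) \<partial>lborel)"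

lemma nn_integral_W_gaussian:
  "(\<integral>\<^sup>+r. ennreal (W r * exp (- r\<^sup>2)) \<partial>lborel) = ennreal (weight_sum * Gamma ((1 + p) / 2) / 2)"
proof -
  let ?g = "\<lambda>r::real. indicator {0<..} r * ennreal (r powr p * exp (- r\<^sup>2))"
  have g: "(\<integral>\<^sup>+r. ?g r \<partial>lborel) = ennreal (Gamma ((1 + p) / 2) / 2)"
    using nn_integral_powr_exp_square[of "1 + p"] p by simp
  have g': "(\<integral>\<^sup>+r. ?g (- r) \<partial>lborel) = ennreal (Gamma ((1 + p) / 2) / 2)"
    using nn_integral_lborel_reflect[of ?g 0] g by simp
  have "(\<integral>\<^sup>+r. ennreal (W r * exp (- r\<^sup>2)) \<partial>lborel) =
    (\<integral>\<^sup>+r. ennreal ((1 + \<tau>) powr p) * ?g r + ennreal ((1 - \<tau>) powr p) * ?g (- r) \<partial>lborel)"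
  proof (intro nn_integral_cong)
    fix r :: real
    consider "r = 0" | "r > 0" | "r < 0" by linarith
    then show "ennreal (W r * exp (- r\<^sup>2)) = ennreal ((1 + \<tau>) powr p) * ?g r + ennreal ((1 - \<tau>) powr p) * ?g (- r)"
    proof cases
      case 3
      then show ?thesis using W_minus[of "-r"] by (simp add: mult.assoc flip: ennreal_mult)
    qed (simp_all add: W_nonneg_arg mult.assoc flip: ennreal_mult)
  qed
  also have "\<dots> = ennreal ((1 + \<tau>) powr p) * ennreal (Gamma ((1 + p) / 2) / 2) + ennreal ((1 - \<tau>) powr p) * ennreal (Gamma ((1 + p) / 2) / 2)"
    using g g' by (subst nn_integral_add) (auto simp: nn_integral_cmult)
  also have "\<dots> = ennreal (weight_sum * Gamma ((1 + p) / 2) / 2)"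
    using Gamma_real_pos[of "(1 + p) / 2"] p
    by (simp add: weight_sum_def algebra_simps add_divide_distrib flip: ennreal_mult ennreal_plus)
  finally show ?thesis .
qed

text \<open>Split off one coordinate, in the direction of \<open>u\<close>, from the Gaussian density: the
  remaining \<open>n - 1\<close> coordinates contribute \<open>\<pi>\<^bsup>(n-1)/2\<^esup>\<close>, which is found by
  doing the same with the constant weight one.\<close>

lemma nn_integral_W_gaussian_space:
  fixes u :: "'a::euclidean_space"
  assumes u: "norm u = 1"
  shows "(\<integral>\<^sup>+x. ennreal (W (u \<bullet> x) * exp (- (norm x)\<^sup>2)) \<partial>lborel) =
    ennreal (weight_sum * Gamma ((1 + p) / 2) / 2 * pi powr ((DIM('a) - 1) / 2))"
proof -
  define E where "E = (\<integral>\<^sup>+x. indicator (slab u) x * ennreal (exp (- ((norm x)\<^sup>2 - (x \<bullet> u)\<^sup>2))) \<partial>lborel)"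
  have split: "(\<integral>\<^sup>+x. ennreal (w (u \<bullet> x) * exp (- (norm x)\<^sup>2)) \<partial>lborel) =
      E * (\<integral>\<^sup>+r. ennreal (w r * exp (- r\<^sup>2)) \<partial>lborel)"
    if w [measurable]: "w \<in> borel_measurable borel" and w0: "\<And>r. 0 \<le> w r" for w :: "real \<Rightarrow> real"
  proof -
    have "(\<integral>\<^sup>+x. ennreal (w (u \<bullet> x) * exp (- (norm x)\<^sup>2)) \<partial>lborel) =
      (\<integral>\<^sup>+x. indicator (slab u) x * (\<integral>\<^sup>+t. ennreal (w (u \<bullet> (x + t *\<^sub>R u)) * exp (- (norm (x + t *\<^sub>R u))\<^sup>2)) \<partial>lborel) \<partial>lborel)"
      by (rule nn_integral_along_lines[OF _ u]) simp
    also have "\<dots> = (\<integral>\<^sup>+x. (indicator (slab u) x * ennreal (exp (- ((norm x)\<^sup>2 - (x \<bullet> u)\<^sup>2)))) *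
        (\<integral>\<^sup>+r. ennreal (w r * exp (- r\<^sup>2)) \<partial>lborel) \<partial>lborel)"
    proof (rule nn_integral_cong)
      fix x :: 'a
      have "(\<integral>\<^sup>+t. ennreal (w (u \<bullet> (x + t *\<^sub>R u)) * exp (- (norm (x + t *\<^sub>R u))\<^sup>2)) \<partial>lborel) =
        (\<integral>\<^sup>+t. ennreal (exp (- ((norm x)\<^sup>2 - (x \<bullet> u)\<^sup>2))) * ennreal (w (x \<bullet> u + t) * exp (- (x \<bullet> u + t)\<^sup>2)) \<partial>lborel)"
      proof (rule nn_integral_cong)
        fix t
        have "u \<bullet> (x + t *\<^sub>R u) = x \<bullet> u + t" using u by (simp add: inner_add_right inner_commute norm_eq_1)
        then show "ennreal (w (u \<bullet> (x + t *\<^sub>R u)) * exp (- (norm (x + t *\<^sub>R u))\<^sup>2)) =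
            ennreal (exp (- ((norm x)\<^sup>2 - (x \<bullet> u)\<^sup>2))) * ennreal (w (x \<bullet> u + t) * exp (- (x \<bullet> u + t)\<^sup>2))"
          using w0 by (simp add: norm_line_power2[OF u] mult.left_commute flip: ennreal_mult exp_add)
      qed
      also have "\<dots> = ennreal (exp (- ((norm x)\<^sup>2 - (x \<bullet> u)\<^sup>2))) * (\<integral>\<^sup>+t. ennreal (w (x \<bullet> u + t) * exp (- (x \<bullet> u + t)\<^sup>2)) \<partial>lborel)"
        by (rule nn_integral_cmult) simp
      also have "(\<integral>\<^sup>+t. ennreal (w (x \<bullet> u + t) * exp (- (x \<bullet> u + t)\<^sup>2)) \<partial>lborel) = (\<integral>\<^sup>+r. ennreal (w r * exp (- r\<^sup>2)) \<partial>lborel)"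
        by (rule nn_integral_lborel_translate) simp
      finally show "indicator (slab u) x * (\<integral>\<^sup>+t. ennreal (w (u \<bullet> (x + t *\<^sub>R u)) * exp (- (norm (x + t *\<^sub>R u))\<^sup>2)) \<partial>lborel) =
        indicator (slab u) x * ennreal (exp (- ((norm x)\<^sup>2 - (x \<bullet> u)\<^sup>2))) * (\<integral>\<^sup>+r. ennreal (w r * exp (- r\<^sup>2)) \<partial>lborel)"
        by (simp add: mult.assoc)
    qed
    also have "\<dots> = E * (\<integral>\<^sup>+r. ennreal (w r * exp (- r\<^sup>2)) \<partial>lborel)"
      unfolding E_def by (rule nn_integral_multc) simp
    finally show ?thesis .
  qed
  have "ennreal (pi powr (DIM('a) / 2)) = E * (\<integral>\<^sup>+r. ennreal (exp (- (norm (r::real))\<^sup>2)) \<partial>lborel)"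
    using split[of "\<lambda>_. 1"] nn_integral_gaussian[where 'a='a] by simp
  also have "(\<integral>\<^sup>+r. ennreal (exp (- (norm (r::real))\<^sup>2)) \<partial>lborel) = ennreal (pi powr (1 / 2))"
    using nn_integral_gaussian[where 'a=real] by simp
  finally have EE: "E * ennreal (pi powr (1 / 2)) = ennreal (pi powr (DIM('a) / 2))" by simp
  have "E = E * (ennreal (pi powr (1 / 2)) * ennreal (pi powr (- 1 / 2)))"
    by (simp flip: ennreal_mult powr_add)
  also have "\<dots> = ennreal (pi powr (DIM('a) / 2)) * ennreal (pi powr (- 1 / 2))"
    by (simp add: EE mult.assoc[symmetric])
  also have "\<dots> = ennreal (pi powr ((DIM('a) - 1) / 2))"
    by (simp add: diff_divide_distrib of_nat_diff Suc_leI flip: ennreal_mult powr_add)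
  finally have E: "E = ennreal (pi powr ((DIM('a) - 1) / 2))" .
  show ?thesis
    using split[of W] weight_sum_pos Gamma_real_pos[of "(1 + p) / 2"] p
    by (simp add: nn_integral_W_gaussian E mult.commute flip: ennreal_mult)
qed

lemma moment_const_tau_pos:
  assumes "n > 0" shows "moment_const_tau n p \<tau> > 0"
  using p assms weight_sum_pos unfolding moment_const_tau_def moment_const_def weight_sum_def
  by (intro divide_pos_pos mult_pos_pos Gamma_real_pos) auto

text \<open>Comparing the Gaussian integral of \<open>W (u \<bullet> x)\<close> in polar coordinates with its value from the
  splitting of one coordinate shows that \<open>c\<^sub>n\<^sub>,\<^sub>p(\<tau>)\<close> is the constant that makes the
  moment body of the unit ball the unit ball.\<close>

lemma nn_integral_W_sphere:
  fixes u :: "'a::euclidean_space"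
  assumes u: "norm u = 1"
  shows "(\<integral>\<^sup>+v. ennreal (W (u \<bullet> v)) \<partial>sphere_measure) = ennreal (1 / moment_const_tau DIM('a) p \<tau>)"
proof -
  define n where "n = DIM('a)"
  have n: "n > 0" by (simp add: n_def)
  define G where "G = Gamma ((real n + p) / 2) / 2"
  have G: "G > 0" unfolding G_def using n p by (intro divide_pos_pos Gamma_real_pos) auto
  have "(\<integral>\<^sup>+x. ennreal (W (u \<bullet> x) * exp (- (norm x)\<^sup>2)) \<partial>lborel) =
     (\<integral>\<^sup>+v. (\<integral>\<^sup>+s. indicator {0<..} s * (ennreal (W (u \<bullet> (s *\<^sub>R v)) * exp (- (norm (s *\<^sub>R v))\<^sup>2)) * ennreal (s ^ (n - 1))) \<partial>lborel) \<partial>sphere_measure)"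
    unfolding n_def by (rule nn_integral_polar) simp
  also have "\<dots> = (\<integral>\<^sup>+v. ennreal (W (u \<bullet> v)) * ennreal G \<partial>sphere_measure)"
  proof (rule nn_integral_cong)
    fix v :: 'a assume "v \<in> space sphere_measure"
    then have v: "norm v = 1" by (simp add: space_sphere_measure)
    have "(\<integral>\<^sup>+s. indicator {0<..} s * (ennreal (W (u \<bullet> (s *\<^sub>R v)) * exp (- (norm (s *\<^sub>R v))\<^sup>2)) * ennreal (s ^ (n - 1))) \<partial>lborel) =
      (\<integral>\<^sup>+s. ennreal (W (u \<bullet> v)) * (indicator {0<..} s * ennreal (s powr ((real n + p) - 1) * exp (- s\<^sup>2))) \<partial>lborel)"
    proof (rule nn_integral_cong)
      fix s :: real
      have "s powr p * s ^ (n - 1) = s powr (real n + p - 1)" if "s > 0"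
        using that n by (rule powr_mult_power_pred)
      then show "indicator {0<..} s * (ennreal (W (u \<bullet> (s *\<^sub>R v)) * exp (- (norm (s *\<^sub>R v))\<^sup>2)) * ennreal (s ^ (n - 1))) =
        ennreal (W (u \<bullet> v)) * (indicator {0<..} s * ennreal (s powr ((real n + p) - 1) * exp (- s\<^sup>2)))"
        by (auto split: split_indicator simp: v W_scale mult_ac simp flip: ennreal_mult)
    qed
    also have "\<dots> = ennreal (W (u \<bullet> v)) * ennreal G"
      using nn_integral_powr_exp_square[of "real n + p"] p by (subst nn_integral_cmult) (auto simp: G_def)
    finally show "(\<integral>\<^sup>+s. indicator {0<..} s * (ennreal (W (u \<bullet> (s *\<^sub>R v)) * exp (- (norm (s *\<^sub>R v))\<^sup>2)) * ennreal (s ^ (n - 1))) \<partial>lborel)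
       = ennreal (W (u \<bullet> v)) * ennreal G" .
  qed
  also have "\<dots> = (\<integral>\<^sup>+v. ennreal (W (u \<bullet> v)) \<partial>sphere_measure) * ennreal G"
    by (rule nn_integral_multc) (simp add: measurable_cong_sets[OF sets_sphere_measure refl] measurable_restrict_space1)
  finally have eq: "(\<integral>\<^sup>+v. ennreal (W (u \<bullet> v)) \<partial>sphere_measure) * ennreal G =
     ennreal (weight_sum * Gamma ((1 + p) / 2) / 2 * pi powr ((n - 1) / 2))"
    using nn_integral_W_gaussian_space[OF u] by (simp add: n_def)
  have "(\<integral>\<^sup>+v. ennreal (W (u \<bullet> v)) \<partial>sphere_measure) = (\<integral>\<^sup>+v. ennreal (W (u \<bullet> v)) \<partial>sphere_measure) * (ennreal G * ennreal (1 / G))"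
    using G by (simp flip: ennreal_mult)
  also have "\<dots> = ennreal (weight_sum * Gamma ((1 + p) / 2) / 2 * pi powr ((n - 1) / 2)) * ennreal (1 / G)"
    by (simp only: mult.assoc[symmetric] eq)
  also have "\<dots> = ennreal (1 / moment_const_tau n p \<tau>)"
  proof -
    have alg: "w * g / 2 * q * (1 / (h / 2)) = 1 / (h / (q * g) / w)" if "w > 0" "g > 0" "q > 0" "h > 0" for w g q h :: real
      using that by (simp add: field_simps)
    have "weight_sum * Gamma ((1 + p) / 2) / 2 * pi powr (real (n - 1) / 2) * (1 / G) = 1 / moment_const_tau n p \<tau>"
      unfolding moment_const_tau_def moment_const_def weight_sum_def[symmetric] G_def
      using G weight_sum_pos Gamma_real_pos[of "(1 + p) / 2"] p n
      by (subst alg) (auto simp: G_def of_nat_diff Suc_leI)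
    then show ?thesis
      using G weight_sum_pos Gamma_real_pos[of "(1 + p) / 2"] p by (simp flip: ennreal_mult)
  qed
  finally show ?thesis by (simp add: n_def)
qed

text \<open>The factor \<open>n + p\<close> comes from the radial integration.\<close>

definition nconst :: "nat \<Rightarrow> real" where
  "nconst n = (real n + p) * moment_const_tau n p \<tau>"

lemma nconst_pos: "n > 0 \<Longrightarrow> nconst n > 0"
  unfolding nconst_def using moment_const_tau_pos p by (intro mult_pos_pos) auto

lemma moment_scale:
  assumes "c \<ge> 0" "A \<in> sets borel"
  shows "moment A (c *\<^sub>R u) = ennreal (c powr p) * moment A u"
  unfolding moment_def using assms
  by (subst nn_integral_cmult[symmetric]) (auto simp: W_scale ennreal_mult mult.assoc)

text \<open>In polar coordinates the radial integral of \<open>s\<^sup>p s\<^sup>n\<^sup>-\<^sup>1\<close> is elementary, as \<open>W\<close> is homogeneous of degree \<open>p\<close>. The set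
  is prescribed on each ray only up to its end point, so that open and closed bodies are both covered.\<close>

lemma moment_radial:
  fixes u :: "'a::euclidean_space"
  assumes [measurable]: "A \<in> sets borel" "R \<in> borel_measurable borel"
    and A: "\<And>v s. norm v = 1 \<Longrightarrow> 0 < s \<Longrightarrow> s \<noteq> R v \<Longrightarrow> s *\<^sub>R v \<in> A \<longleftrightarrow> s < R v"
    and R: "\<And>v. norm v = 1 \<Longrightarrow> 0 < R v"
  shows "ennreal (real DIM('a) + p) * moment A u =
    (\<integral>\<^sup>+v. ennreal (W (u \<bullet> v) * R v powr (real DIM('a) + p)) \<partial>sphere_measure)"
proof -
  define n where "n = DIM('a)"
  have n: "n > 0" by (simp add: n_def)
  have np: "real n + p > 0" using p n by simp
  have "moment A u = (\<integral>\<^sup>+v. (\<integral>\<^sup>+s. indicator {0<..} s * (ennreal (W (u \<bullet> (s *\<^sub>R v))) * indicator A (s *\<^sub>R v) * ennreal (s ^ (n - 1))) \<partial>lborel) \<partial>sphere_measure)"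
    unfolding n_def moment_def by (rule nn_integral_polar) simp
  also have "\<dots> = (\<integral>\<^sup>+v. ennreal (W (u \<bullet> v) * R v powr (real n + p) / (real n + p)) \<partial>sphere_measure)"
  proof (rule nn_integral_cong)
    fix v :: 'a assume "v \<in> space sphere_measure"
    then have v: "norm v = 1" by (simp add: space_sphere_measure)
    have "(\<integral>\<^sup>+s. indicator {0<..} s * (ennreal (W (u \<bullet> (s *\<^sub>R v))) * indicator A (s *\<^sub>R v) * ennreal (s ^ (n - 1))) \<partial>lborel)
      = (\<integral>\<^sup>+s. ennreal (W (u \<bullet> v) * s powr (real n + p - 1)) * indicator {0..R v} s \<partial>lborel)"
    proof (rule nn_integral_cong_AE, use AE_lborel_singleton[of "R v"] AE_lborel_singleton[of 0] in eventually_elim)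
      case (elim s)
      have "s powr p * s ^ (n - 1) = s powr (real n + p - 1)" if "s > 0"
        using that n by (rule powr_mult_power_pred)
      then show ?case using elim A[OF v, of s]
        by (cases "s > 0") (auto split: split_indicator simp: W_scale mult_ac simp flip: ennreal_mult)
    qed
    also have "\<dots> = ennreal (W (u \<bullet> v) * (R v powr (real n + p - 1 + 1) / (real n + p - 1 + 1)))"
      using R[OF v] np p n
      by (intro nn_integral_has_integral_lebesgue' has_integral_mult_right has_integral_powr_from_0) auto
    finally show "(\<integral>\<^sup>+s. indicator {0<..} s * (ennreal (W (u \<bullet> (s *\<^sub>R v))) * indicator A (s *\<^sub>R v) * ennreal (s ^ (n - 1))) \<partial>lborel)
       = ennreal (W (u \<bullet> v) * R v powr (real n + p) / (real n + p))" by simp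
  qed
  finally have "ennreal (real n + p) * moment A u = (\<integral>\<^sup>+v. ennreal (real n + p) * ennreal (W (u \<bullet> v) * R v powr (real n + p) / (real n + p)) \<partial>sphere_measure)"
    by (simp only:) (subst nn_integral_cmult, auto simp: measurable_cong_sets[OF sets_sphere_measure refl] measurable_restrict_space1)
  also have "\<dots> = (\<integral>\<^sup>+v. ennreal (W (u \<bullet> v) * R v powr (real n + p)) \<partial>sphere_measure)"
    using np by (intro nn_integral_cong) (simp flip: ennreal_mult)
  finally show ?thesis by (simp add: n_def)
qed

lemma moment_between_balls:
  fixes u :: "'a::euclidean_space"
  assumes r: "r > 0" and [measurable]: "A \<in> sets borel" and A: "ball 0 r \<subseteq> A" "A \<subseteq> cball 0 r"
  shows "moment A u = ennreal (r powr (real DIM('a) + p) * norm u powr p / nconst DIM('a))"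
proof (cases "u = 0")
  case False
  define n where "n = DIM('a)"
  have n: "n > 0" by (simp add: n_def)
  have np: "real n + p > 0" using p n by simp
  define w where "w = u /\<^sub>R norm u"
  have w: "norm w = 1" "u = norm u *\<^sub>R w" using False by (auto simp: w_def)
  have "ennreal (real n + p) * moment A w =
    (\<integral>\<^sup>+v. ennreal (W (w \<bullet> v) * r powr (real n + p)) \<partial>sphere_measure)"
    unfolding n_def
  proof (rule moment_radial)
    fix v :: 'a and s :: real assume v: "norm v = 1" and s: "0 < s" "s \<noteq> r"
    then show "s *\<^sub>R v \<in> A \<longleftrightarrow> s < r" using subsetD[OF A(1), of "s *\<^sub>R v"] subsetD[OF A(2), of "s *\<^sub>R v"] by auto
  qed (use r in auto)
  also have "\<dots> = (\<integral>\<^sup>+v. ennreal (W (w \<bullet> v)) \<partial>sphere_measure) * ennreal (r powr (real n + p))"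
    by (simp add: ennreal_mult) (rule nn_integral_multc, simp add: measurable_cong_sets[OF sets_sphere_measure refl] measurable_restrict_space1)
  also have "\<dots> = ennreal (r powr (real n + p) / moment_const_tau n p \<tau>)"
    using moment_const_tau_pos[OF n] by (simp add: nn_integral_W_sphere[OF w(1)] n_def flip: ennreal_mult)
  finally have eq: "ennreal (real n + p) * moment A w = ennreal (r powr (real n + p) / moment_const_tau n p \<tau>)" .
  have "moment A w = ennreal (1 / (real n + p)) * (ennreal (real n + p) * moment A w)"
    using np by (simp add: mult.assoc[symmetric] flip: ennreal_mult)
  also have "\<dots> = ennreal (r powr (real n + p) / nconst n)"
    using np moment_const_tau_pos[OF n] by (simp add: eq nconst_def flip: ennreal_mult)
  finally have "moment A w = ennreal (r powr (real n + p) / nconst n)" .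
  then show ?thesis
    using moment_scale[of "norm u" A w] w(2) nconst_pos[OF n] by (simp add: n_def mult.commute flip: ennreal_mult)
qed (simp add: moment_def)

lemma moment_ball:
  fixes u :: "'a::euclidean_space"
  assumes "r > 0"
  shows "moment (ball 0 r) u = ennreal (r powr (real DIM('a) + p) * norm u powr p / nconst DIM('a))"
  using assms by (intro moment_between_balls) auto

end

section \<open>Convex bodies from sublinear functions\<close>

text \<open>The largest set whose support function is at most \<open>h\<close>.\<close>

definition wulff :: "('a::euclidean_space \<Rightarrow> real) \<Rightarrow> 'a set" where
  "wulff h = {x. \<forall>u. u \<bullet> x \<le> h u}"

lemma closed_wulff: "closed (wulff h)"
proof -
  have "wulff h = (\<Inter>u. {x. u \<bullet> x \<le> h u})" by (auto simp: wulff_def)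
  then show ?thesis by (auto intro!: closed_INT closed_halfspace_le)
qed

lemma convex_wulff: "convex (wulff h)"
proof -
  have "wulff h = (\<Inter>u. {x. u \<bullet> x \<le> h u})" by (auto simp: wulff_def)
  then show ?thesis by (auto intro!: convex_INT convex_halfspace_le)
qed

lemma wulff_mono: "(\<And>u. h u \<le> h' u) \<Longrightarrow> wulff h \<subseteq> wulff h'"
  unfolding wulff_def by (fastforce intro: order_trans)

lemma wulff_norm:
  assumes "c \<ge> 0"
  shows "wulff (\<lambda>u. c * norm u) = cball (0::'a::euclidean_space) c"
proof (intro equalityI subsetI)
  fix x :: 'a assume "x \<in> wulff (\<lambda>u. c * norm u)"
  then have "x \<bullet> x \<le> c * norm x" by (simp add: wulff_def)
  then have "norm x * norm x \<le> c * norm x" by (simp add: power2_norm_eq_inner[symmetric] power2_eq_square)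
  then show "x \<in> cball 0 c" using assms by (cases "x = 0") auto
next
  fix x :: 'a assume "x \<in> cball 0 c"
  then have "u \<bullet> x \<le> c * norm u" for u
    using norm_cauchy_schwarz[of u x] mult_left_mono[of "norm x" c "norm u"] by (simp add: mult.commute)
  then show "x \<in> wulff (\<lambda>u. c * norm u)" by (simp add: wulff_def)
qed

lemma exists_supporting_functional:
  fixes S :: "'a::euclidean_space set"
  assumes "convex S" "x \<in> S" "x \<notin> interior S" "interior S \<noteq> {}"
  obtains a where "a \<noteq> 0" "\<And>y. y \<in> S \<Longrightarrow> a \<bullet> y \<le> a \<bullet> x"
proof -
  have "x \<notin> rel_interior S" using assms by (simp add: rel_interior_nonempty_interior)
  then obtain a where "a \<noteq> 0" "\<And>y. y \<in> S \<Longrightarrow> a \<bullet> x \<le> a \<bullet> y"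
    using supporting_hyperplane_rel_boundary[OF assms(1,2)] by metis
  then show ?thesis by (intro that[of "- a"]) auto
qed

locale gauge_fun =
  fixes h :: "'a::euclidean_space \<Rightarrow> real" and c C :: real
  assumes add: "h (u + w) \<le> h u + h w"
    and scale: "s \<ge> 0 \<Longrightarrow> h (s *\<^sub>R u) = s * h u"
    and c: "0 < c" and lower: "c * norm u \<le> h u" and upper: "h u \<le> C * norm u"
begin

lemma zero [simp]: "h 0 = 0"
  using scale[of 0 0] by simp

lemma pos: "u \<noteq> 0 \<Longrightarrow> 0 < h u"
  using c lower[of u] by (smt (verit) mult_pos_pos zero_less_norm_iff)

lemma nonneg: "0 \<le> h u"
  using pos[of u] by (cases "u = 0") auto

lemma C_nonneg: "0 \<le> C"
proof -
  obtain b :: 'a where b: "b \<in> Basis" using nonempty_Basis by blast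
  then show ?thesis using upper[of b] nonneg[of b] by simp
qed

lemma wulff_subset: "wulff h \<subseteq> cball 0 C"
  using wulff_mono[of h "\<lambda>u. C * norm u"] upper wulff_norm[OF C_nonneg, where 'a='a] by auto

lemma subset_wulff: "cball 0 c \<subseteq> wulff h"
  using wulff_mono[of "\<lambda>u. c * norm u" h] lower wulff_norm[of c, where 'a='a] c by auto

lemma zero_interior: "0 \<in> interior (wulff h)"
  using subset_wulff c by (meson ball_subset_cball centre_in_ball interior_maximal open_ball subset_iff order_trans)

lemma compact_wulff: "compact (wulff h)"
  using wulff_subset closed_wulff by (metis bounded_cball bounded_subset compact_eq_bounded_closed)

lemma convex_body_wulff: "convex_body (wulff h)"
  using zero_interior compact_wulff convex_wulff by (auto simp: convex_body_def)

lemma wulff_borel [measurable]: "wulff h \<in> sets borel"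
  by (rule borel_closed[OF closed_wulff])

lemma support_attained:
  assumes "u \<noteq> 0"
  shows "\<exists>x\<in>wulff h. u \<bullet> x = h u"
proof -
  define D where "D = {v. h v \<le> 1}"
  define v where "v = u /\<^sub>R h u"
  have hu: "h u > 0" using pos assms by simp
  have hv: "h v = 1" unfolding v_def using scale[of "inverse (h u)" u] hu by simp
  have "convex D"
  proof (rule convexI)
    fix x y and a b :: real assume *: "x \<in> D" "y \<in> D" "0 \<le> a" "0 \<le> b" "a + b = 1"
    have "h (a *\<^sub>R x + b *\<^sub>R y) \<le> a * h x + b * h y" using add[of "a *\<^sub>R x" "b *\<^sub>R y"] scale * by simp
    also have "\<dots> \<le> a * 1 + b * 1" using * by (intro add_mono mult_left_mono) (auto simp: D_def)
    finally show "a *\<^sub>R x + b *\<^sub>R y \<in> D" using * by (simp add: D_def)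
  qed
  have bD: "cball 0 (1 / (C + 1)) \<subseteq> D"
  proof
    fix x :: 'a assume "x \<in> cball 0 (1 / (C + 1))"
    then have "norm x * (C + 1) \<le> 1" using C_nonneg by (simp add: field_simps)
    then have "C * norm x \<le> 1" using norm_ge_zero[of x] by (simp add: algebra_simps del: norm_ge_zero)
    then show "x \<in> D" using upper[of x] by (simp add: D_def)
  qed
  have D0: "0 \<in> interior D"
    using bD C_nonneg by (meson ball_subset_cball centre_in_ball interior_maximal open_ball subset_iff order_trans divide_pos_pos zero_less_one add_nonneg_pos)
  have "v \<notin> interior D"
  proof
    assume "v \<in> interior D"
    then obtain e where e: "e > 0" "cball v e \<subseteq> D"
      using mem_interior_cball by blast
    have v0: "norm v > 0" using hv zero by auto
    have "(1 + e / norm v) *\<^sub>R v \<in> cball v e" using v0 e by (simp add: dist_norm scaleR_left_distrib)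
    then have "h ((1 + e / norm v) *\<^sub>R v) \<le> 1" using e by (auto simp: D_def)
    then have "1 + e / norm v \<le> 1" using scale[of "1 + e / norm v" v] hv e v0 by simp
    then show False using e v0 by (simp add: divide_le_0_iff)
  qed
  moreover have "v \<in> D" by (simp add: D_def hv)
  ultimately obtain a where a: "a \<noteq> 0" "\<And>y. y \<in> D \<Longrightarrow> a \<bullet> y \<le> a \<bullet> v"
    using exists_supporting_functional[OF \<open>convex D\<close>] D0 by blast
  define k where "k = 1 / ((C + 1) * norm a)"
  have k: "k > 0" using a C_nonneg by (simp add: k_def)
  have "k *\<^sub>R a \<in> D" using bD a C_nonneg by (auto simp: k_def)
  then have "k * (a \<bullet> a) \<le> a \<bullet> v" using a(2)[of "k *\<^sub>R a"] by simp
  moreover have "k * (a \<bullet> a) > 0" using k a by simp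
  ultimately have av: "a \<bullet> v > 0" by linarith
  define x where "x = a /\<^sub>R (a \<bullet> v)"
  have "w \<bullet> x \<le> h w" for w
  proof (cases "w = 0")
    case False
    then have hw: "h w > 0" by (rule pos)
    then have "h (w /\<^sub>R h w) = 1" using scale[of "inverse (h w)" w] by simp
    then have "a \<bullet> (w /\<^sub>R h w) \<le> a \<bullet> v" by (intro a) (simp add: D_def)
    then have "a \<bullet> w \<le> h w * (a \<bullet> v)" using hw by (simp add: field_simps)
    then show ?thesis using av by (simp add: x_def inner_commute field_simps)
  qed simp
  then have "x \<in> wulff h" by (simp add: wulff_def)
  moreover have "u \<bullet> x = h u"
  proof -
    have "u = h u *\<^sub>R v" using hu by (simp add: v_def)
    then have "u \<bullet> x = h u * (v \<bullet> x)" by (metis inner_scaleR_left)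
    also have "v \<bullet> x = 1" using av by (simp add: x_def inner_commute)
    finally show ?thesis by simp
  qed
  ultimately show ?thesis by blast
qed

lemma support_fun_wulff: "support_fun (wulff h) u = h u"
proof (cases "u = 0")
  case True
  have "0 \<in> wulff h" using zero_interior interior_subset by blast
  then have "(\<lambda>y. 0) ` wulff h = {0::real}" by auto
  then show ?thesis using True by (simp add: support_fun_def)
next
  case False
  then obtain x where "x \<in> wulff h" "u \<bullet> x = h u" using support_attained by blast
  then show ?thesis unfolding support_fun_def
    by (intro antisym cSUP_least cSUP_upper2[of _ _ x]) (auto simp: wulff_def intro!: bdd_aboveI[of _ "h u"])
qed

text \<open>A convex body is the intersection of its supporting half-spaces.\<close>

lemma wulff_unique:
  assumes K: "convex_body K" "0 \<in> interior K" and s: "\<And>u. u \<in> sphere 0 1 \<Longrightarrow> support_fun K u = h u"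
  shows "K = wulff h"
proof
  have cK: "compact K" "convex K" "0 \<in> K" using K interior_subset by (auto simp: convex_body_def)
  have bdd: "bdd_above ((\<bullet>) u ` K)" for u
    using cK(1) by (intro bounded_imp_bdd_above compact_imp_bounded compact_continuous_image continuous_intros)
  have hn: "support_fun K (u /\<^sub>R norm u) = h u / norm u" if "u \<noteq> 0" for u
    using s[of "u /\<^sub>R norm u"] scale[of "inverse (norm u)" u] that by (simp add: field_simps)
  show "K \<subseteq> wulff h"
  proof
    fix x assume x: "x \<in> K"
    have "u \<bullet> x \<le> h u" for u
    proof (cases "u = 0")
      case False
      have "(u /\<^sub>R norm u) \<bullet> x \<le> support_fun K (u /\<^sub>R norm u)"
        unfolding support_fun_def by (intro cSUP_upper x bdd)
      then show ?thesis using False hn[of u] by (simp add: field_simps)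
    qed simp
    then show "x \<in> wulff h" by (simp add: wulff_def)
  qed
  show "wulff h \<subseteq> K"
  proof
    fix x assume x: "x \<in> wulff h"
    show "x \<in> K"
    proof (rule ccontr)
      assume "x \<notin> K"
      then obtain a b where ab: "a \<bullet> x < b" "\<And>y. y \<in> K \<Longrightarrow> b < a \<bullet> y"
        using separating_hyperplane_closed_point[OF cK(2) compact_imp_closed[OF cK(1)]] by metis
      have a0: "a \<noteq> 0" using ab(1) ab(2)[OF cK(3)] by auto
      have "support_fun K ((- a) /\<^sub>R norm (- a)) \<le> - b / norm a"
        unfolding support_fun_def
      proof (rule cSUP_least)
        fix y assume "y \<in> K"
        then show "((- a) /\<^sub>R norm (- a)) \<bullet> y \<le> - b / norm a"
          using ab(2)[of y] a0 by (simp add: field_simps)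
      qed (use cK in auto)
      then have "h (- a) \<le> - b" using hn[of "- a"] a0 by (simp add: field_simps)
      then have "(- a) \<bullet> x \<le> - b" using x unfolding wulff_def by (smt (verit) mem_Collect_eq)
      then show False using ab(1) by simp
    qed
  qed
qed

text \<open>The boundary point of the body on the ray through \<open>e\<close> has a supporting functional; as
  \<open>0\<close> is interior, this functional is positive at \<open>e\<close> and can be normalized there.\<close>

lemma exit_functional:
  assumes g: "g > 0" "g *\<^sub>R e \<in> wulff h" and out: "\<And>t. t > g \<Longrightarrow> t *\<^sub>R e \<notin> wulff h"
  shows "\<exists>u. u \<bullet> e = 1 \<and> h u = g"
proof -
  have e0: "e \<noteq> 0"
  proof
    assume "e = 0"
    then show False using out[of "g + 1"] g by simp
  qed
  have "g *\<^sub>R e \<notin> interior (wulff h)"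
  proof
    assume "g *\<^sub>R e \<in> interior (wulff h)"
    then obtain d where d: "d > 0" "cball (g *\<^sub>R e) d \<subseteq> wulff h" using mem_interior_cball by blast
    have "(g + d / norm e) *\<^sub>R e \<in> cball (g *\<^sub>R e) d" using d e0 by (simp add: dist_norm scaleR_left_distrib)
    then have "(g + d / norm e) *\<^sub>R e \<in> wulff h" using d by blast
    moreover have "g + d / norm e > g" using d e0 by simp
    ultimately show False using out by blast
  qed
  then obtain a where a: "a \<noteq> 0" "\<And>y. y \<in> wulff h \<Longrightarrow> a \<bullet> y \<le> a \<bullet> (g *\<^sub>R e)"
    using exists_supporting_functional[OF convex_wulff g(2)] zero_interior by blast
  obtain y where y: "y \<in> wulff h" "a \<bullet> y = h a" using support_attained[OF a(1)] by blast
  have ha: "h a = g * (a \<bullet> e)"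
    using a(2)[OF y(1)] y(2) g(2) by (intro antisym) (auto simp: wulff_def)
  have ae: "a \<bullet> e > 0" using pos[OF a(1)] g ha by (simp add: zero_less_mult_iff)
  then show ?thesis
    using ha scale[of "inverse (a \<bullet> e)" a] by (intro exI[of _ "a /\<^sub>R (a \<bullet> e)"]) (simp add: field_simps)
qed

end

section \<open>Moment bodies under Steiner symmetrization\<close>

text \<open>The class of sets to which the moment functional is applied. It is stable under Steiner
  symmetrization with the same radii, in contrast to the star bodies.\<close>

definition sandwiched :: "real \<Rightarrow> real \<Rightarrow> 'a::euclidean_space set \<Rightarrow> bool" where
  "sandwiched r R A \<longleftrightarrow> A \<in> sets borel \<and> ball 0 r \<subseteq> A \<and> A \<subseteq> cball 0 R \<and> 0 < r \<and> 0 \<le> R"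

lemma sandwichedD [dest]:
  assumes "sandwiched r R A"
  shows "A \<in> sets borel" "ball 0 r \<subseteq> A" "A \<subseteq> cball 0 R" "0 < r" "0 \<le> R"
  using assms by (auto simp: sandwiched_def)

lemma sandwiched_steiner:
  assumes "sandwiched r R A" "norm e = 1" shows "sandwiched r R (steiner e A)"
  using sandwichedD[OF assms(1)] assms(2) unfolding sandwiched_def
  by (intro conjI steiner_borel steiner_subset_cball ball_subset_steiner)

lemma chord_minus:
  fixes A :: "'a::euclidean_space set"
  assumes [measurable]: "A \<in> sets borel"
  shows "chord A (- e) x = chord A e x"
proof -
  have "(\<integral>\<^sup>+t. indicator A (x + t *\<^sub>R (- e)) \<partial>lborel) = (\<integral>\<^sup>+t. indicator A (x + (0 - t) *\<^sub>R e) \<partial>lborel)" by simp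
  also have "\<dots> = (\<integral>\<^sup>+t. indicator A (x + t *\<^sub>R e) \<partial>lborel)"
    by (rule nn_integral_lborel_reflect) measurable
  finally show ?thesis
    unfolding chord_def measure_def emeasure_line_section[OF assms] by simp
qed

lemma steiner_minus: "A \<in> sets borel \<Longrightarrow> steiner (- e) A = steiner e A"
  by (simp add: steiner_def chord_minus)

lemma measure_mono_chord:
  fixes K Q :: "'a::euclidean_space set"
  assumes K: "K \<in> sets borel" "K \<subseteq> cball 0 R" and Q: "Q \<in> sets borel" "Q \<subseteq> cball 0 R" and e: "norm e = 1"
    and le: "\<And>x. chord K e x \<le> chord Q e x"
  shows "measure lborel K \<le> measure lborel Q"
proof -
  have "emeasure lborel K \<le> emeasure lborel Q"
    unfolding emeasure_along_lines[OF K(1) e] emeasure_along_lines[OF Q(1) e]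
    by (intro nn_integral_mono mult_left_mono) (simp_all add: emeasure_chord[OF e K] emeasure_chord[OF e Q] le ennreal_leI)
  moreover have "emeasure lborel Q < \<infinity>"
    using emeasure_mono[OF Q(2), of lborel] emeasure_compact_finite[of "cball (0::'a) R"]
    by (auto intro: le_less_trans)
  ultimately show ?thesis by (simp add: measure_def enn2real_mono)
qed

context gauge_fun
begin

text \<open>The body contains \<open>x + t e\<close> for every \<open>t\<close> between the suprema and infima imposed by the functionals with
  \<open>u \<bullet> e = 1\<close> and \<open>w \<bullet> e = - 1\<close>; by homogeneity these account for all functionals that do not vanish at
  \<open>e\<close>, and the remaining ones are limits of them.\<close>

lemma chord_wulff_ge:
  assumes e: "norm e = 1"
    and D: "0 \<le> D" "\<And>u w. u \<bullet> e = 1 \<Longrightarrow> w \<bullet> e = - 1 \<Longrightarrow> D \<le> h u + h w - (u + w) \<bullet> x"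
  shows "D \<le> chord (wulff h) e x"
proof -
  have ee: "e \<bullet> e = 1" using e by (simp add: norm_eq_1)
  define U where "U = {h u - u \<bullet> x |u. u \<bullet> e = 1}"
  define V where "V = {h w - w \<bullet> x |w. w \<bullet> e = - 1}"
  have Une: "h e - e \<bullet> x \<in> U" using ee by (auto simp: U_def)
  have Vne: "h (- e) - (- e) \<bullet> x \<in> V" using ee unfolding V_def by (intro CollectI exI[of _ "- e"]) simp
  have sum: "D \<le> a + b" if "a \<in> U" "b \<in> V" for a b
    using that D(2) by (fastforce simp: U_def V_def inner_add_left)
  have bU: "bdd_below U" using sum[OF _ Vne] by (intro bdd_belowI[of _ "D - (h (- e) - (- e) \<bullet> x)"]) force
  have bV: "bdd_below V" using sum[OF Une] by (intro bdd_belowI[of _ "D - (h e - e \<bullet> x)"]) force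
  have "D - b \<le> Inf U" if "b \<in> V" for b
    using sum[OF _ that] Une by (intro cInf_greatest) force+
  then have "D - Inf U \<le> Inf V" using Vne by (intro cInf_greatest) force+
  then have DUV: "D \<le> Inf U + Inf V" by simp
  have "{- Inf V .. Inf U} \<subseteq> {t. x + t *\<^sub>R e \<in> wulff h}"
  proof
    fix t assume t: "t \<in> {- Inf V .. Inf U}"
    have tU: "t \<le> h u - u \<bullet> x" if "u \<bullet> e = 1" for u
      using t cInf_lower[OF _ bU, of "h u - u \<bullet> x"] that by (force simp: U_def)
    have tV: "- t \<le> h u - u \<bullet> x" if "u \<bullet> e = - 1" for u
      using t cInf_lower[OF _ bV, of "h u - u \<bullet> x"] that by (force simp: V_def)
    have *: "u \<bullet> (x + t *\<^sub>R e) \<le> h u" if "u \<bullet> e \<noteq> 0" for u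
    proof -
      define s where "s = \<bar>u \<bullet> e\<bar>"
      have s: "s > 0" using that by (simp add: s_def)
      define v where "v = u /\<^sub>R s"
      have u: "u = s *\<^sub>R v" using s by (simp add: v_def)
      have "v \<bullet> e = 1 \<or> v \<bullet> e = - 1" using that by (auto simp: v_def s_def abs_if)
      then have "v \<bullet> x + t * (v \<bullet> e) \<le> h v" using tU[of v] tV[of v] by auto
      then have "s * (v \<bullet> x + t * (v \<bullet> e)) \<le> s * h v" using s by simp
      then show ?thesis using scale[of s v] s unfolding u by (simp add: inner_add_right distrib_left mult.left_commute)
    qed
    have "u \<bullet> (x + t *\<^sub>R e) \<le> h u" for u
    proof (cases "u \<bullet> e = 0")
      case True
      \<comment> \<open>A functional that vanishes on \<open>e\<close> is approximated by \<open>u + \<epsilon> e\<close>.\<close>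
      show ?thesis
      proof (rule field_le_epsilon)
        fix d :: real assume d: "d > 0"
        define b where "b = \<bar>h e - e \<bullet> (x + t *\<^sub>R e)\<bar> + 1"
        define k where "k = d / b"
        have b: "b > 0" by (simp add: b_def)
        have k: "k > 0" using d b by (simp add: k_def)
        have "(u + k *\<^sub>R e) \<bullet> (x + t *\<^sub>R e) \<le> h (u + k *\<^sub>R e)"
          using True k ee by (intro *) (simp add: inner_add_left)
        also have "\<dots> \<le> h u + k * h e" using add[of u "k *\<^sub>R e"] scale[of k e] k by simp
        finally have "u \<bullet> (x + t *\<^sub>R e) \<le> h u + k * (h e - e \<bullet> (x + t *\<^sub>R e))"
          by (simp add: inner_add_left algebra_simps)
        also have "\<dots> \<le> h u + k * b" using k by (intro add_left_mono mult_left_mono) (auto simp: b_def)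
        also have "k * b = d" using b by (simp add: k_def)
        finally show "u \<bullet> (x + t *\<^sub>R e) \<le> h u + d" .
      qed
    qed (use * in auto)
    then show "t \<in> {t. x + t *\<^sub>R e \<in> wulff h}" by (simp add: wulff_def)
  qed
  then have "emeasure lborel {- Inf V .. Inf U} \<le> emeasure lborel {t. x + t *\<^sub>R e \<in> wulff h}"
    by (intro emeasure_mono) auto
  then have "ennreal (Inf U + Inf V) \<le> ennreal (chord (wulff h) e x)"
    using DUV D(1) emeasure_chord[OF e wulff_borel wulff_subset] by (simp add: emeasure_lborel_Icc)
  then show ?thesis using DUV by (simp add: ennreal_le_iff)
qed

text \<open>The two ends of the chord through the origin are boundary points; the functionals that support the body
  there, normalized at \<open>\<plusminus> e\<close>, attain the infimum that gives the length of the chord.\<close>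

lemma chord_wulff_origin:
  assumes e: "norm e = 1"
  obtains u w where "u \<bullet> e = 1" "w \<bullet> e = - 1" "chord (wulff h) e 0 = h u + h w"
    "\<And>t. t *\<^sub>R e \<in> wulff h \<longleftrightarrow> t \<in> {- h w .. h u}"
proof -
  have exit: "\<exists>u. u \<bullet> d = 1 \<and> h u *\<^sub>R d \<in> wulff h \<and> (\<forall>t>h u. t *\<^sub>R d \<notin> wulff h)" if d: "norm d = 1" for d :: 'a
  proof -
    define T where "T = {t. t *\<^sub>R d \<in> wulff h}"
    have "closed ((\<lambda>t. t *\<^sub>R d) -` wulff h)"
      by (intro closed_vimage closed_wulff continuous_intros)
    then have "closed T" by (simp add: T_def vimage_def)
    have Tsub: "T \<subseteq> {-C..C}" using wulff_subset d by (auto simp: T_def dest!: subsetD) 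
    have cT: "c \<in> T" using subset_wulff d c by (auto simp: T_def)
    have bT: "bdd_above T" using Tsub by (meson bdd_above_Icc bdd_above_mono)
    have g: "Sup T \<in> T" using closed_contains_Sup[OF _ bT \<open>closed T\<close>] cT by blast
    have "Sup T \<ge> c" using cSup_upper[OF cT bT] .
    have out: "t *\<^sub>R d \<notin> wulff h" if "t > Sup T" for t
      using cSup_upper[OF _ bT, of t] that by (force simp: T_def)
    obtain u where "u \<bullet> d = 1" "h u = Sup T"
      using exit_functional[of "Sup T" d] g out \<open>Sup T \<ge> c\<close> c by (auto simp: T_def)
    then show ?thesis using g out by (auto simp: T_def)
  qed
  obtain u where u: "u \<bullet> e = 1" "h u *\<^sub>R e \<in> wulff h" "\<And>t. t > h u \<Longrightarrow> t *\<^sub>R e \<notin> wulff h"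
    using exit[OF e] by blast
  obtain w where w: "w \<bullet> (- e) = 1" "h w *\<^sub>R (- e) \<in> wulff h" "\<And>t. t > h w \<Longrightarrow> t *\<^sub>R (- e) \<notin> wulff h"
    using exit[of "- e"] e by auto
  have iff: "t *\<^sub>R e \<in> wulff h \<longleftrightarrow> t \<in> {- h w .. h u}" for t
  proof
    assume t: "t *\<^sub>R e \<in> wulff h"
    then show "t \<in> {- h w .. h u}" using u(3)[of t] w(3)[of "- t"] by force
  next
    assume t: "t \<in> {- h w .. h u}"
    have "convex {t. t *\<^sub>R e \<in> wulff h}"
      using convex_linear_vimage[of "\<lambda>t. t *\<^sub>R e" "wulff h"] convex_wulff[of h]
      by (simp add: vimage_def bounded_linear.linear[OF bounded_linear_scaleR_left])
    then have "closed_segment (- h w) (h u) \<subseteq> {t. t *\<^sub>R e \<in> wulff h}"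
      using u(2) w(2) by (intro closed_segment_subset) auto
    then show "t *\<^sub>R e \<in> wulff h"
      using t nonneg[of u] nonneg[of w] by (auto simp: closed_segment_eq_real_ivl)
  qed
  have "{t. 0 + t *\<^sub>R e \<in> wulff h} = {- h w .. h u}"
    unfolding add_0 iff by (rule Collect_mem_eq)
  then have "chord (wulff h) e 0 = h u + h w"
    using nonneg[of u] nonneg[of w] by (simp add: chord_def)
  then show ?thesis using that[OF u(1) _ _ iff] w(1) by simp
qed

end

context moment_weight
begin

text \<open>For the weight \<open>\<alpha>\<close> proportional to \<open>x\<close>, the convexity inequality \<open>powr_add_le\<close> is an equality.\<close>

lemma split_powr:
  assumes "x > 0" "y > 0"
  defines "\<alpha> \<equiv> x / (x + y)"
  shows "\<alpha> powr (1 - p) * x powr p + (1 - \<alpha>) powr (1 - p) * y powr p = (x + y) powr p"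
proof -
  have *: "(z / (x + y)) powr (1 - p) * z powr p = z * (x + y) powr (p - 1)" if "z > 0" for z
  proof -
    have "(z / (x + y)) powr (1 - p) * z powr p = (z powr (1 - p) * z powr p) / (x + y) powr (1 - p)"
      using that assms by (simp add: powr_divide)
    also have "z powr (1 - p) * z powr p = z" using that by (simp flip: powr_add)
    also have "z / (x + y) powr (1 - p) = z * (x + y) powr (p - 1)"
      by (simp add: divide_inverse powr_minus[symmetric])
    finally show ?thesis .
  qed
  have "1 - \<alpha> = y / (x + y)" using assms by (simp add: field_simps)
  then have "\<alpha> powr (1 - p) * x powr p + (1 - \<alpha>) powr (1 - p) * y powr p = (x + y) * (x + y) powr (p - 1)"
    unfolding \<alpha>_def using *[OF assms(1)] *[OF assms(2)] by (simp add: distrib_right)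
  also have "\<dots> = (x + y) powr p" using assms powr_add[of "x + y" 1 "p - 1"] by simp
  finally show ?thesis .
qed

definition supp :: "'a::euclidean_space set \<Rightarrow> 'a \<Rightarrow> real" where
  "supp A u = (nconst DIM('a) * enn2real (moment A u)) powr (1 / p)"

lemma supp_nonneg [simp]: "0 \<le> supp A u"
  by (simp add: supp_def)

lemma moment_bounds:
  fixes A :: "'a::euclidean_space set"
  assumes A: "sandwiched r R A"
  shows "moment (ball 0 r) u \<le> moment A u" "moment A u \<le> moment (ball 0 (R + 1)) u" "moment A u < \<infinity>"
proof -
  show "moment (ball 0 r) u \<le> moment A u"
    unfolding moment_def using sandwichedD[OF A] by (intro nn_integral_mono) (auto split: split_indicator)
  show 1: "moment A u \<le> moment (ball 0 (R + 1)) u"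
    unfolding moment_def using sandwichedD[OF A] by (intro nn_integral_mono) (force split: split_indicator)
  have "moment (ball 0 (R + 1)) u < \<infinity>" using sandwichedD[OF A] by (subst moment_ball) auto
  then show "moment A u < \<infinity>" using 1 by (rule le_less_trans[rotated])
qed

lemma supp_powr:
  fixes A :: "'a::euclidean_space set"
  assumes A: "sandwiched r R A"
  shows "ennreal (supp A u powr p) = ennreal (nconst DIM('a)) * moment A u"
  unfolding supp_def using nconst_pos[of "DIM('a)"] p moment_bounds(3)[OF A, of u]
  by (simp add: powr_powr ennreal_mult)

lemma supp_ball:
  assumes "r > 0"
  shows "supp (ball (0::'a::euclidean_space) r) u = r powr ((real DIM('a) + p) / p) * norm u"
  unfolding supp_def using assms nconst_pos[of "DIM('a)"] p
  by (simp add: moment_ball powr_mult powr_powr)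

lemma supp_mono:
  fixes A B :: "'a::euclidean_space set"
  assumes "moment A u \<le> moment B u" "moment B u < \<infinity>"
  shows "supp A u \<le> supp B u"
  unfolding supp_def using nconst_pos[of "DIM('a)"] p assms
  by (intro powr_mono2 mult_left_mono enn2real_mono) auto

lemma supp_bounds:
  fixes A :: "'a::euclidean_space set"
  assumes A: "sandwiched r R A"
  shows "r powr ((real DIM('a) + p) / p) * norm u \<le> supp A u"
    "supp A u \<le> (R + 1) powr ((real DIM('a) + p) / p) * norm u"
proof -
  have r: "r > 0" "R + 1 > 0" using sandwichedD[OF A] by auto
  show "r powr ((real DIM('a) + p) / p) * norm u \<le> supp A u"
    using supp_mono[OF moment_bounds(1,3)[OF A], of u] r by (simp add: supp_ball)
  have "moment (ball 0 (R + 1)) u < \<infinity>" using r by (subst moment_ball) auto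
  then show "supp A u \<le> (R + 1) powr ((real DIM('a) + p) / p) * norm u"
    using supp_mono[OF moment_bounds(2)[OF A], of u] r by (simp add: supp_ball)
qed

lemma supp_pos:
  assumes A: "sandwiched r R A" and "u \<noteq> 0"
  shows "supp A u > 0"
proof -
  have "0 < r powr ((real DIM('a) + p) / p) * norm u" using sandwichedD[OF A] assms by simp
  then show ?thesis using supp_bounds(1)[OF A, of u] by linarith
qed

text \<open>The weighted form of convexity of \<open>t\<^sup>p\<close>, with the weight chosen from the two
  values, is Minkowski's inequality; it is applied below across two different sets.\<close>

lemma supp_add_le:
  fixes A B :: "'a::euclidean_space set"
  assumes A: "sandwiched r R A" and B: "sandwiched r' R' B" and uw: "u \<noteq> 0" "w \<noteq> 0"
    and le: "\<And>\<alpha>. 0 < \<alpha> \<Longrightarrow> \<alpha> < 1 \<Longrightarrow>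
      moment B z \<le> ennreal (\<alpha> powr (1 - p)) * moment A u + ennreal ((1 - \<alpha>) powr (1 - p)) * moment A w"
  shows "supp B z \<le> supp A u + supp A w"
proof -
  let ?x = "supp A u" and ?y = "supp A w"
  have pos: "?x > 0" "?y > 0" using supp_pos[OF A] uw by auto
  define \<alpha> where "\<alpha> = ?x / (?x + ?y)"
  have \<alpha>: "0 < \<alpha>" "\<alpha> < 1" using pos by (auto simp: \<alpha>_def)
  have "ennreal (supp B z powr p) \<le> ennreal (nconst DIM('a)) *
      (ennreal (\<alpha> powr (1 - p)) * moment A u + ennreal ((1 - \<alpha>) powr (1 - p)) * moment A w)"
    unfolding supp_powr[OF B] by (intro mult_left_mono le \<alpha>) auto
  also have "\<dots> = ennreal (\<alpha> powr (1 - p)) * ennreal (?x powr p) + ennreal ((1 - \<alpha>) powr (1 - p)) * ennreal (?y powr p)"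
    unfolding supp_powr[OF A] by (simp add: algebra_simps)
  also have "\<dots> = ennreal ((?x + ?y) powr p)"
    using split_powr[OF pos] by (simp add: \<alpha>_def flip: ennreal_mult ennreal_plus)
  finally have "supp B z powr p \<le> (?x + ?y) powr p" by simp
  then show ?thesis using pos p by (meson add_pos_pos less_imp_le not_le powr_less_mono2 supp_nonneg less_trans zero_less_one)
qed

lemma gauge_supp:
  fixes A :: "'a::euclidean_space set"
  assumes A: "sandwiched r R A"
  shows "gauge_fun (supp A) (r powr ((real DIM('a) + p) / p)) ((R + 1) powr ((real DIM('a) + p) / p))"
proof
  have [measurable]: "A \<in> sets borel" using A by auto
  have 0: "supp A 0 = 0" using supp_bounds(2)[OF A, of 0] by (intro antisym) auto
  fix u w :: 'a and s :: real
  show "supp A (u + w) \<le> supp A u + supp A w"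
  proof (cases "u = 0 \<or> w = 0")
    case False
    show ?thesis
    proof (rule supp_add_le[OF A A])
      fix \<alpha> :: real assume \<alpha>: "0 < \<alpha>" "\<alpha> < 1"
      have "moment A (u + w) \<le> (\<integral>\<^sup>+x. ennreal (\<alpha> powr (1 - p)) * (ennreal (W (u \<bullet> x)) * indicator A x) +
           ennreal ((1 - \<alpha>) powr (1 - p)) * (ennreal (W (w \<bullet> x)) * indicator A x) \<partial>lborel)"
        unfolding moment_def
      proof (rule nn_integral_mono)
        fix x
        have "ennreal (W ((u + w) \<bullet> x)) \<le> ennreal (\<alpha> powr (1 - p) * W (u \<bullet> x) + (1 - \<alpha>) powr (1 - p) * W (w \<bullet> x))"
          unfolding inner_add_left by (intro ennreal_leI W_add_le \<alpha>)
        then show "ennreal (W ((u + w) \<bullet> x)) * indicator A x \<le> ennreal (\<alpha> powr (1 - p)) * (ennreal (W (u \<bullet> x)) * indicator A x) +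
           ennreal ((1 - \<alpha>) powr (1 - p)) * (ennreal (W (w \<bullet> x)) * indicator A x)"
          by (auto split: split_indicator simp: ennreal_mult)
      qed
      also have "\<dots> = ennreal (\<alpha> powr (1 - p)) * moment A u + ennreal ((1 - \<alpha>) powr (1 - p)) * moment A w"
        unfolding moment_def by (simp add: nn_integral_add nn_integral_cmult)
      finally show "moment A (u + w) \<le> ennreal (\<alpha> powr (1 - p)) * moment A u + ennreal ((1 - \<alpha>) powr (1 - p)) * moment A w" .
    qed (use False in auto)
  qed (auto simp: 0)
  show "supp A (s *\<^sub>R u) = s * supp A u" if "0 \<le> s"
    unfolding supp_def using that nconst_pos[of "DIM('a)"] p
    by (simp add: moment_scale enn2real_mult powr_mult powr_powr)
qed (use sandwichedD[OF A] supp_bounds[OF A] in auto)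

definition mbody :: "'a::euclidean_space set \<Rightarrow> 'a set" where
  "mbody A = wulff (supp A)"

text \<open>On every line parallel to \<open>e\<close>, the two integrals are the two sides of the
  one-dimensional rearrangement inequality.\<close>

lemma steiner_line_le:
  fixes A :: "'a::euclidean_space set"
  assumes A: "sandwiched r R A" and e: "norm e = 1" and uw: "u \<bullet> e = 1" "w \<bullet> e = - 1" and \<alpha>: "0 < \<alpha>" "\<alpha> < 1"
  shows "(\<integral>\<^sup>+t. indicator (steiner e A) (x + t *\<^sub>R e) * ennreal (W ((u + w + 2 *\<^sub>R e) \<bullet> (x + t *\<^sub>R e))) \<partial>lborel) =
      (\<integral>\<^sup>+r\<in>{-(chord A e x / 2)<..<chord A e x / 2}. ennreal (W (u \<bullet> x + w \<bullet> x + 2 * r)) \<partial>lborel)" (is ?eq)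
    and "(\<integral>\<^sup>+t. indicator (steiner e A) (x + t *\<^sub>R e) * ennreal (W ((u + w + 2 *\<^sub>R e) \<bullet> (x + t *\<^sub>R e))) \<partial>lborel) \<le>
      (\<integral>\<^sup>+t. indicator A (x + t *\<^sub>R e) * ennreal (\<alpha> powr (1 - p) * W (u \<bullet> (x + t *\<^sub>R e)) + (1 - \<alpha>) powr (1 - p) * W (w \<bullet> (x + t *\<^sub>R e))) \<partial>lborel)" (is ?le)
proof -
  have AA[measurable]: "A \<in> sets borel" and AR: "A \<subseteq> cball 0 R" using A by auto
  have ee: "e \<bullet> e = 1" using e by (simp add: norm_eq_1)
  show eq: ?eq
    by (subst nn_integral_line_steiner[OF AA e])
      (auto intro!: nn_integral_cong simp: inner_add_left inner_add_right inner_diff_right uw ee inner_commute[of x e] algebra_simps)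
  have "(\<integral>\<^sup>+r\<in>{-(chord A e x / 2)<..<chord A e x / 2}. ennreal (W (u \<bullet> x + w \<bullet> x + 2 * r)) \<partial>lborel) \<le>
    (\<integral>\<^sup>+t\<in>{t. x + t *\<^sub>R e \<in> A}. ennreal (\<alpha> powr (1 - p) * W (u \<bullet> x + t) + (1 - \<alpha>) powr (1 - p) * W (w \<bullet> x - t)) \<partial>lborel)"
    by (rule line_rearrangement[OF _ emeasure_chord[OF e AA AR] _ \<alpha>]) auto
  also have "\<dots> = (\<integral>\<^sup>+t. indicator A (x + t *\<^sub>R e) * ennreal (\<alpha> powr (1 - p) * W (u \<bullet> (x + t *\<^sub>R e)) + (1 - \<alpha>) powr (1 - p) * W (w \<bullet> (x + t *\<^sub>R e))) \<partial>lborel)"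
    by (intro nn_integral_cong) (auto simp: inner_add_right uw indicator_def)
  finally show ?le using eq by simp
qed

lemma moment_split:
  assumes [measurable]: "A \<in> sets borel"
  shows "(\<integral>\<^sup>+x. indicator A x * ennreal (a powr q * W (u \<bullet> x) + b powr q * W (w \<bullet> x)) \<partial>lborel) =
    ennreal (a powr q) * moment A u + ennreal (b powr q) * moment A w"
proof -
  have "(\<integral>\<^sup>+x. indicator A x * ennreal (a powr q * W (u \<bullet> x) + b powr q * W (w \<bullet> x)) \<partial>lborel) =
    (\<integral>\<^sup>+x. ennreal (a powr q) * (ennreal (W (u \<bullet> x)) * indicator A x) + ennreal (b powr q) * (ennreal (W (w \<bullet> x)) * indicator A x) \<partial>lborel)"
    by (intro nn_integral_cong) (auto split: split_indicator simp: ennreal_mult)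
  also have "\<dots> = ennreal (a powr q) * moment A u + ennreal (b powr q) * moment A w"
    unfolding moment_def by (simp add: nn_integral_add nn_integral_cmult)
  finally show ?thesis .
qed

text \<open>The key estimate, obtained by integrating the rearrangement inequality over all lines. On a
  line parallel to \<open>e\<close>, the value of \<open>u + w + 2 e\<close> at height \<open>r\<close> is the sum of the value of \<open>u\<close> at height
  \<open>m + r\<close> and the value of \<open>w\<close> at height \<open>m - r\<close>, whatever the midpoint \<open>m\<close> of the original chord is.\<close>

lemma supp_steiner_le:
  fixes A :: "'a::euclidean_space set"
  assumes A: "sandwiched r R A" and e: "norm e = 1" and uw: "u \<bullet> e = 1" "w \<bullet> e = - 1"
  shows "supp (steiner e A) (u + w + 2 *\<^sub>R e) \<le> supp A u + supp A w"
proof (rule supp_add_le[OF A sandwiched_steiner[OF A e]])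
  show "u \<noteq> 0" "w \<noteq> 0" using uw by auto
  have AA[measurable]: "A \<in> sets borel" using A by auto
  fix \<alpha> :: real assume \<alpha>: "0 < \<alpha>" "\<alpha> < 1"
  have "moment (steiner e A) (u + w + 2 *\<^sub>R e) =
     (\<integral>\<^sup>+x. indicator (steiner e A) x * ennreal (W ((u + w + 2 *\<^sub>R e) \<bullet> x)) \<partial>lborel)"
    by (simp add: moment_def mult.commute)
  also have "\<dots> \<le> (\<integral>\<^sup>+x. indicator A x * ennreal (\<alpha> powr (1 - p) * W (u \<bullet> x) + (1 - \<alpha>) powr (1 - p) * W (w \<bullet> x)) \<partial>lborel)"
    by (intro nn_integral_mono_lines[OF _ _ e] steiner_line_le(2)[OF A e uw \<alpha>]) measurable
  also have "\<dots> = ennreal (\<alpha> powr (1 - p)) * moment A u + ennreal ((1 - \<alpha>) powr (1 - p)) * moment A w"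
    by (rule moment_split) simp
  finally show "moment (steiner e A) (u + w + 2 *\<^sub>R e) \<le> ennreal (\<alpha> powr (1 - p)) * moment A u + ennreal ((1 - \<alpha>) powr (1 - p)) * moment A w" .
qed

lemma supp_steiner_le':
  fixes A :: "'a::euclidean_space set"
  assumes A: "sandwiched r R A" and e: "norm e = 1" and uw: "u \<bullet> e = 1" "w \<bullet> e = - 1"
  shows "supp (steiner e A) (u + w - 2 *\<^sub>R e) \<le> supp A u + supp A w"
  using supp_steiner_le[OF A, of "- e" w u] e uw A steiner_minus[of A e] by (auto simp: add.commute)

text \<open>Testing a point of the chord against \<open>u + w + 2 e\<close> bounds it from above, and against
  \<open>u + w - 2 e\<close> from below.\<close>

lemma chord_mbody_steiner:
  fixes A :: "'a::euclidean_space set"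
  assumes A: "sandwiched r R A" and e: "norm e = 1" and uw: "u \<bullet> e = 1" "w \<bullet> e = - 1" and x: "x \<bullet> e = 0"
    and ne: "x + t0 *\<^sub>R e \<in> mbody (steiner e A)"
  shows "chord (mbody (steiner e A)) e x \<le>
    (supp (steiner e A) (u + w + 2 *\<^sub>R e) + supp (steiner e A) (u + w - 2 *\<^sub>R e)) / 2 - (u + w) \<bullet> x"
proof -
  let ?S = "supp (steiner e A)"
  interpret S: gauge_fun ?S "r powr ((real DIM('a) + p) / p)" "(R + 1) powr ((real DIM('a) + p) / p)"
    by (rule gauge_supp[OF sandwiched_steiner[OF A e]])
  have ee: "e \<bullet> e = 1" using e by (simp add: norm_eq_1)
  have ex: "e \<bullet> x = 0" using x by (simp add: inner_commute)
  let ?b = "(?S (u + w + 2 *\<^sub>R e) - (u + w) \<bullet> x) / 2" and ?a = "(?S (u + w - 2 *\<^sub>R e) - (u + w) \<bullet> x) / 2"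
  have sub: "{t. x + t *\<^sub>R e \<in> mbody (steiner e A)} \<subseteq> {- ?a .. ?b}"
  proof
    fix t assume "t \<in> {t. x + t *\<^sub>R e \<in> mbody (steiner e A)}"
    then have t: "v \<bullet> (x + t *\<^sub>R e) \<le> ?S v" for v by (simp add: mbody_def wulff_def)
    have "(u + w + 2 *\<^sub>R e) \<bullet> (x + t *\<^sub>R e) = (u + w) \<bullet> x + 2 * t"
      "(u + w - 2 *\<^sub>R e) \<bullet> (x + t *\<^sub>R e) = (u + w) \<bullet> x - 2 * t"
      using uw ee ex by (simp_all add: inner_add_left inner_add_right inner_diff_left algebra_simps)
    then have "(u + w) \<bullet> x + 2 * t \<le> ?S (u + w + 2 *\<^sub>R e)" "(u + w) \<bullet> x - 2 * t \<le> ?S (u + w - 2 *\<^sub>R e)"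
      using t[of "u + w + 2 *\<^sub>R e"] t[of "u + w - 2 *\<^sub>R e"] by simp_all
    moreover have "- ((\<beta> - k) / 2) \<le> t \<and> t \<le> (\<alpha> - k) / 2" if "k + 2 * t \<le> \<alpha>" "k - 2 * t \<le> \<beta>" for \<alpha> \<beta> k :: real
      using that by (simp add: field_simps)
    ultimately show "t \<in> {- ?a .. ?b}" by simp
  qed
  then have "t0 \<in> {- ?a .. ?b}" using ne by blast
  then have ab: "- ?a \<le> ?b" by (meson atLeastAtMost_iff order_trans)
  have "emeasure lborel {t. x + t *\<^sub>R e \<in> mbody (steiner e A)} \<le> emeasure lborel {- ?a .. ?b}"
    using sub by (intro emeasure_mono) auto
  then have "ennreal (chord (mbody (steiner e A)) e x) \<le> ennreal (?b + ?a)"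
    using ab S.wulff_borel by (simp add: emeasure_chord[OF e _ S.wulff_subset] mbody_def emeasure_lborel_Icc)
  then have "chord (mbody (steiner e A)) e x \<le> ?b + ?a" using ab by (subst (asm) ennreal_le_iff) linarith+
  then show ?thesis by (simp add: add_divide_distrib diff_divide_distrib)
qed

lemma chord_mbody_steiner_le:
  fixes A :: "'a::euclidean_space set"
  assumes A: "sandwiched r R A" and e: "norm e = 1"
  shows "chord (mbody (steiner e A)) e x \<le> chord (mbody A) e x"
proof -
  interpret H: gauge_fun "supp A" "r powr ((real DIM('a) + p) / p)" "(R + 1) powr ((real DIM('a) + p) / p)"
    by (rule gauge_supp[OF A])
  interpret S: gauge_fun "supp (steiner e A)" "r powr ((real DIM('a) + p) / p)" "(R + 1) powr ((real DIM('a) + p) / p)"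
    by (rule gauge_supp[OF sandwiched_steiner[OF A e]])
  have orth: "chord (mbody (steiner e A)) e x \<le> chord (mbody A) e x" if x: "x \<bullet> e = 0" for x
  proof (cases "\<exists>t. x + t *\<^sub>R e \<in> mbody (steiner e A)")
    case True
    then obtain t0 where t0: "x + t0 *\<^sub>R e \<in> mbody (steiner e A)" by blast
    show ?thesis
      unfolding mbody_def[of A]
    proof (rule H.chord_wulff_ge[OF e])
      fix u w :: 'a assume uw: "u \<bullet> e = 1" "w \<bullet> e = - 1"
      show "chord (mbody (steiner e A)) e x \<le> supp A u + supp A w - (u + w) \<bullet> x"
      proof -
        have "l \<le> m - k" if "l \<le> (a + b) / 2 - k" "a \<le> m" "b \<le> m" for l m k a b :: real
          using that by (simp add: field_simps)
        from this[OF chord_mbody_steiner[OF A e uw x t0] supp_steiner_le[OF A e uw] supp_steiner_le'[OF A e uw]]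
        show ?thesis .
      qed
    qed simp
  next
    case False
    then have "chord (mbody (steiner e A)) e x = 0" by (simp add: chord_def)
    then show ?thesis by simp
  qed
  have b: "mbody A \<in> sets borel" "mbody (steiner e A) \<in> sets borel" by (simp_all add: mbody_def)
  have "(x - (x \<bullet> e) *\<^sub>R e) \<bullet> e = 0" using e by (simp add: inner_diff_left norm_eq_1)
  from orth[OF this] show ?thesis
    using chord_shift[OF b(1), of e "x - (x \<bullet> e) *\<^sub>R e" "x \<bullet> e"] chord_shift[OF b(2), of e "x - (x \<bullet> e) *\<^sub>R e" "x \<bullet> e"] by simp
qed

lemma mbody_borel:
  assumes "sandwiched r R A" shows "mbody A \<in> sets borel"
  using gauge_fun.wulff_borel[OF gauge_supp[OF assms]] by (simp add: mbody_def)

lemma mbody_subset: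
  fixes A :: "'a::euclidean_space set"
  assumes "sandwiched r R A" shows "mbody A \<subseteq> cball 0 ((R + 1) powr ((real DIM('a) + p) / p))"
  using gauge_fun.wulff_subset[OF gauge_supp[OF assms]] by (simp add: mbody_def)

lemma measure_mbody_steiner_le:
  fixes A :: "'a::euclidean_space set"
  assumes A: "sandwiched r R A" and e: "norm e = 1"
  shows "measure lborel (mbody (steiner e A)) \<le> measure lborel (mbody A)"
  using sandwiched_steiner[OF A e] A
  by (intro measure_mono_chord[OF mbody_borel mbody_subset mbody_borel mbody_subset e] chord_mbody_steiner_le[OF A e])

lemma measure_mbody_iterate_le:
  fixes A :: "'a::euclidean_space set"
  assumes A: "sandwiched r R A" and "steiner_iterate A B"
  shows "sandwiched r R B \<and> measure lborel (mbody B) \<le> measure lborel (mbody A)"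
  using assms(2)
proof induction
  case (steiner_step B e)
  then show ?case using measure_mbody_steiner_le[of r R B e] sandwiched_steiner[of r R B e] by linarith
qed (use A in simp)

text \<open>An iterated symmetral of \<open>A\<close> covers the ball of the same volume up to a set of measure \<open>\<delta>\<close>, which lowers
  the \<open>p\<close>th power of the support function at \<open>u\<close> by at most a multiple of \<open>\<delta> \<bar>u\<bar>\<^sup>p\<close>. So its moment body
  contains a ball whose radius \<open>c \<delta>\<close> tends to that of the moment body of the ball.\<close>

theorem measure_mbody_ge:
  fixes A :: "'a::euclidean_space set"
  assumes A: "sandwiched r0 R A" and r: "0 < r" "r \<le> R"
    and vol: "emeasure lborel A = emeasure lborel (ball (0::'a) r)"
  shows "measure lborel (cball (0::'a) (r powr ((real DIM('a) + p) / p))) \<le> measure lborel (mbody A)"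
proof -
  define n where "n = DIM('a)"
  define K where "K = nconst n * (2 * r) powr p"
  define c where "c \<delta> = max 0 (r powr (real n + p) - K * \<delta>) powr (1 / p)" for \<delta>
  have nc: "nconst n > 0" by (simp add: n_def nconst_pos)
  have fin: "emeasure lborel (S::'a set) < \<infinity>" if "S \<subseteq> ball 0 r" for S
    using emeasure_mono[of S "ball 0 r" lborel] that emeasure_lborel_ball_finite[of "0::'a" r] by (auto intro: le_less_trans)
  have step: "measure lborel (cball (0::'a) (c \<delta>)) \<le> measure lborel (mbody A)" if \<delta>: "\<delta> > 0" for \<delta>
  proof -
    obtain B where B: "steiner_iterate A B" "measure lborel (ball 0 r - B) < \<delta>"
      using steiner_iterates_approach_ball[OF sandwichedD(1,3)[OF A] r vol \<delta>] by blast
    have SB: "sandwiched r0 R B" and le: "measure lborel (mbody B) \<le> measure lborel (mbody A)"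
      using measure_mbody_iterate_le[OF A B(1)] by auto
    have [measurable]: "B \<in> sets borel" using SB by auto
    have "c \<delta> * norm u \<le> supp B u" for u :: 'a
    proof -
      have "moment (ball 0 r) u \<le> (\<integral>\<^sup>+x. ennreal (W (u \<bullet> x)) * indicator B x + ennreal ((2 * r * norm u) powr p) * indicator (ball 0 r - B) x \<partial>lborel)"
        unfolding moment_def
      proof (rule nn_integral_mono)
        fix x :: 'a
        have "W (u \<bullet> x) \<le> (2 * r * norm u) powr p" if "norm x < r"
        proof -
          have "\<bar>u \<bullet> x\<bar> \<le> norm u * norm x" by (rule Cauchy_Schwarz_ineq2)
          also have "\<dots> \<le> norm u * r" using that by (intro mult_left_mono) auto
          finally have "(2 * \<bar>u \<bullet> x\<bar>) powr p \<le> (2 * r * norm u) powr p"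
            using p by (intro powr_mono2) (auto simp: mult.commute mult.left_commute)
          then show ?thesis using W_le[of "u \<bullet> x"] by linarith
        qed
        then show "ennreal (W (u \<bullet> x)) * indicator (ball 0 r) x \<le> ennreal (W (u \<bullet> x)) * indicator B x + ennreal ((2 * r * norm u) powr p) * indicator (ball 0 r - B) x"
          by (auto split: split_indicator intro: ennreal_leI)
      qed
      also have "\<dots> = moment B u + ennreal ((2 * r * norm u) powr p) * emeasure lborel (ball 0 r - B)"
        unfolding moment_def by (subst nn_integral_add) (auto simp: nn_integral_cmult_indicator)
      also have "\<dots> \<le> moment B u + ennreal ((2 * r * norm u) powr p) * ennreal \<delta>"
      proof (intro add_left_mono mult_left_mono)
        show "emeasure lborel (ball 0 r - B) \<le> ennreal \<delta>"
          using B(2) fin[of "ball 0 r - B"] by (subst emeasure_eq_ennreal_measure) (auto intro: ennreal_leI)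
      qed simp
      finally have "ennreal (nconst n) * moment (ball 0 r) u \<le>
          ennreal (nconst n) * (moment B u + ennreal ((2 * r * norm u) powr p) * ennreal \<delta>)"
        by (rule mult_left_mono) simp
      also have "\<dots> = ennreal (supp B u powr p + nconst n * (2 * r * norm u) powr p * \<delta>)"
        using nc \<delta> by (simp add: supp_powr[OF SB] n_def[symmetric] distrib_left ennreal_mult mult.assoc)
      finally have "r powr (real n + p) * norm u powr p \<le> supp B u powr p + K * norm u powr p * \<delta>"
        using nc r \<delta> by (simp add: moment_ball n_def[symmetric] K_def powr_mult mult_ac flip: ennreal_mult ennreal_plus)
      then have "(r powr (real n + p) - K * \<delta>) * norm u powr p \<le> supp B u powr p"
        by (simp add: algebra_simps)
      then have "max 0 (r powr (real n + p) - K * \<delta>) * norm u powr p \<le> supp B u powr p"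
        by (auto simp: max_def)
      then have "(max 0 (r powr (real n + p) - K * \<delta>) * norm u powr p) powr (1 / p) \<le> (supp B u powr p) powr (1 / p)"
        using p by (intro powr_mono2) auto
      then show ?thesis using p by (simp add: c_def powr_mult powr_powr)
    qed
    then have "cball 0 (c \<delta>) \<subseteq> mbody B"
      unfolding mbody_def using wulff_mono[of "\<lambda>u. c \<delta> * norm u" "supp B"] wulff_norm[of "c \<delta>", where 'a='a] by (simp add: c_def)
    then have "measure lborel (cball (0::'a) (c \<delta>)) \<le> measure lborel (mbody B)"
      using mbody_borel[OF SB] mbody_subset[OF SB] emeasure_compact_finite[OF compact_cball]
      by (intro measure_mono_fmeasurable fmeasurableI2[OF _ mbody_subset[OF SB]] fmeasurableI) auto
    then show ?thesis using le by simp
  qed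
  have "((\<lambda>\<delta>. c \<delta>) \<longlongrightarrow> max 0 (r powr (real n + p) - K * 0) powr (1 / p)) (at_right 0)"
    unfolding c_def using p r by (intro tendsto_intros) auto
  moreover have "max 0 (r powr (real n + p) - K * 0) powr (1 / p) = r powr ((real n + p) / p)"
    using r by (simp add: powr_powr)
  ultimately have "((\<lambda>\<delta>. measure lborel (cball (0::'a) (c \<delta>))) \<longlongrightarrow> measure lborel (cball (0::'a) (r powr ((real n + p) / p)))) (at_right 0)"
  proof -
    assume "(c \<longlongrightarrow> max 0 (r powr (real n + p) - K * 0) powr (1 / p)) (at_right 0)"
      and "max 0 (r powr (real n + p) - K * 0) powr (1 / p) = r powr ((real n + p) / p)"
    then have "((\<lambda>\<delta>. unit_ball_vol (real n) * c \<delta> ^ n) \<longlongrightarrow> unit_ball_vol (real n) * (r powr ((real n + p) / p)) ^ n) (at_right 0)"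
      by (intro tendsto_intros) simp
    moreover have "measure lborel (cball (0::'a) s) = unit_ball_vol (real n) * s ^ n" if "s \<ge> 0" for s
      using that by (simp add: content_cball n_def)
    ultimately show ?thesis by (simp add: c_def)
  qed
  moreover have "\<forall>\<^sub>F \<delta> in at_right 0. measure lborel (cball (0::'a) (c \<delta>)) \<le> measure lborel (mbody A)"
    using eventually_at_right_less[of "0::real"] by eventually_elim (rule step)
  ultimately show ?thesis
    unfolding n_def by (intro tendsto_upperbound[OF _ _ trivial_limit_at_right_real])
qed

end

section \<open>Star bodies and their moment bodies\<close>

lemma star_body_ray:
  fixes L :: "'a::euclidean_space set"
  assumes L: "star_body L" and x: "x \<noteq> 0" and l: "0 \<le> l"
  shows "l *\<^sub>R x \<in> L \<longleftrightarrow> l \<le> radial_fun L x"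
proof -
  define T where "T = {l. 0 \<le> l \<and> l *\<^sub>R x \<in> L}"
  have cL: "compact L" and star: "star_shaped_origin L" using L by (auto simp: star_body_def)
  have "closed ((\<lambda>l. l *\<^sub>R x) -` L)" using compact_imp_closed[OF cL] by (intro closed_vimage continuous_intros)
  then have "closed ({0..} \<inter> (\<lambda>l. l *\<^sub>R x) -` L)" by (intro closed_Int closed_atLeast)
  moreover have "{0..} \<inter> (\<lambda>l. l *\<^sub>R x) -` L = T" by (auto simp: T_def)
  ultimately have cT: "closed T" by simp
  obtain R where R: "L \<subseteq> cball 0 R" using compact_imp_bounded[OF cL] unfolding bounded_iff by (metis mem_cball_0 subsetI)
  have bT: "bdd_above T"
  proof (rule bdd_aboveI)
    fix l assume "l \<in> T"
    then have "l * norm x \<le> R" using R by (force simp: T_def)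
    then show "l \<le> R / norm x" using x by (simp add: field_simps)
  qed
  have T0: "0 \<in> T" using star by (simp add: T_def star_shaped_origin_def)
  have rho: "radial_fun L x = Sup T" by (simp add: radial_fun_def T_def)
  have ST: "Sup T \<in> T" using closed_contains_Sup[OF _ bT cT] T0 by blast
  show ?thesis
  proof
    assume "l *\<^sub>R x \<in> L"
    then show "l \<le> radial_fun L x" unfolding rho using l by (intro cSup_upper bT) (simp add: T_def)
  next
    assume le: "l \<le> radial_fun L x"
    show "l *\<^sub>R x \<in> L"
    proof (cases "l = 0")
      case False
      then have S0: "Sup T > 0" using le l rho by simp
      have "l *\<^sub>R x = (l / Sup T) *\<^sub>R (Sup T *\<^sub>R x)" using S0 by simp
      moreover have "l / Sup T \<le> 1" "0 \<le> l / Sup T" using S0 le l rho by auto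
      ultimately have "l *\<^sub>R x \<in> closed_segment 0 (Sup T *\<^sub>R x)"
        unfolding in_segment by (intro exI[of _ "l / Sup T"]) simp
      then show ?thesis using star ST by (auto simp: star_shaped_origin_def T_def)
    qed (use T0 in \<open>simp add: T_def\<close>)
  qed
qed

lemma star_body_sandwiched:
  fixes L :: "'a::euclidean_space set"
  assumes L: "star_body L"
  obtains r R where "sandwiched r R L" "R0 \<le> R"
proof -
  have cL: "compact L" and pos: "\<And>x. x \<noteq> 0 \<Longrightarrow> 0 < radial_fun L x" and cont: "continuous_on (- {0}) (radial_fun L)"
    using L by (auto simp: star_body_def)
  have c: "continuous_on (sphere 0 1) (radial_fun L)" by (rule continuous_on_subset[OF cont]) auto
  obtain b :: 'a where b: "b \<in> Basis" using nonempty_Basis by blast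
  then have ne: "sphere (0::'a) 1 \<noteq> {}" by (auto intro!: exI[of _ b])
  obtain v0 :: 'a where v0: "v0 \<in> sphere 0 1" "\<And>v. v \<in> sphere 0 1 \<Longrightarrow> radial_fun L v0 \<le> radial_fun L v"
    using continuous_attains_inf[OF compact_sphere ne c] by blast
  define r where "r = radial_fun L v0"
  have r: "r > 0" unfolding r_def using v0 by (intro pos) auto
  have "ball 0 r \<subseteq> L"
  proof
    fix x :: 'a assume x: "x \<in> ball 0 r"
    show "x \<in> L"
    proof (cases "x = 0")
      case False
      have "norm x \<le> radial_fun L (x /\<^sub>R norm x)" using x v0(2)[of "x /\<^sub>R norm x"] False by (simp add: r_def)
      then have "norm x *\<^sub>R (x /\<^sub>R norm x) \<in> L" using star_body_ray[OF L, of "x /\<^sub>R norm x" "norm x"] False by simp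
      then show ?thesis using False by simp
    qed (use L in \<open>simp add: star_body_def star_shaped_origin_def\<close>)
  qed
  moreover obtain R where R: "L \<subseteq> cball 0 R" using compact_imp_bounded[OF cL] unfolding bounded_iff by (metis mem_cball_0 subsetI)
  moreover have "L \<subseteq> cball 0 (max R (max 0 R0))" using R by fastforce
  ultimately have "sandwiched r (max R (max 0 R0)) L"
    using r compact_imp_closed[OF cL] by (simp add: sandwiched_def)
  then show ?thesis using that by fastforce
qed

text \<open>The radial function exceeds one at \<open>s x\<close>, hence near it by continuity.\<close>

lemma star_body_interior:
  fixes L :: "'a::euclidean_space set"
  assumes L: "star_body L" and x: "x \<in> L" and s: "0 \<le> s" "s < 1"
  shows "s *\<^sub>R x \<in> interior L"
proof (cases "s *\<^sub>R x = 0")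
  case True
  obtain r R where S: "sandwiched r R L" using star_body_sandwiched[OF L, of 0] by blast
  have "ball 0 r \<subseteq> interior L" using sandwichedD(2)[OF S] by (intro interior_maximal) auto
  moreover have "0 \<in> ball (0::'a) r" using sandwichedD(4)[OF S] by simp
  ultimately show ?thesis using True by auto
next
  case False
  then have sx: "s > 0" "x \<noteq> 0" using s by auto
  have cont: "continuous_on (- {0}) (radial_fun L)" using L by (simp add: star_body_def)
  define U where "U = (- {0}) \<inter> radial_fun L -` {1<..}"
  have "open U" unfolding U_def by (rule continuous_open_preimage[OF cont]) auto
  moreover have "U \<subseteq> L"
  proof
    fix y assume "y \<in> U"
    then show "y \<in> L" using star_body_ray[OF L, of y 1] by (auto simp: U_def)
  qed
  moreover have "s *\<^sub>R x \<in> U"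
  proof -
    have "(1 / s) *\<^sub>R (s *\<^sub>R x) \<in> L" using x sx by simp
    then have "1 / s \<le> radial_fun L (s *\<^sub>R x)" using star_body_ray[OF L False, of "1 / s"] sx by simp
    moreover have "1 < 1 / s" using s sx by simp
    ultimately show ?thesis using False by (auto simp: U_def)
  qed
  ultimately show ?thesis using interior_maximal by blast
qed

context moment_weight
begin

lemma sphere_integral_moment:
  fixes L :: "'a::euclidean_space set"
  assumes L: "star_body L"
  shows "(\<integral>v. phi_tau \<tau> (u \<bullet> v) powr p * radial_fun L v powr (real DIM('a) + p) \<partial>sphere_measure) =
    (real DIM('a) + p) * enn2real (moment L u)"
proof -
  define R where "R v = indicator (- {0}) v *\<^sub>R radial_fun L v" for v
  have R [measurable]: "R \<in> borel_measurable borel"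
    unfolding R_def using L by (intro borel_measurable_continuous_on_indicator) (auto simp: star_body_def)
  have [measurable]: "L \<in> sets borel" using L by (auto simp: star_body_def intro: borel_closed compact_imp_closed)
  have Rv: "R v = radial_fun L v" if "norm v = 1" for v
  proof -
    have "v \<noteq> 0" using that by auto
    then show ?thesis by (simp add: R_def)
  qed
  have "(\<integral>v. phi_tau \<tau> (u \<bullet> v) powr p * radial_fun L v powr (real DIM('a) + p) \<partial>sphere_measure) =
     (\<integral>v. W (u \<bullet> v) * R v powr (real DIM('a) + p) \<partial>sphere_measure)"
    by (intro Bochner_Integration.integral_cong) (auto simp: W_def Rv space_sphere_measure)
  also have "\<dots> = enn2real (\<integral>\<^sup>+v. ennreal (W (u \<bullet> v) * R v powr (real DIM('a) + p)) \<partial>sphere_measure)"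
    by (intro integral_eq_nn_integral)
      (simp_all add: measurable_cong_sets[OF sets_sphere_measure refl] measurable_restrict_space1)
  also have "(\<integral>\<^sup>+v. ennreal (W (u \<bullet> v) * R v powr (real DIM('a) + p)) \<partial>sphere_measure) =
      ennreal (real DIM('a) + p) * moment L u"
  proof (rule moment_radial[symmetric])
    fix v :: 'a assume v: "norm v = 1"
    then have "v \<noteq> 0" by auto
    then show "0 < R v" using L v by (simp add: Rv star_body_def)
    fix s :: real assume "0 < s" "s \<noteq> R v"
    then show "s *\<^sub>R v \<in> L \<longleftrightarrow> s < R v" using star_body_ray[OF L \<open>v \<noteq> 0\<close>, of s] v by (auto simp: Rv)
  qed simp_all
  finally show ?thesis using p by (simp add: enn2real_mult)
qed

text \<open>The set \<open>mbody L\<close> has the prescribed support function, and a convex body is determined by its support function.\<close>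

lemma moment_body_eq:
  fixes L :: "'a::euclidean_space set"
  assumes L: "star_body L"
  shows "moment_body p \<tau> L = mbody L"
proof -
  obtain r R where S: "sandwiched r R L" using star_body_sandwiched[OF L, of 0] by blast
  interpret H: gauge_fun "supp L" "r powr ((real DIM('a) + p) / p)" "(R + 1) powr ((real DIM('a) + p) / p)"
    by (rule gauge_supp[OF S])
  have rhs: "moment_const_tau DIM('a) p \<tau> *
     (\<integral>v. phi_tau \<tau> (u \<bullet> v) powr p * radial_fun L v powr (real DIM('a) + p) \<partial>sphere_measure) = supp L u powr p" for u :: 'a
    unfolding sphere_integral_moment[OF L] supp_def using p nconst_pos[of "DIM('a)"]
    by (simp add: powr_powr nconst_def)
  show ?thesis
    unfolding moment_body_def rhs mbody_def
  proof (rule the_equality)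
    show "convex_body (wulff (supp L)) \<and> 0 \<in> interior (wulff (supp L)) \<and>
      (\<forall>u\<in>sphere 0 1. support_fun (wulff (supp L)) u powr p = supp L u powr p)"
      using H.convex_body_wulff H.zero_interior by (simp add: H.support_fun_wulff)
    fix K assume K: "convex_body K \<and> 0 \<in> interior K \<and> (\<forall>u\<in>sphere 0 1. support_fun K u powr p = supp L u powr p)"
    show "K = wulff (supp L)"
    proof (rule H.wulff_unique)
      fix u :: 'a assume u: "u \<in> sphere 0 1"
      have K0: "0 \<in> K" using K interior_subset by blast
      have "bdd_above ((\<bullet>) u ` K)"
        using K by (intro bounded_imp_bdd_above compact_imp_bounded compact_continuous_image continuous_intros) (auto simp: convex_body_def)
      then have "0 \<le> support_fun K u" unfolding support_fun_def using K0 by (intro cSUP_upper2[of _ _ 0]) auto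
      moreover have "support_fun K u powr p = supp L u powr p" using K u by blast
      moreover have "(y powr p) powr (1 / p) = y" if "0 \<le> y" for y
        using p that by (simp add: powr_powr)
      ultimately show "support_fun K u = supp L u" by (metis supp_nonneg)
    qed (use K in auto)
  qed
qed

end

section \<open>Equality forces symmetry about the origin\<close>

text \<open>Statements that hold on almost all lines are transferred to the line through the origin along such a
  sequence.\<close>

lemma AE_sequence_to_origin:
  fixes P :: "'a::euclidean_space \<Rightarrow> bool"
  assumes ae: "AE x in lborel. x \<in> ball 0 \<epsilon> \<longrightarrow> P x" and \<epsilon>: "\<epsilon> > 0"
  obtains X where "X \<longlonglongrightarrow> 0" "\<And>k::nat. P (X k)" "\<And>k. norm (X k) < \<epsilon>"
proof -
  have "\<exists>x. norm x < min \<epsilon> (inverse (real (Suc k))) \<and> P x" for k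
  proof (rule ccontr)
    assume *: "\<not> ?thesis"
    let ?B = "ball (0::'a) (min \<epsilon> (inverse (real (Suc k))))"
    have "AE x in lborel. x \<notin> ?B"
      using ae by eventually_elim (use * in auto)
    then have "emeasure lborel ?B = 0"
      using AE_iff_null_sets[of ?B lborel] by (simp add: null_sets_def)
    then show False
      using \<epsilon> emeasure_ball_neq_0[of "min \<epsilon> (inverse (real (Suc k)))" "0::'a"] by simp
  qed
  then obtain X where X: "\<And>k. norm (X k) < min \<epsilon> (inverse (real (Suc k))) \<and> P (X k)" by metis
  have "X \<longlonglongrightarrow> 0"
    by (rule tendsto_norm_zero_cancel, rule Lim_null_comparison[OF _ LIMSEQ_inverse_real_of_nat])
      (use X in \<open>auto intro!: always_eventually less_imp_le\<close>)
  then show ?thesis using X that by auto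
qed

text \<open>Dominated convergence: the indicator function of \<open>G\<close> is continuous at every point of the limiting
  line that is interior or exterior to \<open>G\<close>, which leaves only finitely many exceptions.\<close>

lemma nn_integral_line_tendsto:
  fixes G :: "'a::euclidean_space set" and F :: "'a \<Rightarrow> real"
  assumes G: "closed G" "G \<subseteq> cball 0 R" and e: "norm e = 1" and N: "finite N"
    and int: "\<And>t. t \<notin> N \<Longrightarrow> t *\<^sub>R e \<in> G \<Longrightarrow> t *\<^sub>R e \<in> interior G"
    and F: "continuous_on UNIV F" "\<And>x. 0 \<le> F x" and X: "X \<longlonglongrightarrow> 0" "\<And>k. norm (X k) \<le> 1"
  shows "(\<lambda>k. \<integral>\<^sup>+t. indicator G (X k + t *\<^sub>R e) * ennreal (F (X k + t *\<^sub>R e)) \<partial>lborel)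
    \<longlonglongrightarrow> (\<integral>\<^sup>+t. indicator G (t *\<^sub>R e) * ennreal (F (t *\<^sub>R e)) \<partial>lborel)"
proof -
  have [measurable]: "G \<in> sets borel" using G by simp
  have [measurable]: "F \<in> borel_measurable borel" using F by (intro borel_measurable_continuous_onI)
  have "bounded (F ` cball 0 R)"
    by (intro compact_imp_bounded compact_continuous_image continuous_on_subset[OF F(1)]) auto
  then have "bdd_above (F ` cball 0 R)" by (rule bounded_imp_bdd_above)
  then obtain M where M: "\<And>x. x \<in> cball 0 R \<Longrightarrow> F x \<le> M" unfolding bdd_above_def by blast
  show ?thesis
  proof (rule nn_integral_dominated_convergence[where w="\<lambda>t. ennreal M * indicator {-(R+1)..R+1} t"])
    show "(\<integral>\<^sup>+t. ennreal M * indicator {-(R+1)..R+1} t \<partial>lborel) < \<infinity>"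
      by (subst nn_integral_cmult_indicator) (auto simp: ennreal_mult_less_top emeasure_lborel_Icc_eq)
    show "AE t in lborel. indicator G (X k + t *\<^sub>R e) * ennreal (F (X k + t *\<^sub>R e)) \<le> ennreal M * indicator {-(R+1)..R+1} t" for k
    proof (intro always_eventually allI)
      fix t
      show "indicator G (X k + t *\<^sub>R e) * ennreal (F (X k + t *\<^sub>R e)) \<le> ennreal M * indicator {-(R+1)..R+1} t"
      proof (cases "X k + t *\<^sub>R e \<in> G")
        case True
        then have "X k + t *\<^sub>R e \<in> cball 0 R" using G by auto
        moreover from this have "\<bar>t\<bar> \<le> R + 1" using abs_le_of_line_in_cball[OF e] X(2)[of k] by force
        moreover from this have "t \<in> {-(R+1)..R+1}" by auto
        ultimately show ?thesis using True M by (auto intro: ennreal_leI)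
      qed simp
    qed
    have "AE t in lborel. t \<notin> N"
      using finite_imp_null_set_lborel[OF N] by (rule AE_not_in)
    then show "AE t in lborel. (\<lambda>k. indicator G (X k + t *\<^sub>R e) * ennreal (F (X k + t *\<^sub>R e))) \<longlonglongrightarrow> indicator G (t *\<^sub>R e) * ennreal (F (t *\<^sub>R e))"
    proof eventually_elim
      case (elim t)
      have lim: "(\<lambda>k. X k + t *\<^sub>R e) \<longlonglongrightarrow> t *\<^sub>R e" using X(1) by (auto intro!: tendsto_eq_intros)
      have Flim: "(\<lambda>k. ennreal (F (X k + t *\<^sub>R e))) \<longlonglongrightarrow> ennreal (F (t *\<^sub>R e))"
        by (intro tendsto_ennrealI continuous_on_tendsto_compose[OF F(1) lim]) auto
      show ?case
      proof (cases "t *\<^sub>R e \<in> G")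
        case True
        then have "\<forall>\<^sub>F k in sequentially. X k + t *\<^sub>R e \<in> interior G"
          using int[OF elim] by (intro topological_tendstoD[OF lim]) auto
        then have "\<forall>\<^sub>F k in sequentially. indicator G (X k + t *\<^sub>R e) * ennreal (F (X k + t *\<^sub>R e)) = ennreal (F (X k + t *\<^sub>R e))"
          by eventually_elim (use subsetD[OF interior_subset[of G]] in simp)
        then show ?thesis using Flim True by (simp add: tendsto_cong)
      next
        case False
        then have "\<forall>\<^sub>F k in sequentially. X k + t *\<^sub>R e \<in> - G"
          using G by (intro topological_tendstoD[OF lim]) auto
        then have "\<forall>\<^sub>F k in sequentially. indicator G (X k + t *\<^sub>R e) * ennreal (F (X k + t *\<^sub>R e)) = 0"
          by eventually_elim auto
        then show ?thesis using False by (simp add: tendsto_eventually)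
      qed
    qed
  qed measurable
qed

lemma chord_tendsto:
  fixes G :: "'a::euclidean_space set"
  assumes G: "closed G" "G \<subseteq> cball 0 R" and e: "norm e = 1" and N: "finite N"
    and int: "\<And>t. t \<notin> N \<Longrightarrow> t *\<^sub>R e \<in> G \<Longrightarrow> t *\<^sub>R e \<in> interior G"
    and X: "X \<longlonglongrightarrow> 0" "\<And>k. norm (X k) \<le> 1"
  shows "(\<lambda>k. chord G e (X k)) \<longlonglongrightarrow> chord G e 0"
proof -
  have b: "G \<in> sets borel" using G by simp
  have "(\<integral>\<^sup>+t. indicator G (x + t *\<^sub>R e) * ennreal 1 \<partial>lborel) = ennreal (chord G e x)" for x
    using emeasure_chord[OF e b G(2), of x] by (simp add: emeasure_line_section[OF b])
  then have "(\<lambda>k. ennreal (chord G e (X k))) \<longlonglongrightarrow> ennreal (chord G e 0)"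
    using nn_integral_line_tendsto[OF G e N int, of "\<lambda>_. 1" X] X by (metis (no_types, lifting) ext add_0 continuous_on_const zero_le_one)
  then show ?thesis by simp
qed

lemma star_body_line:
  fixes L :: "'a::euclidean_space set"
  assumes L: "star_body L" and e: "norm e = 1"
  shows "t *\<^sub>R e \<in> L \<longleftrightarrow> t \<in> {- radial_fun L (- e) .. radial_fun L e}"
proof -
  have e0: "e \<noteq> 0" "- e \<noteq> 0" using e by auto
  then have pos: "0 < radial_fun L e" "0 < radial_fun L (- e)" using L by (auto simp: star_body_def)
  show ?thesis
    using star_body_ray[OF L e0(1), of t] star_body_ray[OF L e0(2), of "- t"] pos by (cases "0 \<le> t") auto
qed

lemma star_body_line_interior:
  fixes L :: "'a::euclidean_space set"
  assumes L: "star_body L" and e: "norm e = 1" and t: "t \<notin> {- radial_fun L (- e), radial_fun L e}" "t *\<^sub>R e \<in> L"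
  shows "t *\<^sub>R e \<in> interior L"
proof -
  have e0: "e \<noteq> 0" "- e \<noteq> 0" using e by auto
  then have pos: "0 < radial_fun L e" "0 < radial_fun L (- e)" using L by (auto simp: star_body_def)
  have t': "- radial_fun L (- e) < t" "t < radial_fun L e" using t star_body_line[OF L e, of t] by auto
  show ?thesis
  proof (cases "0 \<le> t")
    case True
    have "radial_fun L e *\<^sub>R e \<in> L" using star_body_line[OF L e] pos by auto
    then have "(t / radial_fun L e) *\<^sub>R (radial_fun L e *\<^sub>R e) \<in> interior L"
      using True t' pos by (intro star_body_interior[OF L]) auto
    then show ?thesis using pos by simp
  next
    case False
    have "(- radial_fun L (- e)) *\<^sub>R e \<in> L" unfolding star_body_line[OF L e] using pos by simp
    then have "(- t / radial_fun L (- e)) *\<^sub>R ((- radial_fun L (- e)) *\<^sub>R e) \<in> interior L"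
      using False t' pos by (intro star_body_interior[OF L]) (simp_all add: field_simps)
    then show ?thesis using pos by simp
  qed
qed

context gauge_fun
begin

lemma wulff_line_interior:
  assumes e: "norm e = 1" and uw: "\<And>t. t *\<^sub>R e \<in> wulff h \<longleftrightarrow> t \<in> {a .. b}"
    and t: "t \<notin> {a, b}" "t *\<^sub>R e \<in> wulff h"
  shows "t *\<^sub>R e \<in> interior (wulff h)"
proof -
  have ab: "a < t" "t < b" using t uw by auto
  have "0 *\<^sub>R e \<in> wulff h" using zero_interior interior_subset by auto
  then have a0: "a \<le> 0" "0 \<le> b" using uw[of 0] by auto
  have "\<exists>s q. t = s * q \<and> 0 \<le> s \<and> s < 1 \<and> q \<in> {a..b}"
  proof (cases "0 \<le> t")
    case True
    then have "t = t / b * b \<and> 0 \<le> t / b \<and> t / b < 1 \<and> b \<in> {a..b}" using ab a0 by auto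
    then show ?thesis by blast
  next
    case False
    then have "t = t / a * a \<and> 0 \<le> t / a \<and> t / a < 1 \<and> a \<in> {a..b}"
      using ab a0 by (auto simp: divide_less_eq divide_nonpos_neg)
    then show ?thesis by blast
  qed
  then obtain s q where sq: "t = s * q" "0 \<le> s" "s < 1" "q \<in> {a..b}" by blast
  have "q *\<^sub>R e - (1 - s) *\<^sub>R (q *\<^sub>R e - 0) \<in> interior (wulff h)"
    using sq uw by (intro mem_interior_convex_shrink[OF convex_wulff zero_interior]) auto
  moreover have "q *\<^sub>R e - (1 - s) *\<^sub>R (q *\<^sub>R e - 0) = t *\<^sub>R e"
    unfolding sq(1) by (simp add: scaleR_left_diff_distrib left_diff_distrib)
  ultimately show ?thesis by simp
qed

lemma chord_wulff_tendsto:
  assumes e: "norm e = 1" and X: "X \<longlonglongrightarrow> 0" "\<And>k. norm (X k) \<le> 1"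
  shows "(\<lambda>k. chord (wulff h) e (X k)) \<longlonglongrightarrow> chord (wulff h) e 0"
proof -
  obtain u w where uw: "\<And>t. t *\<^sub>R e \<in> wulff h \<longleftrightarrow> t \<in> {- h w .. h u}"
    using chord_wulff_origin[OF e] by metis
  show ?thesis
    by (rule chord_tendsto[OF closed_wulff wulff_subset e, where N="{- h w, h u}"])
      (use wulff_line_interior[OF e uw] X in auto)
qed

end

lemma ball_subset_slab:
  assumes "norm e = 1"
  shows "ball 0 (1/2) \<subseteq> slab e"
proof
  fix x :: 'a assume "x \<in> ball 0 (1/2)"
  moreover have "\<bar>x \<bullet> e\<bar> \<le> norm x * norm e" by (rule Cauchy_Schwarz_ineq2)
  ultimately show "x \<in> slab e" using assms by (simp add: slab_def)
qed

context moment_weight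
begin

text \<open>The chords of the symmetral are never longer, so equal volumes force equal chords over almost
  every point; the chord length is continuous at the origin.\<close>

lemma chord_mbody_eq_origin:
  fixes A :: "'a::euclidean_space set"
  assumes A: "sandwiched r R A" and e: "norm e = 1"
    and eq: "measure lborel (mbody (steiner e A)) = measure lborel (mbody A)"
  shows "chord (mbody (steiner e A)) e 0 = chord (mbody A) e 0"
proof -
  note S = sandwiched_steiner[OF A e]
  let ?C = "(R + 1) powr ((real DIM('a) + p) / p)"
  have fin: "emeasure lborel (mbody B) < \<infinity>" if "sandwiched r R B" for B :: "'a set"
    using emeasure_mono[OF mbody_subset[OF that], of lborel] emeasure_compact_finite[of "cball (0::'a) ?C"]
    by (auto intro: le_less_trans)
  have ind: "(\<integral>\<^sup>+t. indicator (mbody B) (x + t *\<^sub>R e) \<partial>lborel) = ennreal (chord (mbody B) e x)" if "sandwiched r R B" for B :: "'a set" and x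
    using emeasure_chord[OF e mbody_borel[OF that] mbody_subset[OF that]] by (simp add: emeasure_line_section[OF mbody_borel[OF that]])
  have "AE x in lborel. x \<in> slab e \<longrightarrow>
     (\<integral>\<^sup>+t. indicator (mbody (steiner e A)) (x + t *\<^sub>R e) \<partial>lborel) = (\<integral>\<^sup>+t. indicator (mbody A) (x + t *\<^sub>R e) \<partial>lborel)"
  proof (rule AE_eq_on_lines[OF _ _ e])
    show "(\<integral>\<^sup>+x. indicator (mbody (steiner e A)) x \<partial>lborel) = (\<integral>\<^sup>+x. indicator (mbody A) x \<partial>lborel)"
      using eq fin[OF A] fin[OF S] mbody_borel[OF A] mbody_borel[OF S]
      by (simp add: emeasure_eq_ennreal_measure)
    show "(\<integral>\<^sup>+x. indicator (mbody (steiner e A)) x \<partial>lborel) \<noteq> \<infinity>"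
      using fin[OF S] mbody_borel[OF S] by simp
  qed (use mbody_borel[OF A] mbody_borel[OF S] chord_mbody_steiner_le[OF A e] in \<open>auto simp: ind A S intro: ennreal_leI\<close>)
  then have "AE x in lborel. x \<in> ball 0 (1/2) \<longrightarrow> chord (mbody (steiner e A)) e x = chord (mbody A) e x"
    unfolding ind[OF A] ind[OF S] by eventually_elim (use ball_subset_slab[OF e] in auto)
  then obtain X where X: "X \<longlonglongrightarrow> 0" "\<And>k. chord (mbody (steiner e A)) e (X k) = chord (mbody A) e (X k)" "\<And>k::nat. norm (X k) < 1/2"
    using AE_sequence_to_origin[of "1/2" "\<lambda>x. chord (mbody (steiner e A)) e x = chord (mbody A) e x"] by auto
  have X1: "norm (X k) \<le> 1" for k using X(3)[of k] by simp
  show ?thesis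
    using gauge_fun.chord_wulff_tendsto[OF gauge_supp[OF A] e X(1) X1] gauge_fun.chord_wulff_tendsto[OF gauge_supp[OF S] e X(1) X1] X(2)
    by (auto simp: mbody_def intro: LIMSEQ_unique)
qed

text \<open>If symmetrizing does not shrink the moment body, then the rearrangement inequality is an
  equality on almost every line, for the pair of functionals that support the moment body of
  \<open>A\<close> at its two boundary points on the line \<open>\<real> e\<close>.\<close>

lemma equality_on_lines:
  fixes A :: "'a::euclidean_space set"
  assumes A: "sandwiched r R A" and e: "norm e = 1"
    and eq: "measure lborel (mbody (steiner e A)) = measure lborel (mbody A)"
    and uw: "u \<bullet> e = 1" "w \<bullet> e = - 1" "chord (mbody A) e 0 = supp A u + supp A w"
  defines "\<alpha> \<equiv> supp A u / (supp A u + supp A w)"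
  shows "0 < \<alpha>" "\<alpha> < 1" "AE x in lborel. x \<in> slab e \<longrightarrow>
    (\<integral>\<^sup>+r\<in>{-(chord A e x / 2)<..<chord A e x / 2}. ennreal (W (u \<bullet> x + w \<bullet> x + 2 * r)) \<partial>lborel) =
    (\<integral>\<^sup>+t. indicator A (x + t *\<^sub>R e) * ennreal (\<alpha> powr (1 - p) * W (u \<bullet> (x + t *\<^sub>R e)) + (1 - \<alpha>) powr (1 - p) * W (w \<bullet> (x + t *\<^sub>R e))) \<partial>lborel)"
proof -
  note S = sandwiched_steiner[OF A e]
  have [measurable]: "A \<in> sets borel" using A by auto
  have pos: "supp A u > 0" "supp A w > 0" using uw by (auto intro!: supp_pos[OF A])
  show \<alpha>: "0 < \<alpha>" "\<alpha> < 1" using pos by (auto simp: \<alpha>_def)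
  let ?z = "u + w + 2 *\<^sub>R e"
  have "0 \<in> mbody (steiner e A)"
    using gauge_fun.zero_interior[OF gauge_supp[OF S]] interior_subset by (auto simp: mbody_def)
  then have "chord (mbody (steiner e A)) e 0 \<le> (supp (steiner e A) ?z + supp (steiner e A) (u + w - 2 *\<^sub>R e)) / 2"
    using chord_mbody_steiner[OF A e uw(1,2), of 0 0] by simp
  then have ge: "supp A u + supp A w \<le> supp (steiner e A) ?z"
    using chord_mbody_eq_origin[OF A e eq] uw(3) supp_steiner_le'[OF A e uw(1,2)] by simp
  let ?f1 = "\<lambda>x. indicator (steiner e A) x * ennreal (W (?z \<bullet> x))"
  let ?f2 = "\<lambda>x. indicator A x * ennreal (\<alpha> powr (1 - p) * W (u \<bullet> x) + (1 - \<alpha>) powr (1 - p) * W (w \<bullet> x))"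
  have I1: "(\<integral>\<^sup>+x. ?f1 x \<partial>lborel) = moment (steiner e A) ?z" by (simp add: moment_def mult.commute)
  have I2: "(\<integral>\<^sup>+x. ?f2 x \<partial>lborel) = ennreal (\<alpha> powr (1 - p)) * moment A u + ennreal ((1 - \<alpha>) powr (1 - p)) * moment A w"
    by (rule moment_split) simp
  have le: "(\<integral>\<^sup>+t. ?f1 (x + t *\<^sub>R e) \<partial>lborel) \<le> (\<integral>\<^sup>+t. ?f2 (x + t *\<^sub>R e) \<partial>lborel)" for x
    by (rule steiner_line_le(2)[OF A e uw(1,2) \<alpha>])
  have "(\<integral>\<^sup>+x. ?f1 x \<partial>lborel) \<le> (\<integral>\<^sup>+x. ?f2 x \<partial>lborel)"
    by (intro nn_integral_mono_lines[OF _ _ e] le) measurable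
  moreover have "(\<integral>\<^sup>+x. ?f2 x \<partial>lborel) \<le> (\<integral>\<^sup>+x. ?f1 x \<partial>lborel)"
  proof -
    have nc: "nconst DIM('a) > 0" by (simp add: nconst_pos)
    have "ennreal (nconst DIM('a)) * (\<integral>\<^sup>+x. ?f2 x \<partial>lborel) =
      ennreal (\<alpha> powr (1 - p)) * ennreal (supp A u powr p) + ennreal ((1 - \<alpha>) powr (1 - p)) * ennreal (supp A w powr p)"
      unfolding I2 supp_powr[OF A] by (simp add: algebra_simps)
    also have "\<dots> = ennreal ((supp A u + supp A w) powr p)"
      using split_powr[OF pos] by (simp add: \<alpha>_def flip: ennreal_mult ennreal_plus)
    also have "\<dots> \<le> ennreal (supp (steiner e A) ?z powr p)"
      using ge pos p by (intro ennreal_leI powr_mono2) auto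
    also have "\<dots> = ennreal (nconst DIM('a)) * (\<integral>\<^sup>+x. ?f1 x \<partial>lborel)"
      unfolding I1 by (rule supp_powr[OF S])
    finally have *: "ennreal (nconst DIM('a)) * (\<integral>\<^sup>+x. ?f2 x \<partial>lborel) \<le> ennreal (nconst DIM('a)) * (\<integral>\<^sup>+x. ?f1 x \<partial>lborel)" .
    have "ennreal (1 / nconst DIM('a)) * ennreal (nconst DIM('a)) = 1"
      using nc by (simp flip: ennreal_mult)
    then show ?thesis using mult_left_mono[OF *, of "ennreal (1 / nconst DIM('a))"] by (simp add: mult.assoc[symmetric])
  qed
  ultimately have "(\<integral>\<^sup>+x. ?f1 x \<partial>lborel) = (\<integral>\<^sup>+x. ?f2 x \<partial>lborel)" by (rule antisym)
  note eq12 = this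
  have "AE x in lborel. x \<in> slab e \<longrightarrow> (\<integral>\<^sup>+t. ?f1 (x + t *\<^sub>R e) \<partial>lborel) = (\<integral>\<^sup>+t. ?f2 (x + t *\<^sub>R e) \<partial>lborel)"
  proof (rule AE_eq_on_lines[OF _ _ e le eq12])
    show "(\<integral>\<^sup>+x. ?f1 x \<partial>lborel) \<noteq> \<infinity>"
      unfolding I1 using moment_bounds(3)[OF S, of ?z] by simp
  qed simp_all
  then show "AE x in lborel. x \<in> slab e \<longrightarrow>
    (\<integral>\<^sup>+r\<in>{-(chord A e x / 2)<..<chord A e x / 2}. ennreal (W (u \<bullet> x + w \<bullet> x + 2 * r)) \<partial>lborel) =
    (\<integral>\<^sup>+t. ?f2 (x + t *\<^sub>R e) \<partial>lborel)"
    unfolding steiner_line_le(1)[OF A e uw(1,2) \<alpha>] .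
qed

end

context moment_weight
begin

lemma W_interval_tendsto:
  assumes c: "c \<longlonglongrightarrow> c0" and a: "a \<longlonglongrightarrow> (0::real)"
    and bd: "\<And>k. \<bar>c k\<bar> \<le> M" "\<And>k. \<bar>a k\<bar> \<le> M"
  shows "(\<lambda>k. \<integral>\<^sup>+r\<in>{-(c k / 2)<..<c k / 2}. ennreal (W (a k + 2 * r)) \<partial>lborel)
    \<longlonglongrightarrow> (\<integral>\<^sup>+r\<in>{-(c0 / 2)<..<c0 / 2}. ennreal (W (2 * r)) \<partial>lborel)"
proof (rule nn_integral_dominated_convergence[where w="\<lambda>r. ennreal ((4 * M) powr p) * indicator {-M..M} r"])
  have M: "M \<ge> 0" using bd(1)[of 0] by linarith
  show "(\<integral>\<^sup>+r. ennreal ((4 * M) powr p) * indicator {-M..M} r \<partial>lborel) < \<infinity>"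
    using M by (subst nn_integral_cmult_indicator) (auto simp: ennreal_mult_less_top emeasure_lborel_Icc_eq)
  show "AE r in lborel. ennreal (W (a k + 2 * r)) * indicator {-(c k / 2)<..<c k / 2} r \<le> ennreal ((4 * M) powr p) * indicator {-M..M} r" for k
  proof (intro always_eventually allI)
    fix r
    show "ennreal (W (a k + 2 * r)) * indicator {-(c k / 2)<..<c k / 2} r \<le> ennreal ((4 * M) powr p) * indicator {-M..M} r"
    proof (cases "r \<in> {-(c k / 2)<..<c k / 2}")
      case True
      then have "2 * \<bar>r\<bar> \<le> \<bar>c k\<bar>" by (auto simp: abs_if)
      then have r: "2 * \<bar>r\<bar> \<le> M" using bd(1)[of k] by (rule order_trans)
      then have "r \<in> {-M..M}" using M by (auto simp: abs_le_iff)
      moreover have "W (a k + 2 * r) \<le> (4 * M) powr p"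
      proof -
        have "2 * \<bar>a k + 2 * r\<bar> \<le> 2 * (\<bar>a k\<bar> + 2 * \<bar>r\<bar>)" using abs_triangle_ineq[of "a k" "2 * r"] by (simp add: abs_mult)
        also have "\<dots> \<le> 4 * M" using r bd(2)[of k] by simp
        finally have "2 * \<bar>a k + 2 * r\<bar> \<le> 4 * M" .
        then have "(2 * \<bar>a k + 2 * r\<bar>) powr p \<le> (4 * M) powr p" using p by (intro powr_mono2) auto
        then show ?thesis using W_le[of "a k + 2 * r"] by linarith
      qed
      ultimately show ?thesis using True by (auto intro: ennreal_leI)
    qed simp
  qed
  have "AE r in lborel. r \<notin> {-(c0/2), c0/2}"
    by (intro AE_not_in finite_imp_null_set_lborel) simp
  then show "AE r in lborel. (\<lambda>k. ennreal (W (a k + 2 * r)) * indicator {-(c k / 2)<..<c k / 2} r)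
      \<longlonglongrightarrow> ennreal (W (2 * r)) * indicator {-(c0 / 2)<..<c0 / 2} r"
  proof eventually_elim
    case (elim r)
    have "(\<lambda>k. a k + 2 * r) \<longlonglongrightarrow> 0 + 2 * r" by (intro tendsto_intros a)
    then have Wl: "(\<lambda>k. ennreal (W (a k + 2 * r))) \<longlonglongrightarrow> ennreal (W (2 * r))"
      by (intro tendsto_ennrealI continuous_on_tendsto_compose[OF W_continuous[of UNIV]]) auto
    have cl: "(\<lambda>k. c k / 2) \<longlonglongrightarrow> c0 / 2" by (intro tendsto_intros c) simp
    show ?case
    proof (cases "\<bar>r\<bar> < c0 / 2")
      case True
      have "\<forall>\<^sub>F k in sequentially. \<bar>r\<bar> < c k / 2" using order_tendstoD(1)[OF cl True] .
      then have "\<forall>\<^sub>F k in sequentially. ennreal (W (a k + 2 * r)) = ennreal (W (a k + 2 * r)) * indicator {-(c k / 2)<..<c k / 2} r"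
        by eventually_elim (auto simp: abs_less_iff split: split_indicator)
      then have "(\<lambda>k. ennreal (W (a k + 2 * r)) * indicator {-(c k / 2)<..<c k / 2} r) \<longlonglongrightarrow> ennreal (W (2 * r))"
        by (rule Lim_transform_eventually[OF Wl])
      moreover have "indicator {-(c0 / 2)<..<c0 / 2} r = (1::ennreal)"
        using True by (auto simp: abs_less_iff split: split_indicator)
      ultimately show ?thesis by (simp only: mult_1_right)
    next
      case False
      then have "c0 / 2 < \<bar>r\<bar>" using elim by (auto simp: abs_if split: if_splits)
      from order_tendstoD(2)[OF cl this]
      have "\<forall>\<^sub>F k in sequentially. ennreal (W (a k + 2 * r)) * indicator {-(c k / 2)<..<c k / 2} r = 0"
        by eventually_elim (auto simp: abs_if split: split_indicator if_splits)
      moreover have "indicator {-(c0 / 2)<..<c0 / 2} r = (0::ennreal)" using False by (auto split: split_indicator)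
      ultimately show ?thesis by (simp add: tendsto_eventually)
    qed
  qed
qed measurable

text \<open>The rearrangement inequality on the line \<open>\<real> e\<close> itself: its points \<open>t e\<close> are weighted
  by \<open>W t\<close> and \<open>W (- t)\<close>, and equality is only possible if the segment is centred, since the
  midpoint \<open>m\<close> is compared with \<open>0\<close> and both \<open>W m\<close> and \<open>W (- m)\<close> must vanish.\<close>

lemma centred_of_equality:
  assumes \<alpha>: "0 < \<alpha>" "\<alpha> < 1" and ab: "0 < a" "0 < b"
    and eq: "(\<integral>\<^sup>+r\<in>{-((a + b) / 2)<..<(a + b) / 2}. ennreal (W (2 * r)) \<partial>lborel) =
      (\<integral>\<^sup>+t\<in>{- b .. a}. ennreal (\<alpha> powr (1 - p) * W t + (1 - \<alpha>) powr (1 - p) * W (- t)) \<partial>lborel)"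
  shows "a = b"
proof -
  define P where "P = \<alpha> powr (1 - p)"
  define Q where "Q = (1 - \<alpha>) powr (1 - p)"
  define m where "m = (a - b) / 2"
  define l where "l = a + b"
  have PQ: "P > 0" "Q > 0" using \<alpha> by (auto simp: P_def Q_def)
  have l: "l > 0" using ab by (simp add: l_def)
  have ml: "m - l/2 = - b" "m + l/2 = a" by (simp_all add: m_def l_def field_simps)
  let ?I = "{-(l/2)<..<l/2}"
  have "(\<integral>\<^sup>+t\<in>{- b .. a}. ennreal (P * W t + Q * W (- t)) \<partial>lborel) =
     (\<integral>\<^sup>+t\<in>{m - l/2<..<m + l/2}. ennreal (P * W t + Q * W (- t)) \<partial>lborel)"
  proof (rule nn_integral_cong_AE)
    have "AE t in lborel. t \<notin> {- b, a}" by (intro AE_not_in finite_imp_null_set_lborel) simp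
    then show "AE t in lborel. ennreal (P * W t + Q * W (- t)) * indicator {- b .. a} t =
       ennreal (P * W t + Q * W (- t)) * indicator {m - l/2<..<m + l/2} t"
      unfolding ml by eventually_elim (auto split: split_indicator)
  qed
  also have "\<dots> = (\<integral>\<^sup>+t\<in>{m - l/2<..<m + l/2}. ennreal (P * W t) \<partial>lborel) + (\<integral>\<^sup>+t\<in>{m - l/2<..<m + l/2}. ennreal (Q * W (- t)) \<partial>lborel)"
    using PQ by (subst nn_integral_add[symmetric]) (auto intro!: nn_integral_cong simp: distrib_right)
  also have "(\<integral>\<^sup>+t\<in>{m - l/2<..<m + l/2}. ennreal (P * W t) \<partial>lborel) = (\<integral>\<^sup>+r\<in>?I. ennreal (P * W (m + r)) \<partial>lborel)"
    by (subst nn_integral_lborel_translate[of _ m, symmetric])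
      (auto intro!: nn_integral_cong split: split_indicator)
  also have "(\<integral>\<^sup>+t\<in>{m - l/2<..<m + l/2}. ennreal (Q * W (- t)) \<partial>lborel) = (\<integral>\<^sup>+r\<in>?I. ennreal (Q * W (r - m)) \<partial>lborel)"
    by (subst nn_integral_lborel_reflect[of _ m, symmetric])
      (auto intro!: nn_integral_cong split: split_indicator)
  also have "(\<integral>\<^sup>+r\<in>?I. ennreal (P * W (m + r)) \<partial>lborel) + (\<integral>\<^sup>+r\<in>?I. ennreal (Q * W (r - m)) \<partial>lborel) =
     (\<integral>\<^sup>+r\<in>?I. ennreal (P * W (m + r) + Q * W (r - m)) \<partial>lborel)"
    using PQ by (subst nn_integral_add[symmetric]) (auto intro!: nn_integral_cong simp: distrib_right)
  finally have eq2: "(\<integral>\<^sup>+r\<in>?I. ennreal (W (2 * r)) \<partial>lborel) = (\<integral>\<^sup>+r\<in>?I. ennreal (P * W (m + r) + Q * W (r - m)) \<partial>lborel)"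
    using eq by (simp add: P_def Q_def l_def)
  have le: "W (2 * r) \<le> P * W (m + r) + Q * W (r - m)" for r
    using W_add_le[OF \<alpha>, of "m + r" "r - m"] by (simp add: P_def Q_def)
  have "(\<integral>\<^sup>+r\<in>?I. ennreal (W (2 * r)) \<partial>lborel) \<le> (\<integral>\<^sup>+r. ennreal ((2 * l) powr p) * indicator ?I r \<partial>lborel)"
  proof (intro nn_integral_mono)
    fix r
    have "W (2 * r) \<le> (2 * l) powr p" if "r \<in> ?I"
    proof -
      have "2 * \<bar>2 * r\<bar> \<le> 2 * l" using that by (auto simp: abs_if)
      then have "(2 * \<bar>2 * r\<bar>) powr p \<le> (2 * l) powr p" using p by (intro powr_mono2) auto
      then show ?thesis using W_le[of "2 * r"] by linarith
    qed
    then show "ennreal (W (2 * r)) * indicator ?I r \<le> ennreal ((2 * l) powr p) * indicator ?I r"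
      by (auto split: split_indicator intro: ennreal_leI)
  qed
  also have "\<dots> < \<infinity>" using l by (subst nn_integral_cmult_indicator) (auto simp: ennreal_mult_less_top)
  finally have fin: "(\<integral>\<^sup>+r\<in>?I. ennreal (W (2 * r)) \<partial>lborel) \<noteq> \<infinity>" by simp
  have "AE r in lborel. ennreal (W (2 * r)) * indicator ?I r = ennreal (P * W (m + r) + Q * W (r - m)) * indicator ?I r"
    using le by (intro nn_integral_eq_AE_eq eq2 fin) (auto intro!: mult_right_mono ennreal_leI)
  then have "AE r in lborel. r \<in> ball 0 (l/2) \<longrightarrow> W (2 * r) = P * W (m + r) + Q * W (r - m)"
  proof eventually_elim
    case (elim r)
    show ?case
    proof
      assume "r \<in> ball 0 (l/2)"
      then have "r \<in> ?I" by (auto simp: abs_less_iff)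
      then show "W (2 * r) = P * W (m + r) + Q * W (r - m)"
        using elim PQ by (simp add: ennreal_inj del: ennreal_plus)
    qed
  qed
  then obtain X where X: "X \<longlonglongrightarrow> 0" "\<And>k::nat. W (2 * X k) = P * W (m + X k) + Q * W (X k - m)"
    by (rule AE_sequence_to_origin[OF _ half_gt_zero[OF l]]) blast
  have Wc: "(\<lambda>k. W (Y k)) \<longlonglongrightarrow> W y" if "Y \<longlonglongrightarrow> y" for Y y
    using continuous_on_tendsto_compose[OF W_continuous[of UNIV] that] by simp
  have "(\<lambda>k. 2 * X k) \<longlonglongrightarrow> 2 * 0" "(\<lambda>k. m + X k) \<longlonglongrightarrow> m + 0" "(\<lambda>k. X k - m) \<longlonglongrightarrow> 0 - m"
    by (intro tendsto_intros X)+
  note lims = this[THEN Wc]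
  have "(\<lambda>k. P * W (m + X k) + Q * W (X k - m)) \<longlonglongrightarrow> P * W (m + 0) + Q * W (0 - m)"
    by (intro tendsto_intros lims)
  then have "W (2 * 0) = P * W (m + 0) + Q * W (0 - m)"
    using lims(1) by (intro LIMSEQ_unique[of "\<lambda>k. W (2 * X k)"]) (simp_all add: X(2)[symmetric])
  then have "P * W m + Q * W (- m) = 0" by simp
  then have "P * W m = 0 \<and> Q * W (- m) = 0"
    using PQ by (simp add: add_nonneg_eq_0_iff)
  then have "W m + W (- m) = 0" using PQ by simp
  then have "\<bar>m\<bar> powr p = 0" using W_symmetrize[of m] weight_sum_pos by simp
  then show ?thesis by (simp add: m_def)
qed

text \<open>In the limit, the equality on lines close to the origin becomes an equality on the line through the origin and \<open>x\<close>,
  where all that remains of the two functionals is \<open>u \<bullet> t e = t\<close> and \<open>w \<bullet> t e = - t\<close>.\<close>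

lemma symmetric_of_equality:
  fixes L :: "'a::euclidean_space set"
  assumes L: "star_body L" and S: "sandwiched r R L"
    and eq: "\<And>e. norm e = 1 \<Longrightarrow> measure lborel (mbody (steiner e L)) = measure lborel (mbody L)"
    and x: "x \<in> L"
  shows "- x \<in> L"
proof (cases "x = 0")
  case False
  define e where "e = x /\<^sub>R norm x"
  have e: "norm e = 1" "x = norm x *\<^sub>R e" using False by (auto simp: e_def)
  have cl: "closed L" using L by (auto simp: star_body_def compact_imp_closed)
  have LR: "L \<subseteq> cball 0 R" "L \<in> sets borel" using S by auto
  have e0: "e \<noteq> 0" "- e \<noteq> 0" using e by auto
  then have pos: "0 < radial_fun L e" "0 < radial_fun L (- e)" using L by (auto simp: star_body_def)
  obtain u w where uw: "u \<bullet> e = 1" "w \<bullet> e = - 1" "chord (mbody L) e 0 = supp L u + supp L w"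
    using gauge_fun.chord_wulff_origin[OF gauge_supp[OF S] e(1)] unfolding mbody_def by metis
  define \<alpha> where "\<alpha> = supp L u / (supp L u + supp L w)"
  note eql = equality_on_lines[OF S e(1) eq[OF e(1)] uw, folded \<alpha>_def]
  let ?N = "{- radial_fun L (- e), radial_fun L e}"
  let ?lhs = "\<lambda>x. \<integral>\<^sup>+r\<in>{-(chord L e x / 2)<..<chord L e x / 2}. ennreal (W (u \<bullet> x + w \<bullet> x + 2 * r)) \<partial>lborel"
  let ?F = "\<lambda>x. \<alpha> powr (1 - p) * W (u \<bullet> x) + (1 - \<alpha>) powr (1 - p) * W (w \<bullet> x)"
  let ?rhs = "\<lambda>x. \<integral>\<^sup>+t. indicator L (x + t *\<^sub>R e) * ennreal (?F (x + t *\<^sub>R e)) \<partial>lborel"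
  have "AE x in lborel. x \<in> ball 0 (1/2) \<longrightarrow> ?lhs x = ?rhs x"
    using eql(3) by eventually_elim (use ball_subset_slab[OF e(1)] in auto)
  then obtain X where X: "X \<longlonglongrightarrow> 0" "\<And>k. ?lhs (X k) = ?rhs (X k)" "\<And>k::nat. norm (X k) < 1/2"
    using AE_sequence_to_origin[of "1/2" "\<lambda>x. ?lhs x = ?rhs x"] by auto
  have X1: "norm (X k) \<le> 1" for k using X(3)[of k] by simp
  have int: "t *\<^sub>R e \<in> interior L" if "t \<notin> ?N" "t *\<^sub>R e \<in> L" for t
    using star_body_line_interior[OF L e(1) that] .
  have ct: "(\<lambda>k. chord L e (X k)) \<longlonglongrightarrow> chord L e 0"
    by (rule chord_tendsto[OF cl LR(1) e(1) _ int X(1) X1, where N="?N"]) auto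
  have at: "(\<lambda>k. u \<bullet> X k + w \<bullet> X k) \<longlonglongrightarrow> 0"
    using X(1) by (auto intro!: tendsto_eq_intros)
  obtain M1 where M1: "\<And>k. \<bar>chord L e (X k)\<bar> \<le> M1"
    using convergent_imp_Bseq[OF convergentI[OF ct]] by (auto simp: Bseq_def)
  obtain M2 where M2: "\<And>k. \<bar>u \<bullet> X k + w \<bullet> X k\<bar> \<le> M2"
    using convergent_imp_Bseq[OF convergentI[OF at]] by (auto simp: Bseq_def)
  have l1: "(\<lambda>k. ?lhs (X k)) \<longlonglongrightarrow> (\<integral>\<^sup>+r\<in>{-(chord L e 0 / 2)<..<chord L e 0 / 2}. ennreal (W (2 * r)) \<partial>lborel)"
    by (rule W_interval_tendsto[OF ct at, of "max M1 M2"]) (use M1 M2 in \<open>auto simp: le_max_iff_disj\<close>)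
  have l2: "(\<lambda>k. ?rhs (X k)) \<longlonglongrightarrow> (\<integral>\<^sup>+t. indicator L (t *\<^sub>R e) * ennreal (?F (t *\<^sub>R e)) \<partial>lborel)"
  proof (rule nn_integral_line_tendsto[OF cl LR(1) e(1) _ int _ _ X(1) X1, where N="?N"])
    show "continuous_on UNIV ?F"
      by (intro continuous_intros continuous_on_compose2[OF W_continuous[of UNIV]]) auto
  qed auto
  have line: "t *\<^sub>R e \<in> L \<longleftrightarrow> t \<in> {- radial_fun L (- e) .. radial_fun L e}" for t
    by (rule star_body_line[OF L e(1)])
  have "{t. 0 + t *\<^sub>R e \<in> L} = {- radial_fun L (- e) .. radial_fun L e}"
    unfolding add_0 line by (rule Collect_mem_eq)
  then have ch: "chord L e 0 = radial_fun L e + radial_fun L (- e)"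
    using pos by (simp add: chord_def)
  have "(\<integral>\<^sup>+r\<in>{-(chord L e 0 / 2)<..<chord L e 0 / 2}. ennreal (W (2 * r)) \<partial>lborel) =
     (\<integral>\<^sup>+t. indicator L (t *\<^sub>R e) * ennreal (?F (t *\<^sub>R e)) \<partial>lborel)"
    using LIMSEQ_unique[OF l1] l2 X(2) by simp
  also have "\<dots> = (\<integral>\<^sup>+t\<in>{- radial_fun L (- e) .. radial_fun L e}. ennreal (\<alpha> powr (1 - p) * W t + (1 - \<alpha>) powr (1 - p) * W (- t)) \<partial>lborel)"
    by (intro nn_integral_cong) (simp add: indicator_def line uw)
  finally have "radial_fun L e = radial_fun L (- e)"
    unfolding ch by (rule centred_of_equality[OF eql(1,2) pos])
  then show ?thesis
    using line[of "norm x"] line[of "- norm x"] x e(2) by (metis atLeastAtMost_iff minus_le_iff neg_le_iff_le scaleR_minus_left)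
qed (use x in simp)

section \<open>Equality forces reflection symmetry in every direction\<close>

lemma supp_even:
  fixes L :: "'a::euclidean_space set"
  assumes [measurable]: "L \<in> sets borel" and sym: "\<And>x. x \<in> L \<Longrightarrow> - x \<in> L"
  shows "supp L (- u) = supp L u"
proof -
  have iff: "- x \<in> L \<longleftrightarrow> x \<in> L" for x using sym[of x] sym[of "- x"] by auto
  have "moment L u = ennreal (\<bar>- 1\<bar> ^ DIM('a)) * (\<integral>\<^sup>+x. ennreal (W (u \<bullet> ((- 1) *\<^sub>R x))) * indicator L ((- 1) *\<^sub>R x) \<partial>lborel)"
    unfolding moment_def by (rule nn_integral_lborel_scale) auto
  also have "\<dots> = moment L (- u)"
    by (simp add: moment_def indicator_def iff)
  finally show ?thesis by (simp add: supp_def)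
qed

text \<open>For symmetric \<open>L\<close> the two supporting functionals are \<open>u\<close> and \<open>- u\<close>. On
  the line through \<open>x\<close> the equality then says that the chord minimizes \<open>\<integral> \<bar>u \<bullet> x + t\<bar>\<^sup>p dt\<close>
  among sets of its length, so it is a segment with midpoint on the hyperplane
  \<open>u\<^sup>\<bottom>\<close>, up to a null set.\<close>

lemma chords_centred_of_equality:
  fixes L :: "'a::euclidean_space set"
  assumes S: "sandwiched r R L" and sym: "\<And>x. x \<in> L \<Longrightarrow> - x \<in> L" and e: "norm e = 1"
    and eq: "measure lborel (mbody (steiner e L)) = measure lborel (mbody L)"
  obtains u where "u \<bullet> e = 1" "AE x in lborel. x \<in> slab e \<longrightarrow> (\<exists>l.
    emeasure lborel ({- (u \<bullet> x) - l<..<- (u \<bullet> x) + l} - {t. x + t *\<^sub>R e \<in> L}) = 0 \<and>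
    emeasure lborel ({t. x + t *\<^sub>R e \<in> L} - {- (u \<bullet> x) - l<..<- (u \<bullet> x) + l}) = 0)"
proof -
  have LL[measurable]: "L \<in> sets borel" and LR: "L \<subseteq> cball 0 R" using S by auto
  have even: "supp L (- v) = supp L v" for v by (rule supp_even[OF LL]) (rule sym)
  interpret H: gauge_fun "supp L" "r powr ((real DIM('a) + p) / p)" "(R + 1) powr ((real DIM('a) + p) / p)"
    by (rule gauge_supp[OF S])
  obtain u w where uw: "u \<bullet> e = 1" "w \<bullet> e = - 1" "chord (mbody L) e 0 = supp L u + supp L w"
    and line: "\<And>t. t *\<^sub>R e \<in> wulff (supp L) \<longleftrightarrow> t \<in> {- supp L w .. supp L u}"
    using H.chord_wulff_origin[OF e] unfolding mbody_def by metis
  have neg: "- y \<in> wulff (supp L)" if "y \<in> wulff (supp L)" for y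
    unfolding wulff_def
  proof (intro CollectI allI)
    fix v
    have "(- v) \<bullet> y \<le> supp L (- v)" using that unfolding wulff_def by blast
    then show "v \<bullet> (- y) \<le> supp L v" by (simp add: even)
  qed
  have pos: "supp L u > 0" "supp L w > 0" using uw by (auto intro!: supp_pos[OF S])
  have "- supp L u \<in> {- supp L w .. supp L u}" "supp L w \<in> {- supp L w .. supp L u}"
    using neg[of "supp L u *\<^sub>R e"] neg[of "(- supp L w) *\<^sub>R e"] line[of "supp L u"] line[of "- supp L u"] line[of "supp L w"] line[of "- supp L w"] pos by auto
  then have "supp L w = supp L u" by auto
  then have ch: "chord (mbody L) e 0 = supp L u + supp L (- u)" using uw(3) even by simp
  have ne: "(- u) \<bullet> e = - 1" using uw by simp
  have half: "supp L u / (supp L u + supp L (- u)) = 1 / 2" "1 - 1 / 2 = (1 / 2 :: real)" using pos even by auto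
  have ae: "AE x in lborel. x \<in> slab e \<longrightarrow>
    (\<integral>\<^sup>+r\<in>{-(chord L e x / 2)<..<chord L e x / 2}. ennreal (W (u \<bullet> x + (- u) \<bullet> x + 2 * r)) \<partial>lborel) =
    (\<integral>\<^sup>+t. indicator L (x + t *\<^sub>R e) * ennreal ((1/2) powr (1 - p) * W (u \<bullet> (x + t *\<^sub>R e)) + (1/2) powr (1 - p) * W ((- u) \<bullet> (x + t *\<^sub>R e))) \<partial>lborel)"
    using equality_on_lines(3)[OF S e eq uw(1) ne ch] unfolding half .
  show ?thesis
  proof (rule that[OF uw(1)], use ae in eventually_elim, rule impI)
    case (elim x)
    assume "x \<in> slab e"
    define l where "l = chord L e x / 2"
    define a where "a = u \<bullet> x"
    define A where "A = {t. x + t *\<^sub>R e \<in> L}"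
    \<comment> \<open>For \<open>w = - u\<close> the weights are both \<open>1 / 2\<close>, and \<open>W s + W (- s)\<close> is a multiple of \<open>\<bar>s\<bar>\<^sup>p\<close>.\<close>
    define K where "K = 2 powr (p - 1) * weight_sum"
    have K: "K > 0" using weight_sum_pos by (simp add: K_def)
    have [measurable]: "A \<in> sets borel" unfolding A_def by measurable
    let ?I = "{- a - l<..<- a + l}"
    have l0: "0 \<le> l" by (simp add: l_def)
    have eqx: "(\<integral>\<^sup>+r\<in>{- l<..<l}. ennreal (W (2 * r)) \<partial>lborel) = (\<integral>\<^sup>+t\<in>A. ennreal (K * \<bar>a + t\<bar> powr p) \<partial>lborel)"
    proof -
      have "(\<integral>\<^sup>+r\<in>{- l<..<l}. ennreal (W (2 * r)) \<partial>lborel) =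
        (\<integral>\<^sup>+t. indicator L (x + t *\<^sub>R e) * ennreal ((1/2) powr (1 - p) * W (u \<bullet> (x + t *\<^sub>R e)) + (1/2) powr (1 - p) * W ((- u) \<bullet> (x + t *\<^sub>R e))) \<partial>lborel)"
        using elim \<open>x \<in> slab e\<close> by (simp add: l_def)
      also have "\<dots> = (\<integral>\<^sup>+t\<in>A. ennreal (K * \<bar>a + t\<bar> powr p) \<partial>lborel)"
      proof (rule nn_integral_cong)
        fix t
        have "u \<bullet> (x + t *\<^sub>R e) = a + t" by (simp add: a_def inner_add_right uw)
        moreover have "(1/2) powr (1 - p) = 2 powr (p - 1)" by (simp add: powr_divide powr_minus_divide[of 2 "1 - p", simplified] powr_diff)
        ultimately have "(1/2) powr (1 - p) * W (u \<bullet> (x + t *\<^sub>R e)) + (1/2) powr (1 - p) * W ((- u) \<bullet> (x + t *\<^sub>R e)) = K * \<bar>a + t\<bar> powr p"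
          using W_symmetrize[of "a + t"] by (simp add: K_def mult.assoc distrib_left[symmetric] del: minus_add_distrib)
        then show "indicator L (x + t *\<^sub>R e) * ennreal ((1/2) powr (1 - p) * W (u \<bullet> (x + t *\<^sub>R e)) + (1/2) powr (1 - p) * W ((- u) \<bullet> (x + t *\<^sub>R e)))
           = ennreal (K * \<bar>a + t\<bar> powr p) * indicator A t" by (simp add: A_def indicator_def)
      qed
      finally show ?thesis .
    qed
    have J: "(\<integral>\<^sup>+r\<in>{- l<..<l}. ennreal (W (2 * r)) \<partial>lborel) = (\<integral>\<^sup>+t\<in>?I. ennreal (K * \<bar>a + t\<bar> powr p) \<partial>lborel)"
    proof -
      let ?J = "\<integral>\<^sup>+r\<in>{- l<..<l}. ennreal (W (2 * r)) \<partial>lborel"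
      have "?J = (\<integral>\<^sup>+r\<in>{- l<..<l}. ennreal (W (2 * (0 - r))) \<partial>lborel)"
        by (subst nn_integral_lborel_reflect[of _ 0, symmetric]) (auto intro!: nn_integral_cong split: split_indicator)
      then have "?J + ?J = (\<integral>\<^sup>+r\<in>{- l<..<l}. ennreal (W (2 * r)) \<partial>lborel) + (\<integral>\<^sup>+r\<in>{- l<..<l}. ennreal (W (- (2 * r))) \<partial>lborel)" by simp
      also have "\<dots> = (\<integral>\<^sup>+r\<in>{- l<..<l}. ennreal (2 * (K * \<bar>r\<bar> powr p)) \<partial>lborel)"
      proof (subst nn_integral_add[symmetric])
        show "(\<integral>\<^sup>+r. ennreal (W (2 * r)) * indicator {- l<..<l} r + ennreal (W (- (2 * r))) * indicator {- l<..<l} r \<partial>lborel) = (\<integral>\<^sup>+r\<in>{- l<..<l}. ennreal (2 * (K * \<bar>r\<bar> powr p)) \<partial>lborel)"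
        proof (rule nn_integral_cong)
          fix r
          have "W (2 * r) + W (- (2 * r)) = 2 * (K * \<bar>r\<bar> powr p)"
            unfolding W_symmetrize K_def by (simp add: abs_mult powr_mult powr_diff)
          then show "ennreal (W (2 * r)) * indicator {- l<..<l} r + ennreal (W (- (2 * r))) * indicator {- l<..<l} r = ennreal (2 * (K * \<bar>r\<bar> powr p)) * indicator {- l<..<l} r"
            by (simp add: distrib_right[symmetric] flip: ennreal_plus)
        qed
      qed simp_all
      also have "\<dots> = 2 * (\<integral>\<^sup>+r\<in>{- l<..<l}. ennreal (K * \<bar>r\<bar> powr p) \<partial>lborel)"
        using K by (subst nn_integral_cmult[symmetric]) (auto simp: ennreal_mult mult.assoc)
      finally have JJ: "?J + ?J = 2 * (\<integral>\<^sup>+r\<in>{- l<..<l}. ennreal (K * \<bar>r\<bar> powr p) \<partial>lborel)" .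
      have "2 * ?J = 2 * (\<integral>\<^sup>+r\<in>{- l<..<l}. ennreal (K * \<bar>r\<bar> powr p) \<partial>lborel)"
        unfolding JJ[symmetric] by (rule mult_2)
      then have "?J = (\<integral>\<^sup>+r\<in>{- l<..<l}. ennreal (K * \<bar>r\<bar> powr p) \<partial>lborel)"
        by (subst (asm) ennreal_mult_cancel_left) auto
      also have "\<dots> = (\<integral>\<^sup>+t\<in>?I. ennreal (K * \<bar>a + t\<bar> powr p) \<partial>lborel)"
        by (subst nn_integral_lborel_translate[of _ a, symmetric]) (auto intro!: nn_integral_cong split: split_indicator)
      finally show ?thesis .
    qed
    have eA: "emeasure lborel A = emeasure lborel ?I"
      using emeasure_chord[OF e LL LR, of x] l0 by (simp add: A_def l_def)
    have lt: "0 \<le> K * \<bar>a + t\<bar> powr p \<and> K * \<bar>a + t\<bar> powr p < K * l powr p" if "t \<in> ?I" for t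
      using that K p by (auto intro!: powr_less_mono2 simp: abs_less_iff)
    have ge: "K * l powr p \<le> K * \<bar>a + t\<bar> powr p" if "t \<notin> ?I" for t
      using that K p l0 by (auto intro!: powr_mono2 simp: abs_if)
    have "emeasure lborel (?I - A) = 0 \<and> emeasure lborel (A - ?I) = 0"
      by (rule bathtub(2)[where \<psi>="\<lambda>t. K * \<bar>a + t\<bar> powr p" and c="K * l powr p"])
        (use eA l0 J eqx lt ge in \<open>auto simp: less_imp_le\<close>)
    then show "\<exists>l. emeasure lborel ({- (u \<bullet> x) - l<..<- (u \<bullet> x) + l} - {t. x + t *\<^sub>R e \<in> L}) = 0 \<and>
      emeasure lborel ({t. x + t *\<^sub>R e \<in> L} - {- (u \<bullet> x) - l<..<- (u \<bullet> x) + l}) = 0"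
      by (auto simp: a_def A_def)
  qed
qed

end

text \<open>For \<open>u \<bullet> e = 1\<close>, the linear involution that negates \<open>e\<close> and fixes the hyperplane orthogonal to \<open>u\<close>.\<close>

definition oblique_reflection :: "'a::euclidean_space \<Rightarrow> 'a \<Rightarrow> 'a \<Rightarrow> 'a" where
  "oblique_reflection e u z = z - (2 * (u \<bullet> z)) *\<^sub>R e"

lemma oblique_reflection_borel [measurable]: "oblique_reflection e u \<in> borel_measurable borel"
  unfolding oblique_reflection_def[abs_def] by measurable

lemma continuous_oblique_reflection: "continuous_on S (oblique_reflection e u)"
  unfolding oblique_reflection_def[abs_def] by (intro continuous_intros)

lemma oblique_reflection_line:
  assumes "u \<bullet> e = 1"
  shows "oblique_reflection e u (x + t *\<^sub>R e) = x + (- 2 * (u \<bullet> x) - t) *\<^sub>R e"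
  using assms by (simp add: oblique_reflection_def inner_add_right algebra_simps scaleR_2[symmetric] flip: scaleR_left_distrib scaleR_left_diff_distrib)

lemma oblique_reflection_involution:
  assumes "u \<bullet> e = 1"
  shows "oblique_reflection e u (oblique_reflection e u z) = z"
  using assms by (simp add: oblique_reflection_def inner_diff_right)

lemma oblique_reflection_scale: "oblique_reflection e u (s *\<^sub>R z) = s *\<^sub>R oblique_reflection e u z"
  by (simp add: oblique_reflection_def scaleR_diff_right)

lemma distr_oblique_reflection:
  fixes e u :: "'a::euclidean_space"
  assumes e: "norm e = 1" and u: "u \<bullet> e = 1"
  shows "distr lborel borel (oblique_reflection e u) = lborel"
proof (rule measure_eqI)
  fix A :: "'a set" assume "A \<in> sets (distr lborel borel (oblique_reflection e u))"
  then have [measurable]: "A \<in> sets borel" by simp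
  have "emeasure (distr lborel borel (oblique_reflection e u)) A =
      (\<integral>\<^sup>+z. indicator A z \<partial>distr lborel borel (oblique_reflection e u))"
    by (rule nn_integral_indicator[symmetric]) simp
  also have "\<dots> = (\<integral>\<^sup>+z. indicator A (oblique_reflection e u z) \<partial>lborel)"
    by (rule nn_integral_distr) simp_all
  also have "\<dots> = (\<integral>\<^sup>+x. indicator (slab e) x * (\<integral>\<^sup>+t. indicator A (oblique_reflection e u (x + t *\<^sub>R e)) \<partial>lborel) \<partial>lborel)"
    by (rule nn_integral_along_lines[OF _ e]) simp
  also have "\<dots> = (\<integral>\<^sup>+x. indicator (slab e) x * (\<integral>\<^sup>+t. indicator A (x + t *\<^sub>R e) \<partial>lborel) \<partial>lborel)"
  proof (rule nn_integral_cong)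
    fix x
    have "(\<integral>\<^sup>+t. indicator A (x + (- 2 * (u \<bullet> x) - t) *\<^sub>R e) \<partial>lborel) = (\<integral>\<^sup>+t. indicator A (x + t *\<^sub>R e) \<partial>lborel)"
      by (rule nn_integral_lborel_reflect) measurable
    then show "indicator (slab e) x * (\<integral>\<^sup>+t. indicator A (oblique_reflection e u (x + t *\<^sub>R e)) \<partial>lborel) =
       indicator (slab e) x * (\<integral>\<^sup>+t. indicator A (x + t *\<^sub>R e) \<partial>lborel)"
      unfolding oblique_reflection_line[OF u] by simp
  qed
  also have "\<dots> = (\<integral>\<^sup>+z. indicator A z \<partial>lborel)"
    by (rule nn_integral_along_lines[OF _ e, symmetric]) simp
  also have "\<dots> = emeasure lborel A"
    by (rule nn_integral_indicator) simp
  finally show "emeasure (distr lborel borel (oblique_reflection e u)) A = emeasure lborel A" .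
qed simp

text \<open>The reflection exchanges the two halves of each centred chord, so it maps \<open>L\<close> to itself up to a
  null set. As \<open>L\<close> is the closure of its interior, no exceptional points are left.\<close>

lemma star_body_reflection_invariant:
  fixes L :: "'a::euclidean_space set"
  assumes L: "star_body L" and e: "norm e = 1" and u: "u \<bullet> e = 1"
    and ae: "AE x in lborel. x \<in> slab e \<longrightarrow> (\<exists>l.
      emeasure lborel ({- (u \<bullet> x) - l<..<- (u \<bullet> x) + l} - {t. x + t *\<^sub>R e \<in> L}) = 0 \<and>
      emeasure lborel ({t. x + t *\<^sub>R e \<in> L} - {- (u \<bullet> x) - l<..<- (u \<bullet> x) + l}) = 0)"
    and z: "z \<in> L"
  shows "oblique_reflection e u z \<in> L"
proof -
  let ?R = "oblique_reflection e u"
  have cl: "closed L" using L by (auto simp: star_body_def compact_imp_closed)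
  have [measurable]: "L \<in> sets borel" using cl by simp
  define N where "N = {z \<in> L. ?R z \<notin> L}"
  have N [measurable]: "N \<in> sets borel" unfolding N_def by measurable
  have "AE x in lborel. indicator (slab e) x * emeasure lborel {t. x + t *\<^sub>R e \<in> N} = 0"
    using ae
  proof eventually_elim
    case (elim x)
    show ?case
    proof (cases "x \<in> slab e")
      case True
      define a where "a = u \<bullet> x"
      define A where "A = {t. x + t *\<^sub>R e \<in> L}"
      have [measurable]: "A \<in> sets borel" unfolding A_def by measurable
      obtain l where l: "emeasure lborel ({- a - l<..<- a + l} - A) = 0" "emeasure lborel (A - {- a - l<..<- a + l}) = 0"
        using elim True unfolding a_def A_def by blast
      let ?I = "{- a - l<..<- a + l}"
      have refl: "emeasure lborel {t. - 2 * a - t \<in> ?I - A} = 0"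
      proof -
        have "emeasure lborel {t. - 2 * a - t \<in> ?I - A} = (\<integral>\<^sup>+t. indicator {t. - 2 * a - t \<in> ?I - A} t \<partial>lborel)"
          by (rule nn_integral_indicator[symmetric]) measurable
        also have "\<dots> = (\<integral>\<^sup>+t. indicator (?I - A) (- 2 * a - t) \<partial>lborel)" by (simp add: indicator_def)
        also have "\<dots> = (\<integral>\<^sup>+t. indicator (?I - A) t \<partial>lborel)" by (rule nn_integral_lborel_reflect) measurable
        also have "\<dots> = 0" using l(1) by simp
        finally show ?thesis .
      qed
      have "{t. x + t *\<^sub>R e \<in> N} \<subseteq> (A - ?I) \<union> {t. - 2 * a - t \<in> ?I - A}"
        by (auto simp: N_def A_def a_def oblique_reflection_line[OF u])
      then have "emeasure lborel {t. x + t *\<^sub>R e \<in> N} \<le> emeasure lborel ((A - ?I) \<union> {t. - 2 * a - t \<in> ?I - A})"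
        by (intro emeasure_mono) measurable
      also have "\<dots> \<le> emeasure lborel (A - ?I) + emeasure lborel {t. - 2 * a - t \<in> ?I - A}"
        by (intro emeasure_subadditive) measurable
      also have "\<dots> = 0" unfolding refl l(2) by simp
      finally show ?thesis by simp
    qed simp
  qed
  then have "emeasure lborel N = 0"
    unfolding emeasure_along_lines[OF N e] by (subst nn_integral_0_iff_AE) auto
  have int: "?R y \<in> L" if y: "y \<in> interior L" for y
  proof (rule ccontr)
    assume "?R y \<notin> L"
    have "open (?R -` (- L))" using cl by (intro open_vimage continuous_oblique_reflection) auto
    then have "open (interior L \<inter> ?R -` (- L))" by auto
    moreover have "y \<in> interior L \<inter> ?R -` (- L)" using y \<open>?R y \<notin> L\<close> by simp
    ultimately obtain d where d: "d > 0" "ball y d \<subseteq> interior L \<inter> ?R -` (- L)"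
      using open_contains_ball by blast
    have "ball y d \<subseteq> N" using d(2) interior_subset[of L] by (auto simp: N_def)
    then have "emeasure lborel (ball y d) \<le> emeasure lborel N" by (intro emeasure_mono) auto
    then have "emeasure lborel (ball y d) = 0" using \<open>emeasure lborel N = 0\<close> by simp
    then show False using emeasure_ball_neq_0[OF d(1)] by blast
  qed
  have "((\<lambda>s. s *\<^sub>R ?R z) \<longlongrightarrow> 1 *\<^sub>R ?R z) (at_left (1::real))" by (intro tendsto_intros)
  moreover have "\<forall>\<^sub>F s in at_left (1::real). s *\<^sub>R ?R z \<in> L"
  proof -
    have "\<forall>\<^sub>F s in at_left (1::real). s \<in> {0<..<1}" by (rule eventually_at_leftI[of 0]) auto
    then show ?thesis
    proof eventually_elim
      case (elim s)
      then have "s *\<^sub>R z \<in> interior L" by (intro star_body_interior[OF L z]) auto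
      from int[OF this] show ?case by (simp add: oblique_reflection_scale)
    qed
  qed
  ultimately have "1 *\<^sub>R ?R z \<in> L"
    by (intro Lim_in_closed_set[OF cl]) (auto simp: trivial_limit_at_left_real)
  then show ?thesis by simp
qed

section \<open>Orthonormal bases of positive definite forms\<close>

text \<open>A maximal \<open>B\<close>-orthonormal set spans, because otherwise one Gram--Schmidt step would enlarge it;
  the map takes the standard basis to it.\<close>

lemma exists_orthonormalizing_map:
  fixes B :: "'a::euclidean_space \<Rightarrow> 'a \<Rightarrow> real"
  assumes B: "bilinear B" and sym: "\<And>x y. B x y = B y x" and pos: "\<And>x. x \<noteq> 0 \<Longrightarrow> 0 < B x x"
  obtains f :: "'a \<Rightarrow> 'a" where "linear f" "\<And>x y. B (f x) (f y) = x \<bullet> y"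
proof -
  define on where "on S \<longleftrightarrow> finite S \<and> (\<forall>s\<in>S. \<forall>t\<in>S. B s t = (if s = t then 1 else 0))" for S
  have lin: "linear (\<lambda>x. B x y)" for y using B by (simp add: bilinear_def)
  have Bsum: "B (\<Sum>s\<in>S. c s *\<^sub>R s) t = c t" if "on S" "t \<in> S" for S c t
  proof -
    have "B (\<Sum>s\<in>S. c s *\<^sub>R s) t = (\<Sum>s\<in>S. c s * B s t)"
      using linear_sum[OF lin[of t], of "\<lambda>s. c s *\<^sub>R s" S] by (simp add: linear_cmul[OF lin])
    also have "\<dots> = (\<Sum>s\<in>S. if s = t then c s else 0)"
      using that by (intro sum.cong) (auto simp: on_def)
    also have "\<dots> = c t" using that by (simp add: on_def)
    finally show ?thesis .
  qed
  have indep: "independent S" if S: "on S" for S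
  proof -
    have fS: "finite S" using S by (simp add: on_def)
    show ?thesis
      unfolding dependent_finite[OF fS]
    proof
      assume "\<exists>c. (\<exists>v\<in>S. c v \<noteq> 0) \<and> (\<Sum>v\<in>S. c v *\<^sub>R v) = 0"
      then obtain c v where c: "v \<in> S" "c v \<noteq> 0" "(\<Sum>v\<in>S. c v *\<^sub>R v) = 0" by blast
      have "c v = B (\<Sum>v\<in>S. c v *\<^sub>R v) v" using Bsum[OF S c(1), of c] by simp
      also have "\<dots> = 0" unfolding c(3) using linear_0[OF lin[of v]] by simp
      finally show False using c(2) by simp
    qed
  qed
  have bound: "card S \<le> DIM('a)" if "on S" for S using independent_bound[OF indep[OF that]] by simp
  have "\<exists>S. on S \<and> (\<forall>S'. on S' \<longrightarrow> card S' \<le> card S)"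
    by (rule ex_has_greatest_nat[of on "{}" card "Suc DIM('a)"]) (use bound in \<open>auto simp: on_def less_Suc_eq_le\<close>)
  then obtain S where S: "on S" and max: "\<And>S'. on S' \<Longrightarrow> card S' \<le> card S" by blast
  have fS: "finite S" using S by (simp add: on_def)
  have "card S = DIM('a)"
  proof (rule ccontr)
    assume "card S \<noteq> DIM('a)"
    then have less: "card S < DIM('a)" using bound[OF S] by simp
    have "span S \<noteq> UNIV"
    proof
      assume "span S = UNIV"
      then have "DIM('a) \<le> card S" using dim_le_card[of UNIV S] fS by simp
      then show False using less by simp
    qed
    then obtain y where y: "y \<notin> span S" by blast
    define y' where "y' = y - (\<Sum>s\<in>S. B y s *\<^sub>R s)"
    have "(\<Sum>s\<in>S. B y s *\<^sub>R s) \<in> span S" by (intro span_sum span_scale span_base)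
    then have "y' \<noteq> 0" using y by (auto simp: y'_def)
    then have q: "B y' y' > 0" by (rule pos)
    have y'0: "B y' s = 0" if "s \<in> S" for s
      unfolding y'_def using linear_diff[OF lin[of s]] Bsum[OF S that, of "\<lambda>t. B y t"] by simp
    define k where "k = 1 / sqrt (B y' y')"
    have lin2: "linear (B x)" for x using B by (simp add: bilinear_def)
    have ky: "B (k *\<^sub>R y') (k *\<^sub>R y') = 1"
      using q by (simp add: linear_cmul[OF lin] linear_cmul[OF lin2] k_def)
    have ks: "B (k *\<^sub>R y') s = 0" "B s (k *\<^sub>R y') = 0" if "s \<in> S" for s
      using y'0[OF that] sym[of s y'] by (simp_all add: linear_cmul[OF lin] linear_cmul[OF lin2])
    have nin: "k *\<^sub>R y' \<notin> S" using ky ks by fastforce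
    have "on (insert (k *\<^sub>R y') S)"
      using S nin ky ks unfolding on_def by auto
    then have "card (insert (k *\<^sub>R y') S) \<le> card S" by (rule max)
    then show False using nin fS by simp
  qed
  then obtain g where g: "bij_betw g (Basis :: 'a set) S"
    using finite_same_card_bij[of "Basis :: 'a set" S] fS by auto
  have Bg: "B (g b) (g c) = (if b = c then 1 else 0)" if "b \<in> Basis" "c \<in> Basis" for b c
  proof -
    have "g b \<in> S" "g c \<in> S" "g b = g c \<longleftrightarrow> b = c"
      using g that by (auto simp: bij_betw_def inj_on_eq_iff)
    then show ?thesis using S by (simp add: on_def)
  qed
  define f where "f x = (\<Sum>b\<in>Basis. (x \<bullet> b) *\<^sub>R g b)" for x
  have "linear f"
    unfolding f_def by (intro linearI) (simp_all add: inner_add_left scaleR_add_left sum.distrib scaleR_sum_right)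
  moreover have "B (f x) (f y) = x \<bullet> y" for x y
  proof -
    have lin2: "linear (B z)" for z using B by (simp add: bilinear_def)
    have "B (f x) (f y) = (\<Sum>b\<in>Basis. (x \<bullet> b) * B (g b) (f y))"
      unfolding f_def[of x] using linear_sum[OF lin[of "f y"], of "\<lambda>b. (x \<bullet> b) *\<^sub>R g b" Basis] by (simp add: linear_cmul[OF lin])
    also have "\<dots> = (\<Sum>b\<in>Basis. (x \<bullet> b) * (y \<bullet> b))"
    proof (intro sum.cong refl arg_cong2[where f="(*)"])
      fix b :: 'a assume b: "b \<in> Basis"
      have "B (g b) (f y) = (\<Sum>c\<in>Basis. (y \<bullet> c) * B (g b) (g c))"
        unfolding f_def using linear_sum[OF lin2[of "g b"], of "\<lambda>b. (y \<bullet> b) *\<^sub>R g b" Basis] by (simp add: linear_cmul[OF lin2])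
      also have "\<dots> = (\<Sum>c\<in>Basis. if b = c then y \<bullet> c else 0)"
        using b by (intro sum.cong) (auto simp: Bg)
      also have "\<dots> = y \<bullet> b" using b by simp
      finally show "B (g b) (f y) = y \<bullet> b" .
    qed
    also have "\<dots> = x \<bullet> y" by (rule euclidean_inner[symmetric])
    finally show ?thesis .
  qed
  ultimately show ?thesis by (rule that)
qed

definition second_moment :: "'a::euclidean_space set \<Rightarrow> 'a \<Rightarrow> 'a \<Rightarrow> real" where
  "second_moment L y z = (\<integral>x. indicator L x *\<^sub>R ((y \<bullet> x) * (z \<bullet> x)) \<partial>lborel)"

lemma second_moment_integrable:
  assumes "compact (L :: 'a::euclidean_space set)"
  shows "integrable lborel (\<lambda>x. indicator L x *\<^sub>R ((y \<bullet> x) * (z \<bullet> x)))"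
  using assms by (intro borel_integrable_compact continuous_intros)

lemma second_moment_sym: "second_moment L y z = second_moment L z y"
  by (simp add: second_moment_def mult.commute)

lemma bilinear_second_moment:
  assumes L: "compact (L :: 'a::euclidean_space set)"
  shows "bilinear (second_moment L)"
proof -
  have l: "linear (second_moment L y)" for y
  proof (rule linearI)
    fix a b and c :: real
    show "second_moment L y (a + b) = second_moment L y a + second_moment L y b"
      unfolding second_moment_def Bochner_Integration.integral_add[OF second_moment_integrable[OF L] second_moment_integrable[OF L], symmetric]
      by (simp add: inner_add_left algebra_simps)
    show "second_moment L y (c *\<^sub>R a) = c *\<^sub>R second_moment L y a"
      unfolding second_moment_def integral_scaleR_right[symmetric]
      by (intro Bochner_Integration.integral_cong) (simp_all add: algebra_simps)
  qed
  moreover have "(\<lambda>x. second_moment L x y) = second_moment L y" for y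
    by (rule ext) (rule second_moment_sym)
  ultimately show ?thesis by (simp add: bilinear_def)
qed

lemma second_moment_pos:
  assumes L: "compact (L :: 'a::euclidean_space set)" and r: "ball 0 r \<subseteq> L" "0 < r" and y: "y \<noteq> 0"
  shows "0 < second_moment L y y"
proof -
  have nonneg: "0 \<le> second_moment L y y"
    unfolding second_moment_def by (intro integral_nonneg_AE) simp
  moreover have "second_moment L y y \<noteq> 0"
  proof
    assume "second_moment L y y = 0"
    then have ae: "AE x in lborel. indicator L x *\<^sub>R ((y \<bullet> x) * (y \<bullet> x)) = 0"
      unfolding second_moment_def
      using integral_nonneg_eq_0_iff_AE[OF second_moment_integrable[OF L, of y y]] by simp
    define U where "U = ball 0 r \<inter> {x. y \<bullet> x > 0}"
    have U: "open U" unfolding U_def by (intro open_Int open_ball open_halfspace_gt)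
    have "AE x in lborel. x \<notin> U"
      using ae by eventually_elim (use r in \<open>auto simp: U_def indicator_def split: if_splits\<close>)
    then have nU: "emeasure lborel U = 0"
      using AE_iff_null_sets[of U lborel] U by (simp add: null_sets_def)
    have "(r / (2 * norm y)) *\<^sub>R y \<in> U" using y r by (auto simp: U_def)
    then obtain d where d: "d > 0" "ball ((r / (2 * norm y)) *\<^sub>R y) d \<subseteq> U"
      using U open_contains_ball by blast
    have "emeasure lborel (ball ((r / (2 * norm y)) *\<^sub>R y) d) \<le> emeasure lborel U"
      using d U by (intro emeasure_mono) auto
    then have "emeasure lborel (ball ((r / (2 * norm y)) *\<^sub>R y) d) = 0" using nU by simp
    then show False using emeasure_ball_neq_0[OF d(1)] by blast
  qed
  ultimately show ?thesis by simp
qed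

text \<open>A measure preserving reflection that maps \<open>L\<close> to itself preserves the second moments of
  \<open>L\<close>; comparing their values at \<open>v + u\<close> and \<open>v - u\<close>, which the adjoint of the reflection
  exchanges, gives orthogonality of \<open>u\<close> and \<open>v\<close>.\<close>

lemma second_moment_orthogonal:
  fixes L :: "'a::euclidean_space set"
  assumes L: "compact L" and e: "norm e = 1" and u: "u \<bullet> e = 1" and v: "v \<bullet> e = 0"
    and inv: "\<And>z. z \<in> L \<Longrightarrow> oblique_reflection e u z \<in> L"
  shows "second_moment L u v = 0"
proof -
  let ?R = "oblique_reflection e u"
  have iff: "?R z \<in> L \<longleftrightarrow> z \<in> L" for z
    using inv[of z] inv[of "?R z"] oblique_reflection_involution[OF u, of z] by auto
  have [measurable]: "L \<in> sets borel" using L by (simp add: compact_imp_closed)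
  let ?g = "\<lambda>y x. indicator L x *\<^sub>R ((y \<bullet> x) * (y \<bullet> x)) :: real"
  have adj: "(v + u) \<bullet> ?R x = (v - u) \<bullet> x" for x
    using u v by (simp add: oblique_reflection_def inner_add_left inner_diff_left inner_diff_right)
  have "second_moment L (v + u) (v + u) = (\<integral>x. ?g (v + u) x \<partial>distr lborel borel ?R)"
    by (simp only: second_moment_def distr_oblique_reflection[OF e u])
  also have "\<dots> = (\<integral>x. ?g (v + u) (?R x) \<partial>lborel)"
    by (rule integral_distr) simp_all
  also have "\<dots> = second_moment L (v - u) (v - u)"
    unfolding second_moment_def adj by (simp add: indicator_def iff)
  finally have eq: "second_moment L (v + u) (v + u) = second_moment L (v - u) (v - u)" .
  note bl = bilinear_second_moment[OF L]
  show ?thesis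
    using eq by (simp add: bilinear_ladd[OF bl] bilinear_radd[OF bl] bilinear_lsub[OF bl] bilinear_rsub[OF bl] second_moment_sym[of L v u])
qed

section \<open>A body with all these symmetries is an ellipsoid\<close>

text \<open>In coordinates that are orthonormal for the second moments of \<open>L\<close>, all the reflections
  become orthogonal. Any two points of the same norm are exchanged by the reflection along their
  difference, so in these coordinates \<open>L\<close> is a ball.\<close>

lemma ellipsoid_of_reflections:
  fixes L :: "'a::euclidean_space set"
  assumes L: "star_body L"
    and refl: "\<And>e. norm e = 1 \<Longrightarrow> \<exists>u. u \<bullet> e = 1 \<and> (\<forall>z\<in>L. oblique_reflection e u z \<in> L)"
  shows "centered_ellipsoid L"
proof -
  obtain r R where S: "sandwiched r R L" using star_body_sandwiched[OF L, of 0] by blast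
  have cL: "compact L" using L by (simp add: star_body_def)
  let ?B = "second_moment L"
  have pos: "0 < ?B x x" if "x \<noteq> 0" for x
    by (rule second_moment_pos[OF cL sandwichedD(2,4)[OF S] that])
  obtain f :: "'a \<Rightarrow> 'a" where f: "linear f" "\<And>x y. ?B (f x) (f y) = x \<bullet> y"
    using exists_orthonormalizing_map[OF bilinear_second_moment[OF cL] second_moment_sym pos] by blast
  have bl: "bilinear ?B" by (rule bilinear_second_moment[OF cL])
  have "inj f"
  proof (rule linear_injective_0[OF f(1), THEN iffD2], intro allI impI)
    fix x assume "f x = 0"
    then have "x \<bullet> x = 0" using f(2)[of x x] bilinear_lzero[OF bl] by simp
    then show "x = 0" by simp
  qed
  then have "surj f" using linear_injective_imp_surjective[OF f(1)] by simp
  define g where "g = adjoint f"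
  have g: "linear g" "\<And>x y. f x \<bullet> y = x \<bullet> g y"
    unfolding g_def using adjoint_linear[OF f(1)] adjoint_works[OF f(1)] by (auto simp: inner_commute)
  have ginj: "inj g"
  proof (rule linear_injective_0[OF g(1), THEN iffD2], intro allI impI)
    fix y assume gy: "g y = 0"
    obtain x where "y = f x" using \<open>surj f\<close> by (auto simp: surj_def)
    then have "y \<bullet> y = 0" using g(2)[of x y] gy by simp
    then show "y = 0" by simp
  qed
  have swap: "y \<in> L" if x: "x \<in> L" and eqn: "norm (g x) = norm (g y)" for x y
  proof (cases "x = y")
    case False
    define e where "e = (x - y) /\<^sub>R norm (x - y)"
    have ee: "norm e = 1" "x - y = norm (x - y) *\<^sub>R e" using False by (auto simp: e_def)
    obtain u where u: "u \<bullet> e = 1" "\<And>z. z \<in> L \<Longrightarrow> oblique_reflection e u z \<in> L" using refl[OF ee(1)] by blast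
    obtain u' where u': "u = f u'" using \<open>surj f\<close> by (auto simp: surj_def)
    define k where "k = g e"
    have k1: "u' \<bullet> k = 1" using u(1) g(2)[of u' e] by (simp add: u' k_def)
    then have k0: "k \<noteq> 0" by auto
    \<comment> \<open>Orthogonality of \<open>u\<close> to \<open>e\<^sup>\<bottom>\<close> for the second moments makes \<open>u'\<close> a multiple of \<open>k\<close>.\<close>
    define v' where "v' = u' - (1 / (k \<bullet> k)) *\<^sub>R k"
    have vk: "v' \<bullet> k = 0" using k1 k0 by (simp add: v'_def inner_diff_left)
    then have "f v' \<bullet> e = 0" using g(2)[of v' e] by (simp add: k_def)
    then have "?B u (f v') = 0"
      using u by (intro second_moment_orthogonal[OF cL ee(1)]) auto
    then have "u' \<bullet> v' = 0" using f(2)[of u' v'] by (simp add: u')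
    moreover have "v' \<bullet> v' = u' \<bullet> v' - (1 / (k \<bullet> k)) * (v' \<bullet> k)"
      by (subst (1) v'_def) (simp add: inner_diff_left inner_commute[of k v'])
    ultimately have "v' \<bullet> v' = 0" using vk by simp
    then have uk: "u' = (1 / (k \<bullet> k)) *\<^sub>R k" by (simp add: v'_def)
    have d: "g x - g y = norm (x - y) *\<^sub>R k"
      using linear_diff[OF g(1), of x y] linear_cmul[OF g(1), of "norm (x - y)" e] ee(2) by (simp add: k_def)
    have nn: "g x \<bullet> g x = g y \<bullet> g y" using eqn by (simp add: norm_eq)
    have "2 * ((g x - g y) \<bullet> g x) = (g x - g y) \<bullet> (g x - g y)"
      using nn by (simp add: inner_diff_left inner_diff_right inner_commute[of "g y" "g x"])
    then have "2 * (norm (x - y) * (k \<bullet> g x)) = norm (x - y) * (norm (x - y) * (k \<bullet> k))"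
      unfolding d by simp
    then have "2 * (k \<bullet> g x) = norm (x - y) * (k \<bullet> k)" using False by simp
    moreover have "u \<bullet> x = (k \<bullet> g x) / (k \<bullet> k)" using g(2)[of u' x] by (simp add: u' uk)
    ultimately have "2 * (u \<bullet> x) = norm (x - y) * (k \<bullet> k) / (k \<bullet> k)" by (simp only: times_divide_eq_right)
    then have "2 * (u \<bullet> x) = norm (x - y)" using k0 by simp
    then have "oblique_reflection e u x = y" using ee(2) by (simp add: oblique_reflection_def algebra_simps)
    then show ?thesis using u(2)[OF x] by simp
  qed (use x in simp)
  have cg: "continuous_on L (\<lambda>x. norm (g x))"
    by (intro continuous_intros linear_continuous_on_compose[OF continuous_on_id g(1), simplified])
  have "L \<noteq> {}" using sandwichedD(2,4)[OF S] by auto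
  then obtain x0 where x0: "x0 \<in> L" "\<And>x. x \<in> L \<Longrightarrow> norm (g x) \<le> norm (g x0)"
    using continuous_attains_sup[OF cL _ cg] by blast
  define s where "s = norm (g x0)"
  have s: "s > 0"
  proof -
    obtain b :: 'a where b: "b \<in> Basis" using nonempty_Basis by blast
    have "(r / 2) *\<^sub>R b \<in> L" using sandwichedD(2,4)[OF S] b by auto
    moreover have "(r / 2) *\<^sub>R b \<noteq> 0" using b sandwichedD(4)[OF S] by (auto simp: nonzero_Basis)
    then have "g ((r / 2) *\<^sub>R b) \<noteq> 0" using ginj linear_0[OF g(1)] by (metis injD)
    ultimately show ?thesis using x0(2)[of "(r / 2) *\<^sub>R b"] unfolding s_def by (smt (verit) zero_less_norm_iff)
  qed
  have Leq: "x \<in> L \<longleftrightarrow> norm (g x) \<le> s" for x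
  proof
    assume le: "norm (g x) \<le> s"
    define l where "l = norm (g x) / s"
    have l: "0 \<le> l" "l \<le> 1" using le s by (auto simp: l_def)
    have "l *\<^sub>R x0 \<in> closed_segment 0 x0" using l unfolding in_segment by (intro exI[of _ l]) simp
    then have "l *\<^sub>R x0 \<in> L" using L x0(1) by (auto simp: star_body_def star_shaped_origin_def)
    moreover have "norm (g (l *\<^sub>R x0)) = norm (g x)"
      using l s by (simp add: linear_cmul[OF g(1)] l_def s_def[symmetric])
    ultimately show "x \<in> L" using swap by blast
  qed (use x0 in \<open>simp add: s_def\<close>)
  obtain gi where gi: "linear gi" "\<And>x. gi (g x) = x" "\<And>x. g (gi x) = x"
    using linear_injective_isomorphism[OF g(1) ginj] by auto
  define F where "F z = gi (s *\<^sub>R z)" for z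
  have "linear F"
    unfolding F_def using linear_compose[OF linear_scale_self gi(1)] by (simp add: o_def)
  moreover have gF: "g (F z) = s *\<^sub>R z" for z using gi(3) by (simp add: F_def)
  have Fg: "F (g x /\<^sub>R s) = x" for x using gi(2) s by (simp add: F_def)
  have "bij F"
  proof (rule bijI)
    show "inj F" by (rule injI) (metis gF s scaleR_cancel_left less_irrefl)
    show "surj F" by (rule surjI[of F "\<lambda>x. g x /\<^sub>R s"]) (rule Fg)
  qed
  moreover have "L = F ` cball 0 1"
  proof
    show "L \<subseteq> F ` cball 0 1"
    proof
      fix x assume "x \<in> L"
      then have "g x /\<^sub>R s \<in> cball 0 1" using Leq[of x] s by (simp add: field_simps)
      then show "x \<in> F ` cball 0 1" using Fg[of x] by (metis image_eqI)
    qed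
    show "F ` cball 0 1 \<subseteq> L" using s by (auto simp: Leq gF mult_left_le)
  qed
  ultimately show ?thesis unfolding centered_ellipsoid_def by blast
qed

section \<open>Ellipsoids\<close>

text \<open>Translation invariance forces the image of Lebesgue measure under a linear bijection to be a
  multiple of it: both sides, multiplied by the integral of an auxiliary function \<open>k\<close>, are the
  double integral of \<open>q (f x) k (f x - y)\<close>.\<close>

lemma nn_integral_linear_bij:
  fixes f :: "'a::euclidean_space \<Rightarrow> 'a"
  assumes f: "linear f" "bij f"
  obtains D where "0 < D" "\<And>q. q \<in> borel_measurable borel \<Longrightarrow> (\<integral>\<^sup>+x. q (f x) \<partial>lborel) = ennreal D * (\<integral>\<^sup>+x. q x \<partial>lborel)"
proof -
  have [measurable]: "f \<in> borel_measurable borel"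
    using f(1) by (intro borel_measurable_continuous_onI linear_continuous_on linear_conv_bounded_linear[THEN iffD1])
  have shift: "(\<integral>\<^sup>+x. q (f x + y) \<partial>lborel) = (\<integral>\<^sup>+x. q (f x) \<partial>lborel)"
    if [measurable]: "q \<in> borel_measurable borel" for q :: "'a \<Rightarrow> ennreal" and y
  proof -
    obtain v where v: "y = f v" using f(2) by (auto simp: bij_def surj_def)
    have "(\<integral>\<^sup>+x. q (f x + y) \<partial>lborel) = (\<integral>\<^sup>+x. q (f (v + x)) \<partial>lborel)"
      by (simp add: v linear_add[OF f(1)] add.commute)
    also have "\<dots> = (\<integral>\<^sup>+x. q (f x) \<partial>lborel)"
      by (rule nn_integral_lborel_translate) measurable
    finally show ?thesis .
  qed
  have main: "(\<integral>\<^sup>+x. q (f x) \<partial>lborel) * (\<integral>\<^sup>+x. k x \<partial>lborel) = (\<integral>\<^sup>+x. k (f x) \<partial>lborel) * (\<integral>\<^sup>+x. q x \<partial>lborel)"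
    if [measurable]: "q \<in> borel_measurable borel" "k \<in> borel_measurable borel" for q k :: "'a \<Rightarrow> ennreal"
  proof -
    have k: "(\<integral>\<^sup>+y. k (z - y) \<partial>lborel) = (\<integral>\<^sup>+x. k x \<partial>lborel)" for z
    proof -
      have "(\<integral>\<^sup>+x. k x \<partial>lborel) = (\<integral>\<^sup>+x. k (z + x) \<partial>lborel)"
        by (rule nn_integral_lborel_translate[symmetric]) simp
      also have "\<dots> = ennreal (\<bar>- 1\<bar> ^ DIM('a)) * (\<integral>\<^sup>+y. k (z + (- 1) *\<^sub>R y) \<partial>lborel)"
        by (rule nn_integral_lborel_scale) auto
      finally show ?thesis by simp
    qed
    have "(\<integral>\<^sup>+x. q (f x) \<partial>lborel) * (\<integral>\<^sup>+x. k x \<partial>lborel) = (\<integral>\<^sup>+x. (\<integral>\<^sup>+y. q (f x) * k (f x - y) \<partial>lborel) \<partial>lborel)"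
      by (simp add: nn_integral_cmult nn_integral_multc k)
    also have "\<dots> = (\<integral>\<^sup>+y. (\<integral>\<^sup>+x. q (f x) * k (f x - y) \<partial>lborel) \<partial>lborel)"
      by (intro lborel_pair.Fubini') measurable
    also have "\<dots> = (\<integral>\<^sup>+y. (\<integral>\<^sup>+x. q (f x + y) * k (f x) \<partial>lborel) \<partial>lborel)"
    proof (rule nn_integral_cong)
      fix y
      show "(\<integral>\<^sup>+x. q (f x) * k (f x - y) \<partial>lborel) = (\<integral>\<^sup>+x. q (f x + y) * k (f x) \<partial>lborel)"
        using shift[of "\<lambda>z. q z * k (z - y)" y] by simp
    qed
    also have "\<dots> = (\<integral>\<^sup>+x. (\<integral>\<^sup>+y. q (f x + y) * k (f x) \<partial>lborel) \<partial>lborel)"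
      by (intro lborel_pair.Fubini') measurable
    also have "\<dots> = (\<integral>\<^sup>+x. k (f x) * (\<integral>\<^sup>+x. q x \<partial>lborel) \<partial>lborel)"
      by (intro nn_integral_cong, subst nn_integral_multc) (simp_all add: nn_integral_lborel_translate mult.commute)
    also have "\<dots> = (\<integral>\<^sup>+x. k (f x) \<partial>lborel) * (\<integral>\<^sup>+x. q x \<partial>lborel)"
      by (rule nn_integral_multc) measurable
    finally show ?thesis .
  qed
  have cf: "continuous_on UNIV f" by (rule linear_continuous_on) (simp add: f linear_conv_bounded_linear[symmetric])
  have pre: "f -` ball 0 1 \<in> sets borel" by (intro borel_open open_vimage cf) simp
  define E where "E = (\<integral>\<^sup>+x. indicator (ball 0 1) (f x) \<partial>lborel)"
  have E: "E = emeasure lborel (f -` ball 0 1)"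
  proof -
    have "E = (\<integral>\<^sup>+x. indicator (f -` ball 0 1) x \<partial>lborel)" by (simp add: E_def indicator_def)
    also have "\<dots> = emeasure lborel (f -` ball 0 1)" by (rule nn_integral_indicator) (simp add: pre)
    finally show ?thesis .
  qed
  obtain d where d: "d > 0" "ball 0 d \<subseteq> f -` ball 0 1"
  proof -
    have "open (f -` ball 0 1)" by (intro open_vimage cf) simp
    moreover have "0 \<in> f -` ball 0 1" using linear_0[OF f(1)] by simp
    ultimately show ?thesis using that open_contains_ball by blast
  qed
  have "emeasure lborel (ball (0::'a) d) \<le> E"
    unfolding E by (intro emeasure_mono d) (simp add: pre)
  moreover have "emeasure lborel (ball (0::'a) d) > 0"
    using d unit_ball_vol_pos[of "real DIM('a)"] by (simp add: emeasure_ball)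
  ultimately have Epos: "E > 0" by order
  obtain b where b: "b > 0" "\<And>x. norm x * b \<le> norm (f x)"
    using linear_inj_bounded_below_pos[OF f(1)] f(2) by (auto simp: bij_def mult.commute)
  have "f -` ball 0 1 \<subseteq> cball 0 (1 / b)"
  proof
    fix x assume "x \<in> f -` ball 0 1"
    then have "norm x * b \<le> 1" using b(2)[of x] by simp
    then show "x \<in> cball 0 (1 / b)" using b(1) by (simp add: field_simps)
  qed
  then have "E \<le> emeasure lborel (cball (0::'a) (1 / b))" unfolding E by (intro emeasure_mono) auto
  also have "\<dots> < \<infinity>" using emeasure_compact_finite[of "cball (0::'a) (1 / b)"] by simp
  finally have Efin: "E < \<infinity>" .
  define V where "V = unit_ball_vol (real DIM('a))"
  have V: "V > 0" by (simp add: V_def unit_ball_vol_pos)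
  have ball: "(\<integral>\<^sup>+x. indicator (ball (0::'a) 1) x \<partial>lborel) = ennreal V" by (simp add: emeasure_ball V_def)
  define D where "D = enn2real E / V"
  have D: "D > 0" using Epos Efin V by (simp add: D_def enn2real_positive_iff)
  have "(\<integral>\<^sup>+x. q (f x) \<partial>lborel) = ennreal D * (\<integral>\<^sup>+x. q x \<partial>lborel)" if q: "q \<in> borel_measurable borel" for q :: "'a \<Rightarrow> ennreal"
  proof -
    have "(\<integral>\<^sup>+x. q (f x) \<partial>lborel) = (\<integral>\<^sup>+x. q (f x) \<partial>lborel) * (ennreal V * ennreal (1 / V))"
      using V by (simp flip: ennreal_mult)
    also have "\<dots> = E * (\<integral>\<^sup>+x. q x \<partial>lborel) * ennreal (1 / V)"
      using main[OF q, of "indicator (ball 0 1)"] by (simp add: ball E_def mult.assoc[symmetric])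
    also have "\<dots> = (E * ennreal (1 / V)) * (\<integral>\<^sup>+x. q x \<partial>lborel)" by (simp add: mult_ac)
    also have "E * ennreal (1 / V) = ennreal D"
    proof -
      have "ennreal (enn2real E) * ennreal (1 / V) = ennreal D"
        using V by (simp add: D_def flip: ennreal_mult)
      moreover have "ennreal (enn2real E) = E" using Efin by simp
      ultimately show ?thesis by simp
    qed
    finally show ?thesis .
  qed
  with D show ?thesis by (rule that)
qed

context moment_weight
begin

text \<open>Both volumes are multiplied by powers of the modulus \<open>1 / D\<close> of the linear map: a substitution gives
  \<open>h(M (f B), u)\<^sup>p = h(M B, f\<^sup>* u)\<^sup>p / D\<close>, that is \<open>M (f B) = D\<^bsup>-1/p\<^esup> f (M B)\<close>.\<close>

lemma measure_mbody_ellipsoid: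
  fixes f :: "'a::euclidean_space \<Rightarrow> 'a"
  assumes f: "linear f" "bij f"
  obtains D where "0 < D" "D * measure lborel (f ` cball 0 1) = unit_ball_vol (real DIM('a))"
    "D * measure lborel (mbody (f ` cball 0 1)) = unit_ball_vol (real DIM('a)) * (D powr (- 1 / p)) ^ DIM('a)"
proof -
  let ?L = "f ` cball (0::'a) 1"
  obtain D where D: "0 < D" "\<And>q. q \<in> borel_measurable borel \<Longrightarrow> (\<integral>\<^sup>+x. q (f x) \<partial>lborel) = ennreal D * (\<integral>\<^sup>+x. q x \<partial>lborel)"
    using nn_integral_linear_bij[OF f] by blast
  have cf: "continuous_on S f" for S by (rule linear_continuous_on) (simp add: f linear_conv_bounded_linear[symmetric])
  have "compact ?L" by (intro compact_continuous_image cf) simp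
  then have LL [measurable]: "?L \<in> sets borel" by (simp add: compact_imp_closed)
  have inL: "f x \<in> ?L \<longleftrightarrow> x \<in> cball 0 1" for x by (rule inj_image_mem_iff[OF bij_is_inj[OF f(2)]])
  define k where "k = D powr (- 1 / p)"
  have k: "k > 0" using D by (simp add: k_def)
  have meas: "ennreal D * emeasure lborel S = emeasure lborel (cball (0::'a) s)"
    if S: "S \<in> sets borel" and iff: "\<And>x. f x \<in> S \<longleftrightarrow> x \<in> cball 0 s" for S s
  proof -
    have "ennreal D * emeasure lborel S = ennreal D * (\<integral>\<^sup>+x. indicator S x \<partial>lborel)" using S by simp
    also have "\<dots> = (\<integral>\<^sup>+x. indicator S (f x) \<partial>lborel)" using S by (intro D(2)[symmetric]) simp
    also have "\<dots> = (\<integral>\<^sup>+x. indicator (cball (0::'a) s) x \<partial>lborel)" by (simp add: indicator_def iff del: mem_cball)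
    also have "\<dots> = emeasure lborel (cball (0::'a) s)" by simp
    finally show ?thesis .
  qed
  have real: "D * measure lborel S = unit_ball_vol (real DIM('a)) * s ^ DIM('a)"
    if "S \<in> sets borel" and "\<And>x. f x \<in> S \<longleftrightarrow> x \<in> cball 0 s" and s: "s \<ge> 0" for S s
    using arg_cong[OF meas[OF that(1,2)], of enn2real] D(1) s
    by (simp add: measure_def[symmetric] enn2real_mult content_cball)
  have mom: "moment (cball 0 1) (adjoint f u) = ennreal D * moment ?L u" for u
  proof -
    have "ennreal D * moment ?L u = (\<integral>\<^sup>+x. ennreal (W (u \<bullet> f x)) * indicator ?L (f x) \<partial>lborel)"
      unfolding moment_def by (rule D(2)[symmetric]) simp
    also have "\<dots> = moment (cball 0 1) (adjoint f u)"
      unfolding moment_def by (intro nn_integral_cong)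
        (simp add: indicator_def inL adjoint_works[OF f(1)] inner_commute[of u] inner_commute[of "adjoint f u"] del: mem_cball)
    finally show ?thesis by simp
  qed
  have sp: "supp ?L u = k * norm (adjoint f u)" for u
  proof -
    have m1: "moment (cball 0 1) (adjoint f u) = ennreal (norm (adjoint f u) powr p / nconst DIM('a))"
      using moment_between_balls[of 1 "cball 0 1" "adjoint f u"] by simp
    have "moment ?L u = (ennreal (1 / D) * ennreal D) * moment ?L u" using D(1) by (simp flip: ennreal_mult)
    also have "\<dots> = ennreal (1 / D) * moment (cball 0 1) (adjoint f u)"
      by (simp only: mom mult.assoc)
    also have "\<dots> = ennreal (norm (adjoint f u) powr p / nconst DIM('a) / D)"
      using D(1) nconst_pos[of "DIM('a)"] by (simp add: m1 flip: ennreal_mult)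
    finally have "nconst DIM('a) * enn2real (moment ?L u) = norm (adjoint f u) powr p / D"
      using D(1) nconst_pos[of "DIM('a)"] by simp
    then show ?thesis
      unfolding supp_def k_def using p D(1) by (simp add: powr_divide powr_powr powr_minus_divide)
  qed
  have asurj: "surj (adjoint f)"
  proof -
    have al: "linear (adjoint f)" by (rule adjoint_linear[OF f(1)])
    have "inj (adjoint f)"
    proof (rule linear_injective_0[OF al, THEN iffD2], intro allI impI)
      fix y assume y: "adjoint f y = 0"
      obtain x where "y = f x" using f(2) by (auto simp: bij_def surj_def)
      then have "y \<bullet> y = 0" using adjoint_works[OF f(1), of x y] y by simp
      then show "y = 0" by simp
    qed
    then show ?thesis using linear_injective_imp_surjective[OF al] by simp
  qed
  have iff: "f z \<in> mbody ?L \<longleftrightarrow> z \<in> cball 0 k" for z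
  proof -
    have "f z \<in> mbody ?L \<longleftrightarrow> (\<forall>u. adjoint f u \<bullet> z \<le> k * norm (adjoint f u))"
      by (simp add: mbody_def wulff_def sp adjoint_works[OF f(1)] inner_commute[of _ "f z"] inner_commute[of _ z])
    also have "\<dots> \<longleftrightarrow> (\<forall>u. u \<bullet> z \<le> k * norm u)" using asurj by (metis surjD)
    also have "\<dots> \<longleftrightarrow> z \<in> cball 0 k" using wulff_norm[of k, where 'a='a] k by (auto simp: wulff_def)
    finally show ?thesis .
  qed
  have "mbody ?L \<in> sets borel" unfolding mbody_def by (rule borel_closed[OF closed_wulff])
  from real[OF this iff] have "D * measure lborel (mbody ?L) = unit_ball_vol (real DIM('a)) * k ^ DIM('a)" using k by simp
  moreover have "D * measure lborel ?L = unit_ball_vol (real DIM('a))" using real[OF LL inL] by simp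
  ultimately show ?thesis using that D(1) by (simp add: k_def)
qed

section \<open>The inequality and its equality case\<close>

text \<open>Normalized form of the main result: \<open>r\<close> is the radius of the ball with the volume of
  \<open>L\<close>, and \<open>r\<^bsup>(n+p)/p\<^esup>\<close> is the radius of the moment body of that ball.\<close>

lemma mbody_inequality:
  fixes L :: "'a::euclidean_space set"
  assumes L: "star_body L" and r: "0 < r" and vol: "measure lborel L = unit_ball_vol (real DIM('a)) * r ^ DIM('a)"
  defines "m \<equiv> unit_ball_vol (real DIM('a)) * (r powr ((real DIM('a) + p) / p)) ^ DIM('a)"
  shows "m \<le> measure lborel (mbody L)"
    and "measure lborel (mbody L) = m \<Longrightarrow> centered_ellipsoid L"
proof -
  obtain r0 R where S: "sandwiched r0 R L" and R: "r \<le> R" using star_body_sandwiched[OF L] by blast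
  have LL: "L \<in> sets borel" "L \<subseteq> cball 0 R" and R0: "0 \<le> R" using S by auto
  have fin: "emeasure lborel L < \<infinity>"
    using emeasure_mono[OF LL(2), of lborel] emeasure_compact_finite[of "cball (0::'a) R"] by (auto intro: le_less_trans)
  have volL: "emeasure lborel L = emeasure lborel (ball (0::'a) r)"
    using vol r fin by (subst emeasure_eq_ennreal_measure) (auto simp: emeasure_ball)
  have m: "m = measure lborel (cball (0::'a) (r powr ((real DIM('a) + p) / p)))"
    by (simp add: m_def content_cball)
  show ge: "m \<le> measure lborel (mbody L)"
    unfolding m by (rule measure_mbody_ge[OF S r R volL])
  assume eq: "measure lborel (mbody L) = m"
  have eqS: "measure lborel (mbody (steiner e L)) = measure lborel (mbody L)" if e: "norm e = 1" for e
  proof (rule antisym)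
    show "measure lborel (mbody (steiner e L)) \<le> measure lborel (mbody L)"
      by (rule measure_mbody_steiner_le[OF S e])
    have "emeasure lborel (steiner e L) = emeasure lborel (ball (0::'a) r)"
      using emeasure_steiner[OF LL e] volL by simp
    from measure_mbody_ge[OF sandwiched_steiner[OF S e] r R this]
    show "measure lborel (mbody L) \<le> measure lborel (mbody (steiner e L))" by (simp add: eq m)
  qed
  have sym: "- x \<in> L" if "x \<in> L" for x
    by (rule symmetric_of_equality[OF L S eqS that])
  show "centered_ellipsoid L"
  proof (rule ellipsoid_of_reflections[OF L])
    fix e :: 'a assume e: "norm e = 1"
    obtain u where u: "u \<bullet> e = 1" "AE x in lborel. x \<in> slab e \<longrightarrow> (\<exists>l.
        emeasure lborel ({- (u \<bullet> x) - l<..<- (u \<bullet> x) + l} - {t. x + t *\<^sub>R e \<in> L}) = 0 \<and>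
        emeasure lborel ({t. x + t *\<^sub>R e \<in> L} - {- (u \<bullet> x) - l<..<- (u \<bullet> x) + l}) = 0)"
      by (rule chords_centred_of_equality[OF S _ e eqS[OF e]]) (use sym in auto)
    then show "\<exists>u. u \<bullet> e = 1 \<and> (\<forall>z\<in>L. oblique_reflection e u z \<in> L)"
      using star_body_reflection_invariant[OF L e u] by blast
  qed
qed

text \<open>With \<open>V(L) = V(B) r\<^sup>n\<close>, all powers of \<open>r\<close> cancel in the product of \<open>V(L)\<^bsup>-n/p-1\<^esup>\<close> with
  the minimal volume \<open>V(B) r\<^bsup>n(n+p)/p\<^esup>\<close>.\<close>

lemma mbody_ratio:
  fixes L :: "'a::euclidean_space set"
  assumes L: "star_body L"
  defines "n \<equiv> real DIM('a)"
  defines "V \<equiv> unit_ball_vol n"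
  defines "F \<equiv> measure lborel L powr (- n / p - 1) * measure lborel (mbody L)"
  shows "V powr (- n / p) \<le> F \<and> (F = V powr (- n / p) \<longleftrightarrow> centered_ellipsoid L)"
proof -
  have n: "n > 0" by (simp add: n_def)
  have V: "V > 0" by (simp add: V_def n_def unit_ball_vol_pos)
  obtain r0 R where S: "sandwiched r0 R L" using star_body_sandwiched[OF L, of 0] by blast
  have mL: "measure lborel L > 0"
  proof -
    have "measure lborel (ball (0::'a) r0) \<le> measure lborel L"
      using sandwichedD[OF S] emeasure_compact_finite[of "cball (0::'a) R"]
      by (intro measure_mono_fmeasurable fmeasurableI2[OF _ sandwichedD(3)[OF S]] fmeasurableI) auto
    moreover have "measure lborel (ball (0::'a) r0) > 0"
      using sandwichedD(4)[OF S] by (simp add: content_ball unit_ball_vol_pos)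
    ultimately show ?thesis by linarith
  qed
  define r where "r = (measure lborel L / V) powr (1 / n)"
  have r: "r > 0" using mL V by (simp add: r_def)
  have rn: "r powr n = measure lborel L / V" using mL V n by (simp add: r_def powr_powr)
  then have vol: "measure lborel L = V * r powr n" using V by simp
  have vol': "measure lborel L = unit_ball_vol (real DIM('a)) * r ^ DIM('a)"
    using vol r by (simp add: V_def n_def powr_realpow)
  define m where "m = V * r powr (n * ((n + p) / p))"
  have m': "unit_ball_vol (real DIM('a)) * (r powr ((real DIM('a) + p) / p)) ^ DIM('a) = m"
    using r by (simp add: m_def V_def n_def powr_powr mult.commute flip: powr_realpow)
  have key: "measure lborel L powr (- n / p - 1) * m = V powr (- n / p)"
  proof -
    have "measure lborel L powr (- n / p - 1) * m = (V powr (- n / p - 1) * V) * (r powr (n * (- n / p - 1)) * r powr (n * ((n + p) / p)))"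
      using V r by (simp add: vol m_def powr_mult powr_powr)
    also have "V powr (- n / p - 1) * V = V powr (- n / p)" using V by (simp add: powr_diff)
    also have "r powr (n * (- n / p - 1)) * r powr (n * ((n + p) / p)) = 1"
    proof -
      have "n * (- n / p - 1) + n * ((n + p) / p) = 0" using p by (simp add: field_simps)
      then show ?thesis using r by (simp flip: powr_add)
    qed
    finally show ?thesis by simp
  qed
  define c where "c = measure lborel L powr (- n / p - 1)"
  have c: "c > 0" using mL by (simp add: c_def)
  have ge: "m \<le> measure lborel (mbody L)" and eq: "measure lborel (mbody L) = m \<Longrightarrow> centered_ellipsoid L"
    using mbody_inequality[OF L r vol'] by (simp_all add: m')
  have "V powr (- n / p) \<le> F"
    unfolding F_def key[symmetric] c_def[symmetric] using ge c by simp
  moreover have "F = V powr (- n / p) \<longleftrightarrow> measure lborel (mbody L) = m"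
    unfolding F_def key[symmetric] c_def[symmetric] using c by simp
  moreover have "measure lborel (mbody L) = m" if ell: "centered_ellipsoid L"
  proof -
    obtain f :: "'a \<Rightarrow> 'a" where f: "linear f" "bij f" "L = f ` cball 0 1"
      using ell by (auto simp: centered_ellipsoid_def)
    obtain D where D: "0 < D" "D * measure lborel L = V" "D * measure lborel (mbody L) = V * (D powr (- 1 / p)) ^ DIM('a)"
      using measure_mbody_ellipsoid[OF f(1,2)] unfolding f(3) V_def n_def by metis
    have Dr: "D = r powr (- n)"
    proof -
      have "D * r powr n = 1" using D(2) V by (simp add: vol)
      then show ?thesis using r by (simp add: powr_minus field_simps)
    qed
    have "measure lborel (mbody L) = V * ((r powr (- n)) powr (- 1 / p)) powr n / r powr (- n)"
      using D(1,3) r unfolding Dr by (simp add: n_def powr_realpow field_simps)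
    also have "\<dots> = V * (r powr (n / p * n) * r powr n)"
    proof -
      have "((r powr (- n)) powr (- 1 / p)) powr n = r powr (n / p * n)"
        using r by (simp only: powr_powr) simp
      moreover have "x / r powr (- n) = x * r powr n" for x
        using r by (simp add: powr_minus divide_inverse)
      ultimately show ?thesis by (simp add: mult.assoc)
    qed
    also have "r powr (n / p * n) * r powr n = r powr (n * ((n + p) / p))"
    proof -
      have "n / p * n + n = n * ((n + p) / p)" using p by (simp add: field_simps)
      then show ?thesis by (simp only: powr_add[symmetric])
    qed
    finally show ?thesis by (simp add: m_def)
  qed
  ultimately show ?thesis using eq by blast
qed

end

theorem theorem6p4:
  fixes L :: "(real ^ 'n) set" and p \<tau> :: real
  assumes "CARD('n) \<ge> 3" and "1 < p" and "star_body L" and "\<tau> \<in> {-1..1}"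
  shows "measure lebesgue L powr (- real CARD('n) / p - 1) * measure lebesgue (moment_body p \<tau> L)
           \<ge> measure lebesgue (cball 0 1 :: (real ^ 'n) set) powr (- real CARD('n) / p)
    \<and> (measure lebesgue L powr (- real CARD('n) / p - 1) * measure lebesgue (moment_body p \<tau> L)
           = measure lebesgue (cball 0 1 :: (real ^ 'n) set) powr (- real CARD('n) / p)
         \<longleftrightarrow> centered_ellipsoid L)"
proof -
  interpret moment_weight p \<tau>
    using assms by unfold_locales auto
  obtain r R where S: "sandwiched r R L" using star_body_sandwiched[OF assms(3), of 0] by blast
  have "measure lebesgue L = measure lborel L"
    using sandwichedD(1)[OF S] by simp
  moreover have "measure lebesgue (moment_body p \<tau> L) = measure lborel (mbody L)"
    using mbody_borel[OF S] by (simp add: moment_body_eq[OF assms(3)])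
  moreover have "measure lebesgue (cball 0 1 :: (real ^ 'n) set) = unit_ball_vol (real DIM(real ^ 'n))"
    by (simp add: content_cball)
  ultimately show ?thesis
    using mbody_ratio[OF assms(3)] by simp
qed

end
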